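(* Let $\lambda\in(0,\infty)$ and let $f_0:I\to\mathbb{R}^n$ be a smooth regular closed curve, where $I=[0,2\pi]\simeq S^1$. Consider the flow $$\partial_t f=-\nabla_s^2\vec\kappa-\tfrac12|\vec\kappa|^2\vec\kappa+\lambda\frac{f_{xx}}{|f_x|},\qquad f(0,\cdot)=f_0. \qquad (\ast)$$ Assume that for every smooth regular closed initial curve there is some (small) time $T>0$ such that the flow $(\ast)$ starting from that curve exists on $[0,T]$ and is smooth and regular on $[0,T]\times I$. Then the flow $(\ast)$ starting from $f_0$ has a global solution, i.e. there is a smooth $f:[0,\infty)\times I\to\mathbb{R}^n$, with each $f(t,\cdot)$ a regular closed curve, which solves $(\ast)$ for all times.
   Context: $I=[0,2\pi]\simeq S^1$; closed curves are $2\pi$-periodic maps $f=f(x)$, and a curve is regular if $|f_x|>0$ everywhere. For a smooth regular curve $f$: $ds=|f_x|\,dx$ is the length element, $\partial_s=\frac{1}{|f_x|}\partial_x$ is the arc length derivative, $\tau=\partial_s f=f_x/|f_x|$ is the unit tangent, $\vec\kappa=\partial_s^2 f$ is the curvature vector. For a vector field $\vec\phi:I\to\mathbb{R}^n$ along $f$, $\nabla_s\vec\phi=\partial_s\vec\phi-\langle\partial_s\vec\phi,\tau\rangle\tau$ is the normal component of its arc length derivative, and $\nabla_s^2=\nabla_s\nabla_s$. For a time-dependent family $f=f(t,x)$ all these quantities are computed at each fixed time $t$. The flow $(\ast)$ is the $L^2$-gradient flow (with respect to $ds$) of $\mathcal{D}_\lambda(f)=\frac12\int_I|\vec\kappa|^2\,ds+\frac{\lambda}{2}\int_I|f_x|^2\,dx$.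 The time $T$ in the short-time existence assumption may depend on the initial curve. *)

theory Defs
  imports "HOL-Analysis.Analysis"
begin

section \<open>Smoothness\<close>

text \<open>Derivatives are taken within \<open>S\<close>, hence one-sided on the boundary. On the sets used below,
  \<open>UNIV\<close> and \<open>J \<times> UNIV\<close> with \<open>J\<close> a nondegenerate interval, they are unique and the domain is
  finite-dimensional, so that \<open>Ck_on k S\<close> is the usual class of functions whose partial
  derivatives up to order \<open>k\<close> exist and are continuous on \<open>S\<close>.\<close>

primrec Ck_on :: "nat \<Rightarrow> 'a::real_normed_vector set \<Rightarrow> ('a \<Rightarrow> 'b::real_normed_vector) \<Rightarrow> bool" where
  "Ck_on 0 S f \<longleftrightarrow> continuous_on S f"
| "Ck_on (Suc k) S f \<longleftrightarrow>
    (\<exists>f'. (\<forall>x\<in>S. (f has_derivative f' x) (at x within S)) \<and> (\<forall>v. Ck_on k S (\<lambda>x. f' x v)))"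

definition smooth_on :: "'a::real_normed_vector set \<Rightarrow> ('a \<Rightarrow> 'b::real_normed_vector) \<Rightarrow> bool" where
  "smooth_on S f \<longleftrightarrow> (\<forall>k. Ck_on k S f)"

section \<open>Geometry of curves\<close>

text \<open>Closed curves, i.e. maps on the circle \<open>[0, 2\<pi>]\<close> with identified endpoints, are represented
  by their \<open>2\<pi>\<close>-periodic extensions to the real line.\<close>

abbreviation deriv_x :: "(real \<Rightarrow> 'a::real_normed_vector) \<Rightarrow> real \<Rightarrow> 'a" where
  "deriv_x f x \<equiv> vector_derivative f (at x)"

definition smooth_regular_closed_curve :: "(real \<Rightarrow> 'a::real_normed_vector) \<Rightarrow> bool" where
  "smooth_regular_closed_curve f \<longleftrightarrow>
     smooth_on UNIV f \<and> (\<forall>x. f (x + 2 * pi) = f x) \<and> (\<forall>x. norm (deriv_x f x) > 0)"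

definition deriv_s :: "(real \<Rightarrow> 'a::real_normed_vector) \<Rightarrow> (real \<Rightarrow> 'a) \<Rightarrow> real \<Rightarrow> 'a" where
  "deriv_s f \<phi> x = (1 / norm (deriv_x f x)) *\<^sub>R deriv_x \<phi> x"

definition tangent :: "(real \<Rightarrow> 'a::real_normed_vector) \<Rightarrow> real \<Rightarrow> 'a" where
  "tangent f = deriv_s f f"

definition curvature :: "(real \<Rightarrow> 'a::real_normed_vector) \<Rightarrow> real \<Rightarrow> 'a" where
  "curvature f = deriv_s f (deriv_s f f)"

definition nabla_s :: "(real \<Rightarrow> 'a::real_inner) \<Rightarrow> (real \<Rightarrow> 'a) \<Rightarrow> real \<Rightarrow> 'a" where
  "nabla_s f \<phi> x = deriv_s f \<phi> x - (deriv_s f \<phi> x \<bullet> tangent f x) *\<^sub>R tangent f x"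

section \<open>The flow\<close>

definition flow_velocity :: "real \<Rightarrow> (real \<Rightarrow> 'a::real_inner) \<Rightarrow> real \<Rightarrow> 'a" where
  "flow_velocity lam f x =
     - nabla_s f (nabla_s f (curvature f)) x
     - (1/2 * (norm (curvature f x))\<^sup>2) *\<^sub>R curvature f x
     + (lam / norm (deriv_x f x)) *\<^sub>R deriv_x (deriv_x f) x"

text \<open>\<open>J\<close> is the time interval, \<open>{0..T}\<close> or \<open>{0..}\<close>; the time derivative is one-sided at its
  endpoints.\<close>

definition flow_solution ::
    "real \<Rightarrow> (real \<Rightarrow> 'a::real_inner) \<Rightarrow> real set \<Rightarrow> (real \<Rightarrow> real \<Rightarrow> 'a) \<Rightarrow> bool" where
  "flow_solution lam f0 J f \<longleftrightarrow>
     smooth_on (J \<times> UNIV) (\<lambda>(t, x). f t x) \<and>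
     (\<forall>t\<in>J. smooth_regular_closed_curve (f t)) \<and>
     (\<forall>t\<in>J. \<forall>x. ((\<lambda>s. f s x) has_vector_derivative flow_velocity lam (f t) x) (at t within J)) \<and>
     f 0 = f0"

end

theory Submission
  imports Defs
begin

text \<open>Let \<open>w = |f\<^sub>x|\<close>, let \<open>T\<close> be the tangent and \<open>K\<close> the curvature vector. The flow reads
  \<open>f\<^sub>t = V + lam w\<^sub>s T\<close> with a normal field \<open>V = - K\<^sub>s\<^sub>s + lower order\<close>, and the material derivative
  \<open>D u = u\<^sub>t - lam w\<^sub>s u\<^sub>s\<close> removes the tangential motion: with \<open>g = \<langle>K, V\<rangle>\<close> one has
  \<open>[D, \<partial>\<^sub>s] = g \<partial>\<^sub>s\<close>, \<open>D T = V\<^sub>s + g T\<close>, and \<open>D (ln w) = lam w (ln w)\<^sub>s\<^sub>s - g\<close>.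
  The energy identity bounds \<open>K\<close> and the length and makes \<open>\<integral>|V|\<^sup>2\<close> and \<open>\<integral>w\<^sub>s\<^sup>2\<close> integrable in time. Interpolation
  and Gronwall's inequality then bound \<open>K\<^sub>s\<close>; the equation for \<open>ln w\<close> bounds \<open>w\<close> from above and below.
  Higher derivatives follow alternately from the fourth-order equation of \<open>T\<close> and the second-order
  equation of \<open>w\<close>, the coupling being triangular. Hence on a bounded time interval all derivatives stay
  bounded, the solution extends smoothly to the closed interval and is continued by short-time
  existence; as uniqueness is not assumed, a maximal solution is chosen by Zorn's lemma.\<close>

section \<open>Functions of time and space\<close>

text \<open>The obstacle is a coupling of two orders: the normal part of the flow is of fourth order
  in the curve, while the parametrization moves by a second-order equation for \<open>w\<close>
  whose forcing \<open>g\<close> contains two derivatives of \<open>K\<close>. At a fixed time the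
  energy gives no pointwise bound of \<open>w\<close>, so the first estimates must get along with
  \<open>w\<close> square integrable in time. This works because \<open>w\<close> enters the
  equation of \<open>T\<close> only through the lower-order term \<open>lam w K\<close>. The order
  of the estimates is forced: a bound of \<open>K_s\<close> makes \<open>g\<close> and
  \<open>g_s\<close> square integrable, this controls \<open>ln w\<close>, and only then is the
  equation of \<open>w\<close> known to be uniformly parabolic. Two facts about closed curves start
  the argument: the Dirichlet part of the energy bounds the length from above, and closedness
  together with the curvature bound keeps it away from zero, which makes the Sobolev constants
  uniform. All norms are taken with respect to arc length and are converted to derivatives in
  \<open>x\<close> at the very end, once the derivatives of \<open>w\<close> are bounded as
  well.\<close>

definition dx :: "(real \<Rightarrow> real \<Rightarrow> 'a::real_normed_vector) \<Rightarrow> real \<Rightarrow> real \<Rightarrow> 'a" where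
  "dx u t = deriv_x (u t)"

definition cont_per :: "real set \<Rightarrow> (real \<Rightarrow> real \<Rightarrow> 'a::real_normed_vector) \<Rightarrow> bool" where
  "cont_per J u \<longleftrightarrow> continuous_on (J \<times> UNIV) (\<lambda>(t, x). u t x) \<and> (\<forall>t\<in>J. \<forall>x. u t (x + 2 * pi) = u t x)"

primrec CX :: "nat \<Rightarrow> real set \<Rightarrow> (real \<Rightarrow> real \<Rightarrow> 'a::real_normed_vector) \<Rightarrow> bool" where
  "CX 0 J u \<longleftrightarrow> cont_per J u"
| "CX (Suc n) J u \<longleftrightarrow> cont_per J u \<and>
     (\<exists>v. CX n J v \<and> (\<forall>t\<in>J. \<forall>x. (u t has_vector_derivative v t x) (at x)))"

text \<open>The two variables are treated unequally: every level demands all space derivatives, and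
  only time derivatives are counted. On a time interval the class is then closed under
  \<open>dx\<close> without loss, and the velocity of the flow, four space derivatives deep, stays
  in the class of the curve.\<close>

primrec CT :: "nat \<Rightarrow> real set \<Rightarrow> (real \<Rightarrow> real \<Rightarrow> 'a::real_normed_vector) \<Rightarrow> bool" where
  "CT 0 J u \<longleftrightarrow> (\<forall>n. CX n J u)"
| "CT (Suc k) J u \<longleftrightarrow> (\<forall>n. CX n J u) \<and>
     (\<exists>v. CT k J v \<and> (\<forall>t\<in>J. \<forall>x. ((\<lambda>s. u s x) has_vector_derivative v t x) (at t within J)))"

lemma cont_per_cong: "cont_per J u \<Longrightarrow> (\<And>t x. t \<in> J \<Longrightarrow> u t x = v t x) \<Longrightarrow> cont_per J v"
  unfolding cont_per_def by (auto elim!: continuous_on_eq)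

lemma CX_cong: "CX n J u \<Longrightarrow> (\<And>t x. t \<in> J \<Longrightarrow> u t x = v t x) \<Longrightarrow> CX n J v"
proof (cases n)
  case (Suc m)
  assume *: "CX n J u" "\<And>t x. t \<in> J \<Longrightarrow> u t x = v t x"
  then have "t \<in> J \<Longrightarrow> u t = v t" for t by auto
  then show ?thesis using * cont_per_cong[of J u v] unfolding Suc by auto
qed (auto intro: cont_per_cong)

lemma CT_cong: "CT k J u \<Longrightarrow> (\<And>t x. t \<in> J \<Longrightarrow> u t x = v t x) \<Longrightarrow> CT k J v"
proof (cases k)
  case (Suc m)
  assume *: "CT k J u" "\<And>t x. t \<in> J \<Longrightarrow> u t x = v t x"
  have "((\<lambda>s. v s x) has_vector_derivative w) (at t within J)"
    if "((\<lambda>s. u s x) has_vector_derivative w) (at t within J)" "t \<in> J" for w t x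
    by (rule has_vector_derivative_transform[OF that(2) _ that(1)]) (use * in auto)
  then show ?thesis using * CX_cong[of _ J u v] unfolding Suc by (auto; blast)
qed (auto intro: CX_cong)

lemma CX_cont_per: "CX n J u \<Longrightarrow> cont_per J u"
  by (cases n) auto

lemma CX_Suc_D: "CX (Suc n) J u \<Longrightarrow> CX n J u"
  by (induction n arbitrary: u) auto

lemma CT_smooth: "CT k J u \<Longrightarrow> CT 0 J u"
  by (cases k) auto

lemma CT_CX: "CT k J u \<Longrightarrow> CX n J u"
  by (cases k) auto

lemma CT_Suc_D: "CT (Suc n) J u \<Longrightarrow> CT n J u"
  by (induction n arbitrary: u) auto

lemma CX_dx:
  assumes "CX (Suc n) J u"
  shows "CX n J (dx u)" "\<And>t x. t \<in> J \<Longrightarrow> (u t has_vector_derivative dx u t x) (at x)"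
proof -
  obtain v where v: "CX n J v" "\<forall>t\<in>J. \<forall>x. (u t has_vector_derivative v t x) (at x)"
    using assms by auto
  then have e: "t \<in> J \<Longrightarrow> v t x = dx u t x" for t x
    by (metis dx_def vector_derivative_at)
  show "CX n J (dx u)" by (rule CX_cong[OF v(1) e])
  show "\<And>t x. t \<in> J \<Longrightarrow> (u t has_vector_derivative dx u t x) (at x)" using v e by auto
qed

lemma CX_SucI:
  assumes "cont_per J u" "CX n J v" "\<And>t x. t \<in> J \<Longrightarrow> (u t has_vector_derivative v t x) (at x)"
  shows "CX (Suc n) J u"
  using assms by auto

lemma CT_SucI:
  assumes "\<And>n. CX n J u" "CT k J v"
    "\<And>t x. t \<in> J \<Longrightarrow> ((\<lambda>s. u s x) has_vector_derivative v t x) (at t within J)"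
  shows "CT (Suc k) J u"
  using assms by auto

lemma CT_SucE:
  assumes "CT (Suc k) J u"
  obtains v where "CT k J v"
    "\<And>t x. t \<in> J \<Longrightarrow> ((\<lambda>s. u s x) has_vector_derivative v t x) (at t within J)"
  using assms by auto

section \<open>Closure of the regularity classes under algebraic operations\<close>

lemma cont_per_const [simp]: "cont_per J (\<lambda>t x. c)"
  by (auto simp: cont_per_def)

lemma CX_const [simp]: "CX n J (\<lambda>t x. c)"
  by (induction n arbitrary: c) (auto intro!: exI[of _ "\<lambda>_ _. 0"] derivative_eq_intros)

lemma CT_const [simp]: "CT k J (\<lambda>t x. c)"
  by (induction k arbitrary: c) (auto intro!: exI[of _ "\<lambda>_ _. 0"] derivative_eq_intros)

lemma cont_per_add: "cont_per J u \<Longrightarrow> cont_per J v \<Longrightarrow> cont_per J (\<lambda>t x. u t x + v t x)"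
  by (auto simp: cont_per_def case_prod_beta' intro!: continuous_intros)

lemma CX_add: "CX n J u \<Longrightarrow> CX n J v \<Longrightarrow> CX n J (\<lambda>t x. u t x + v t x)"
proof (induction n arbitrary: u v)
  case (Suc n)
  from CX_dx[OF Suc.prems(1)] CX_dx[OF Suc.prems(2)] Suc show ?case
    by (intro CX_SucI[where v = "\<lambda>t x. dx u t x + dx v t x"] cont_per_add)
       (auto intro!: derivative_eq_intros simp: has_vector_derivative_add)
qed (simp add: cont_per_add)

lemma CT_add: "CT n J u \<Longrightarrow> CT n J v \<Longrightarrow> CT n J (\<lambda>t x. u t x + v t x)"
proof (induction n arbitrary: u v)
  case (Suc n)
  obtain u' where u: "CT n J u'" "\<And>t x. t \<in> J \<Longrightarrow> ((\<lambda>s. u s x) has_vector_derivative u' t x) (at t within J)"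
    using CT_SucE[OF Suc.prems(1)] by metis
  obtain v' where v: "CT n J v'" "\<And>t x. t \<in> J \<Longrightarrow> ((\<lambda>s. v s x) has_vector_derivative v' t x) (at t within J)"
    using CT_SucE[OF Suc.prems(2)] by metis
  show ?case
    by (rule CT_SucI[where v = "\<lambda>t x. u' t x + v' t x"])
      (intro CX_add has_vector_derivative_add Suc.IH u v CT_CX[OF Suc.prems(1)] CT_CX[OF Suc.prems(2)]; assumption)+
qed (simp add: CX_add)

context bounded_bilinear
begin

lemma cont_per: "cont_per J u \<Longrightarrow> cont_per J v \<Longrightarrow> cont_per J (\<lambda>t x. prod (u t x) (v t x))"
  by (auto simp: cont_per_def case_prod_beta' intro!: continuous_on)

lemma CX: "CX n J u \<Longrightarrow> CX n J v \<Longrightarrow> CX n J (\<lambda>t x. prod (u t x) (v t x))"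
proof (induction n arbitrary: u v)
  case (Suc n)
  note u = CX_dx[OF Suc.prems(1)] and v = CX_dx[OF Suc.prems(2)]
  show ?case
  proof (rule CX_SucI)
    show "CX n J (\<lambda>t x. prod (u t x) (dx v t x) + prod (dx u t x) (v t x))"
      by (intro CX_add Suc.IH u v CX_Suc_D[OF Suc.prems(1)] CX_Suc_D[OF Suc.prems(2)])
    show "cont_per J (\<lambda>t x. prod (u t x) (v t x))"
      by (rule cont_per[OF CX_cont_per[OF Suc.prems(1)] CX_cont_per[OF Suc.prems(2)]])
    show "((\<lambda>x. prod (u t x) (v t x)) has_vector_derivative
      prod (u t x) (dx v t x) + prod (dx u t x) (v t x)) (at x)" if "t \<in> J" for t x
      by (rule has_vector_derivative[OF u(2)[OF that] v(2)[OF that]])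
  qed
qed (simp add: cont_per)

lemma CT: "CT n J u \<Longrightarrow> CT n J v \<Longrightarrow> CT n J (\<lambda>t x. prod (u t x) (v t x))"
proof (induction n arbitrary: u v)
  case (Suc n)
  obtain u' where u: "CT n J u'" "\<And>t x. t \<in> J \<Longrightarrow> ((\<lambda>s. u s x) has_vector_derivative u' t x) (at t within J)"
    using CT_SucE[OF Suc.prems(1)] by metis
  obtain v' where v: "CT n J v'" "\<And>t x. t \<in> J \<Longrightarrow> ((\<lambda>s. v s x) has_vector_derivative v' t x) (at t within J)"
    using CT_SucE[OF Suc.prems(2)] by metis
  show ?case
  proof (rule CT_SucI)
    show "CT n J (\<lambda>t x. prod (u t x) (v' t x) + prod (u' t x) (v t x))"
      by (intro CT_add Suc.IH u v CT_Suc_D[OF Suc.prems(1)] CT_Suc_D[OF Suc.prems(2)])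
    show "CX k J (\<lambda>t x. prod (u t x) (v t x))" for k
      by (rule CX[OF CT_CX[OF Suc.prems(1)] CT_CX[OF Suc.prems(2)]])
    show "((\<lambda>s. prod (u s x) (v s x)) has_vector_derivative
      prod (u t x) (v' t x) + prod (u' t x) (v t x)) (at t within J)" if "t \<in> J" for t x
      by (rule has_vector_derivative[OF u(2)[OF that] v(2)[OF that]])
  qed
qed (simp add: CX)

end

lemmas CT_scaleR = bounded_bilinear.CT[OF bounded_bilinear_scaleR]
lemmas CT_inner = bounded_bilinear.CT[OF bounded_bilinear_inner]
lemmas CT_mult = bounded_bilinear.CT[OF bounded_bilinear_mult]

lemma CT_minus: "CT n J u \<Longrightarrow> CT n J (\<lambda>t x. - u t x)"
  using CT_scaleR[of n J "\<lambda>_ _. -1" u] by simp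

lemma CT_diff: "CT n J u \<Longrightarrow> CT n J v \<Longrightarrow> CT n J (\<lambda>t x. u t x - v t x)"
  using CT_add[OF _ CT_minus, of n J u v] by simp

lemma cont_per_powr:
  "cont_per J u \<Longrightarrow> (\<And>t x. t \<in> J \<Longrightarrow> u t x > (0::real)) \<Longrightarrow> cont_per J (\<lambda>t x. u t x powr a)"
  by (auto simp: cont_per_def case_prod_beta' intro!: continuous_intros) (metis less_irrefl)

text \<open>The derivative of a power is a power with exponent lowered by one, so the induction runs
  over all exponents at once. Inverses and square roots, hence norms of nonvanishing fields, are the
  exponents -1 and 1/2.\<close>

lemma CX_powr:
  "CX n J u \<Longrightarrow> (\<And>t x. t \<in> J \<Longrightarrow> u t x > (0::real)) \<Longrightarrow> CX n J (\<lambda>t x. u t x powr a)"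
proof (induction n arbitrary: a)
  case (Suc n)
  note u = CX_dx[OF Suc.prems(1)]
  show ?case
  proof (rule CX_SucI)
    show "CX n J (\<lambda>t x. a * (u t x powr (a - 1) * dx u t x))"
      by (intro bounded_bilinear.CX[OF bounded_bilinear_mult] CX_const Suc.IH u CX_Suc_D[OF Suc.prems(1)] Suc.prems(2))
    show "cont_per J (\<lambda>t x. u t x powr a)"
      by (rule cont_per_powr) (use Suc in auto)
    show "((\<lambda>x. u t x powr a) has_vector_derivative a * (u t x powr (a - 1) * dx u t x)) (at x)" if "t \<in> J" for t x
      using u(2)[OF that, of x] Suc.prems(2)[OF that, of x]
      unfolding has_real_derivative_iff_has_vector_derivative[symmetric]
      by (auto intro!: derivative_eq_intros)
  qed
qed (simp add: cont_per_powr)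

lemma CT_powr:
  "CT n J u \<Longrightarrow> (\<And>t x. t \<in> J \<Longrightarrow> u t x > (0::real)) \<Longrightarrow> CT n J (\<lambda>t x. u t x powr a)"
proof (induction n arbitrary: a)
  case (Suc n)
  obtain u' where u: "CT n J u'" "\<And>t x. t \<in> J \<Longrightarrow> ((\<lambda>s. u s x) has_vector_derivative u' t x) (at t within J)"
    using CT_SucE[OF Suc.prems(1)] by metis
  show ?case
  proof (rule CT_SucI)
    show "CT n J (\<lambda>t x. a * (u t x powr (a - 1) * u' t x))"
      by (intro CT_mult CT_const Suc.IH u CT_Suc_D[OF Suc.prems(1)] Suc.prems(2))
    show "((\<lambda>s. u s x powr a) has_vector_derivative a * (u t x powr (a - 1) * u' t x)) (at t within J)"
      if "t \<in> J" for t x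
      using u(2)[OF that, of x] Suc.prems(2)[OF that, of x]
      unfolding has_real_derivative_iff_has_vector_derivative[symmetric]
      by (auto intro!: derivative_eq_intros)
  qed (intro CX_powr CT_CX[OF Suc.prems(1)] Suc.prems(2); assumption)+
qed (simp add: CX_powr)

lemma CX_ln:
  assumes "CX n J u" "\<And>t x. t \<in> J \<Longrightarrow> u t x > (0::real)" shows "CX n J (\<lambda>t x. ln (u t x))"
proof -
  have c: "cont_per J (\<lambda>t x. ln (u t x))"
    using CX_cont_per[OF assms(1)] assms(2)
    by (auto simp: cont_per_def case_prod_beta' intro!: continuous_intros) (metis less_irrefl)
  show ?thesis
  proof (cases n)
    case (Suc m)
    note u = CX_dx[OF assms(1)[unfolded Suc]]
    show ?thesis unfolding Suc
    proof (rule CX_SucI[OF c])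
      show "CX m J (\<lambda>t x. u t x powr (-1) * dx u t x)"
        using assms CX_Suc_D[of m J u] unfolding Suc
        by (intro bounded_bilinear.CX[OF bounded_bilinear_mult] u CX_powr) auto
      show "((\<lambda>x. ln (u t x)) has_vector_derivative u t x powr (-1) * dx u t x) (at x)" if "t \<in> J" for t x
        using u(2)[OF that, of x] assms(2)[OF that, of x]
        unfolding has_real_derivative_iff_has_vector_derivative[symmetric]
        by (auto intro!: derivative_eq_intros simp: powr_minus_divide)
    qed
  qed (simp add: c)
qed

lemma CT_ln:
  assumes "CT n J u" "\<And>t x. t \<in> J \<Longrightarrow> u t x > (0::real)" shows "CT n J (\<lambda>t x. ln (u t x))"
proof (cases n)
  case (Suc m)
  obtain u' where u: "CT m J u'" "\<And>t x. t \<in> J \<Longrightarrow> ((\<lambda>s. u s x) has_vector_derivative u' t x) (at t within J)"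
    using CT_SucE[OF assms(1)[unfolded Suc]] by metis
  show ?thesis unfolding Suc
  proof (rule CT_SucI)
    show "CT m J (\<lambda>t x. (u t x powr (-1) * u' t x))"
      by (intro CT_mult u CT_powr CT_Suc_D[OF assms(1)[unfolded Suc]] assms(2))
    show "((\<lambda>s. ln (u s x)) has_vector_derivative u t x powr (-1) * u' t x) (at t within J)"
      if "t \<in> J" for t x
      using u(2)[OF that, of x] assms(2)[OF that, of x]
      unfolding has_real_derivative_iff_has_vector_derivative[symmetric]
      by (auto intro!: derivative_eq_intros simp: powr_minus_divide)
  qed (intro CX_ln CT_CX[OF assms(1)] assms(2); assumption)+
qed (use assms in \<open>auto intro!: CX_ln\<close>)

lemma CT_inverse:
  assumes "CT n J u" "\<And>t x. t \<in> J \<Longrightarrow> u t x > (0::real)" shows "CT n J (\<lambda>t x. inverse (u t x))"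
  by (rule CT_cong[OF CT_powr[OF assms, where a = "-1"]]) 
     (use assms(2) in \<open>auto simp: powr_minus_divide field_simps less_imp_le\<close>)

lemma CT_sqrt:
  assumes "CT n J u" "\<And>t x. t \<in> J \<Longrightarrow> u t x > (0::real)" shows "CT n J (\<lambda>t x. sqrt (u t x))"
  by (rule CT_cong[OF CT_powr[OF assms, where a = "1/2"]]) 
     (use assms(2) in \<open>auto simp: powr_half_sqrt less_imp_le\<close>)

lemma CT_norm:
  fixes u :: "real \<Rightarrow> real \<Rightarrow> 'a::real_inner"
  assumes "CT n J u" "\<And>t x. t \<in> J \<Longrightarrow> u t x \<noteq> 0" shows "CT n J (\<lambda>t x. norm (u t x))"
  unfolding norm_eq_sqrt_inner by (intro CT_sqrt CT_inner) (use assms in auto)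

text \<open>These are exactly the intervals \<open>{0..<b}\<close> with \<open>b > 0\<close> and
  \<open>{0..}\<close>. The missing right endpoint leaves room to step forward from every time, and
  near each of its times \<open>J\<close> looks like a compact interval starting at 0, over which
  one can integrate.\<close>

definition time_interval :: "real set \<Rightarrow> bool" where
  "time_interval J \<longleftrightarrow> 0 \<in> J \<and> (\<forall>t\<in>J. 0 \<le> t \<and> (\<exists>b>t. {0..b} \<subseteq> J))"

lemma time_interval_within:
  assumes "time_interval J" "t \<in> J"
  obtains b where "b > t" "{0..b} \<subseteq> J" "t \<in> {0..b}" "at t within J = at t within {0..b}"
proof -
  obtain b where b: "b > t" "{0..b} \<subseteq> J" "0 \<le> t" using assms unfolding time_interval_def by blast
  have "at t within J = at t within {0..b}"
    by (rule at_within_nhd[of _ "{..<b}"]) (use b assms in \<open>auto simp: time_interval_def\<close>)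
  then show ?thesis using that b by auto
qed

section \<open>Exchange of space and time derivatives\<close>

lemma cont_per_slices:
  assumes "cont_per J u"
  shows "S \<subseteq> J \<Longrightarrow> continuous_on S (\<lambda>t. u t x)" "t \<in> J \<Longrightarrow> continuous_on A (u t)"
    "S \<subseteq> J \<Longrightarrow> continuous_on (S \<times> A) (\<lambda>(t, x). u t x)"
    "S \<subseteq> J \<Longrightarrow> continuous_on (A \<times> S) (\<lambda>(x, t). u t x)"
proof -
  have c: "continuous_on (J \<times> UNIV) (\<lambda>(t, x). u t x)" using assms by (simp add: cont_per_def)
  show "S \<subseteq> J \<Longrightarrow> continuous_on S (\<lambda>t. u t x)" 
    by (rule continuous_on_compose2[OF c, of _ "\<lambda>t. (t, x)", simplified]) (auto intro!: continuous_intros)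
  show "t \<in> J \<Longrightarrow> continuous_on A (u t)" 
    by (rule continuous_on_compose2[OF c, of _ "\<lambda>x. (t, x)", simplified]) (auto intro!: continuous_intros)
  show "S \<subseteq> J \<Longrightarrow> continuous_on (S \<times> A) (\<lambda>(t, x). u t x)"
    by (rule continuous_on_subset[OF c]) auto
  show "S \<subseteq> J \<Longrightarrow> continuous_on (A \<times> S) (\<lambda>(x, t). u t x)"
    using continuous_on_compose2[OF c, of "A \<times> S" "\<lambda>(x, t). (t, x)"] 
    by (force simp: case_prod_beta' intro!: continuous_intros)
qed

text \<open>The existence of the mixed derivative is part of the conclusion, so symmetry of second
  derivatives cannot be invoked. The time integral of \<open>v\<close> represents \<open>u\<close>;
  differentiating under the integral represents \<open>dx u\<close> as a time integral of
  \<open>dx v\<close>, which the fundamental theorem of calculus differentiates in time.\<close>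

lemma dx_dt_exchange:
  fixes u v :: "real \<Rightarrow> real \<Rightarrow> 'a::euclidean_space"
  assumes J: "time_interval J" and u: "CX 1 J u" and v: "CX 1 J v"
    and uv: "\<And>t x. t \<in> J \<Longrightarrow> ((\<lambda>s. u s x) has_vector_derivative v t x) (at t within J)"
    and t: "t \<in> J"
  shows "((\<lambda>s. dx u s x) has_vector_derivative dx v t x) (at t within J)"
proof -
  obtain b where b: "b > t" "{0..b} \<subseteq> J" "t \<in> {0..b}" "at t within J = at t within {0..b}"
    using time_interval_within[OF J t] by blast
  note u' = CX_dx[OF u[unfolded One_nat_def]] and v' = CX_dx[OF v[unfolded One_nat_def]]
  have cv: "cont_per J v" "cont_per J (dx v)" "cont_per J (dx u)"
    using v u CX_cont_per v'(1) u'(1) by auto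
  have eq: "u s y = u 0 y + integral {0..s} (\<lambda>r. v r y)" if "s \<in> {0..b}" for s y
  proof -
    have "((\<lambda>r. v r y) has_integral (u s y - u 0 y)) {0..s}"
    proof (rule fundamental_theorem_of_calculus)
      show "((\<lambda>r. u r y) has_vector_derivative v r y) (at r within {0..s})" if "r \<in> {0..s}" for r
        by (rule has_vector_derivative_within_subset[OF uv]) (use \<open>s \<in> _\<close> that b in auto)
    qed (use that in auto)
    then show ?thesis by (simp add: integral_unique)
  qed
  have dxu: "dx u s x = dx u 0 x + integral {0..s} (\<lambda>r. dx v r x)" if s: "s \<in> {0..b}" for s
  proof -
    have "((\<lambda>y. integral (cbox 0 s) (\<lambda>r. v r y)) has_vector_derivative integral (cbox 0 s) (\<lambda>r. dx v r x)) (at x within UNIV)"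
    proof (rule leibniz_rule_vector_derivative[where fx = "\<lambda>y r. dx v r y"])
      show "((\<lambda>y. v r y) has_vector_derivative dx v r y) (at y within UNIV)" if "r \<in> cbox 0 s" for r y
        proof -
        have "r \<in> J" using b(2) s that by force
        then show ?thesis using v'(2) by simp
      qed
      show "(\<lambda>r. v r y) integrable_on cbox 0 s" for y
        by (intro integrable_continuous cont_per_slices[OF cv(1)]) (use b s in auto)
      show "continuous_on (UNIV \<times> cbox 0 s) (\<lambda>(x, t). dx v t x)"
        by (rule cont_per_slices[OF cv(2)]) (use b s in auto)
    qed auto
    moreover have "(u 0 has_vector_derivative dx u 0 x) (at x)"
      by (rule u'(2)) (use b t in auto)
    ultimately have "((\<lambda>y. u 0 y + integral {0..s} (\<lambda>r. v r y)) has_vector_derivative dx u 0 x + integral {0..s} (\<lambda>r. dx v r x)) (at x)"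
      by (simp add: has_vector_derivative_add)
    then have "(u s has_vector_derivative dx u 0 x + integral {0..s} (\<lambda>r. dx v r x)) (at x)"
      by (subst ext[of "u s" "\<lambda>y. u 0 y + integral {0..s} (\<lambda>r. v r y)"]) (use eq[OF s] in auto)
    then show ?thesis by (simp add: dx_def vector_derivative_at)
  qed
  have "((\<lambda>s. dx u 0 x + integral {0..s} (\<lambda>r. dx v r x)) has_vector_derivative 0 + dx v t x) (at t within {0..b})"
    by (rule has_vector_derivative_add[OF has_vector_derivative_const integral_has_vector_derivative])
       (rule cont_per_slices(1)[OF cv(2) b(2)], rule b(3))
  then have "((\<lambda>s. dx u s x) has_vector_derivative 0 + dx v t x) (at t within {0..b})"
    by (rule has_vector_derivative_transform[OF b(3), rotated]) (rule dxu)
  then show ?thesis unfolding b(4) by simp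
qed

lemma CT_dx:
  fixes u :: "real \<Rightarrow> real \<Rightarrow> 'a::euclidean_space"
  assumes J: "time_interval J" 
  shows "CT k J u \<Longrightarrow> CT k J (dx u)"
proof (induction k arbitrary: u)
  case 0
  have "CX n J (dx u)" for n by (rule CX_dx(1)[OF CT_CX[OF 0]])
  then show ?case by simp
next
  case (Suc k)
  obtain v where v: "CT k J v" "\<And>t x. t \<in> J \<Longrightarrow> ((\<lambda>s. u s x) has_vector_derivative v t x) (at t within J)"
    using CT_SucE[OF Suc.prems] by metis
  show ?case
  proof (rule CT_SucI)
    show "CX n J (dx u)" for n by (rule CX_dx(1)[OF CT_CX[OF Suc.prems]])
    show "((\<lambda>s. dx u s x) has_vector_derivative dx v t x) (at t within J)" if "t \<in> J" for t x
      by (rule dx_dt_exchange[OF J CT_CX[OF Suc.prems] CT_CX[OF v(1)] v(2) that])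
  qed (rule Suc.IH[OF v(1)])
qed

section \<open>Smoothness and the flow\<close>

lemma Ck_on_cong: "Ck_on k S f \<Longrightarrow> (\<And>x. x \<in> S \<Longrightarrow> f x = g x) \<Longrightarrow> Ck_on k S g"
proof (cases k)
  case (Suc m)
  assume *: "Ck_on k S f" "\<And>x. x \<in> S \<Longrightarrow> f x = g x"
  have "(g has_derivative D) (at x within S)" if "(f has_derivative D) (at x within S)" "x \<in> S" for D x
    by (rule has_derivative_transform[OF that(2) _ that(1)]) (use * in auto)
  then show ?thesis using *(1) unfolding Suc Ck_on.simps by metis
qed (auto elim: continuous_on_eq)

lemma Ck_on_subset: "Ck_on k S f \<Longrightarrow> T \<subseteq> S \<Longrightarrow> Ck_on k T f"
proof (induction k arbitrary: f)
  case 0 then show ?case by (auto intro: continuous_on_subset)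
next
  case (Suc k)
  obtain f' where f': "\<forall>x\<in>S. (f has_derivative f' x) (at x within S)" "\<forall>v. Ck_on k S (\<lambda>x. f' x v)"
    using Suc.prems(1) by auto
  have "\<forall>x\<in>T. (f has_derivative f' x) (at x within T)"
    using f'(1) Suc.prems(2) by (blast intro: has_derivative_subset)
  moreover have "\<forall>v. Ck_on k T (\<lambda>x. f' x v)" using f'(2) Suc.IH Suc.prems(2) by blast
  ultimately show ?case by auto
qed

lemma smooth_on_subset: "smooth_on S f \<Longrightarrow> T \<subseteq> S \<Longrightarrow> smooth_on T f"
  unfolding smooth_on_def using Ck_on_subset by blast

lemma CX_imp_Ck_on: "CX n J u \<Longrightarrow> t \<in> J \<Longrightarrow> Ck_on n UNIV (u t)"
proof (induction n arbitrary: u)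
  case 0 then show ?case by (auto intro: cont_per_slices(2))
next
  case (Suc n)
  note u = CX_dx[OF Suc.prems(1)]
  have "Ck_on n UNIV (\<lambda>x. v *\<^sub>R dx u t x)" for v
    by (rule Suc.IH[where u = "\<lambda>t x. v *\<^sub>R dx u t x"])
      (intro bounded_bilinear.CX[OF bounded_bilinear_scaleR] CX_const u Suc.prems)+
  then show ?case using u(2)[OF Suc.prems(2)]
    by (auto simp: has_vector_derivative_def intro!: exI[of _ "\<lambda>x v. v *\<^sub>R dx u t x"])
qed

text \<open>Total differentiability from partial derivatives: continuity is used for the space
  derivative, while the time derivative enters at the given point alone. At time 0 it is one-sided,
  in accordance with the derivative within \<open>J \<times> UNIV\<close>.\<close>

lemma CT_imp_has_derivative:
  fixes u :: "real \<Rightarrow> real \<Rightarrow> 'a::real_normed_vector"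
  assumes u: "CX 1 J u" and v: "((\<lambda>s. u s x) has_vector_derivative v) (at t within J)" and t: "t \<in> J"
  shows "((\<lambda>(t, x). u t x) has_derivative (\<lambda>(a, b). a *\<^sub>R v + b *\<^sub>R dx u t x)) (at (t, x) within J \<times> UNIV)"
proof (rule has_derivative_eq_rhs[OF has_derivative_partialsI[where fy = "\<lambda>t x. blinfun_scaleR_left (dx u t x)"]])
  note u' = CX_dx[OF u[unfolded One_nat_def]]
  show "((\<lambda>s. u s x) has_derivative (\<lambda>h. h *\<^sub>R v)) (at t within J)"
    using v by (simp add: has_vector_derivative_def)
  show "((\<lambda>y. u t y) has_derivative blinfun_apply (blinfun_scaleR_left (dx u t y))) (at y within UNIV)" if "t \<in> J" for t y
    using u'(2)[OF that, of y] by (simp add: has_vector_derivative_def blinfun_scaleR_left.rep_eq)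
  have "continuous_on (J \<times> UNIV) (\<lambda>(t, x). dx u t x)" using CX_cont_per[OF u'(1)] by (simp add: cont_per_def)
  then have "continuous_on (J \<times> UNIV) (\<lambda>(t, x). blinfun_scaleR_left (dx u t x))"
    by (auto simp: case_prod_beta' intro!: continuous_intros)
  then show "continuous (at (t, x) within J \<times> UNIV) (\<lambda>(t, x). blinfun_scaleR_left (dx u t x))"
    using t by (auto simp: continuous_on_eq_continuous_within)
qed (auto simp: blinfun_scaleR_left.rep_eq)

lemma CT_imp_Ck_on:
  fixes u :: "real \<Rightarrow> real \<Rightarrow> 'a::euclidean_space"
  assumes J: "time_interval J"
  shows "CT k J u \<Longrightarrow> Ck_on k (J \<times> UNIV) (\<lambda>(t, x). u t x)"
proof (induction k arbitrary: u)
  case 0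
  from CT_CX[OF 0, of 0] show ?case by (auto simp: cont_per_def)
next
  case (Suc k)
  obtain v where v: "CT k J v" "\<And>t x. t \<in> J \<Longrightarrow> ((\<lambda>s. u s x) has_vector_derivative v t x) (at t within J)"
    using CT_SucE[OF Suc.prems] by metis
  define D where "D = (\<lambda>(t, x) (a, b). a *\<^sub>R v t x + b *\<^sub>R dx u t x)"
  have "((\<lambda>(t, x). u t x) has_derivative D p) (at p within J \<times> UNIV)" if p: "p \<in> J \<times> UNIV" for p
  proof -
    obtain t x where tx: "p = (t, x)" "t \<in> J" using p by auto
    show ?thesis using CT_imp_has_derivative[OF CT_CX[OF Suc.prems] v(2)[OF tx(2)] tx(2)]
      by (simp add: tx(1) D_def)
  qed
  moreover have "Ck_on k (J \<times> UNIV) (\<lambda>p. D p h)" for h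
  proof -
    have "CT k J (\<lambda>t x. fst h *\<^sub>R v t x + snd h *\<^sub>R dx u t x)"
      by (intro CT_add CT_scaleR CT_const v(1) CT_dx[OF J] CT_Suc_D[OF Suc.prems])
    from Suc.IH[OF this] show ?thesis
      by (rule Ck_on_cong) (auto simp: D_def split: prod.splits)
  qed
  ultimately show ?case by auto
qed

text \<open>Derivatives within a set are unique as soon as each basis direction offers arbitrarily
  short nonzero steps that stay in the set. Forward steps in time always exist, also at time
  0.\<close>

lemma time_interval_derivative_unique:
  assumes J: "time_interval J" and p: "p \<in> J \<times> UNIV"
    and d: "(f has_derivative f') (at p within J \<times> (UNIV::real set))"
      "(f has_derivative f'') (at p within J \<times> UNIV)"
  shows "f' = f''"
proof (rule frechet_derivative_unique_within[OF d])
  fix i :: "real \<times> real" and e :: real assume i: "i \<in> Basis" and e: "0 < e"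
  obtain t x where tx: "p = (t, x)" "t \<in> J" using p by auto
  obtain b where b: "b > t" "{0..b} \<subseteq> J" "t \<in> {0..b}" using time_interval_within[OF J tx(2)] by metis
  define d where "d = min (e/2) (b - t)"
  have "t + d \<in> {0..b}" using b e by (auto simp: d_def)
  then have "t + d \<in> J" using b by blast
  moreover have "i = (1, 0) \<or> i = (0, 1)" using i by (auto simp: Basis_prod_def)
  ultimately have "p + d *\<^sub>R i \<in> J \<times> UNIV" using tx by auto
  moreover have "0 < d" "d < e" using e b(1) by (simp_all add: d_def min_less_iff_disj)
  ultimately show "\<exists>d. 0 < \<bar>d\<bar> \<and> \<bar>d\<bar> < e \<and> p + d *\<^sub>R i \<in> J \<times> UNIV" by (intro exI[of _ d]) simp
qed

text \<open>\<open>Ck_on\<close> provides a derivative for each order separately. By uniqueness they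
  all equal \<open>D 0\<close>, whose values on the two coordinate directions are therefore smooth
  to every order. Uniqueness also hands periodicity on to them.\<close>

lemma smooth_on_partials:
  fixes u :: "real \<Rightarrow> real \<Rightarrow> 'a::real_normed_vector"
  assumes J: "time_interval J" and u: "smooth_on (J \<times> UNIV) (\<lambda>(t, x). u t x)"
    and per: "\<And>t x. t \<in> J \<Longrightarrow> u t (x + 2 * pi) = u t x"
  shows "\<exists>v w. smooth_on (J \<times> UNIV) (\<lambda>(t, x). v t x) \<and> (\<forall>t\<in>J. \<forall>x. v t (x + 2 * pi) = v t x) \<and>
    smooth_on (J \<times> UNIV) (\<lambda>(t, x). w t x) \<and> (\<forall>t\<in>J. \<forall>x. w t (x + 2 * pi) = w t x) \<and>
    (\<forall>t\<in>J. \<forall>x. (u t has_vector_derivative v t x) (at x) \<and>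
      ((\<lambda>s. u s x) has_vector_derivative w t x) (at t within J))"
proof -
  let ?S = "J \<times> (UNIV :: real set)" and ?u = "\<lambda>(t, x). u t x"
  have "\<forall>k. \<exists>D. (\<forall>p\<in>?S. (?u has_derivative D p) (at p within ?S)) \<and> (\<forall>h. Ck_on k ?S (\<lambda>p. D p h))"
    using u unfolding smooth_on_def by (metis Ck_on.simps(2))
  then obtain D where D: "\<And>k p. p \<in> ?S \<Longrightarrow> (?u has_derivative D k p) (at p within ?S)"
    "\<And>k h. Ck_on k ?S (\<lambda>p. D k p h)" by metis
  have eq: "D k p = D 0 p" if "p \<in> ?S" for k p
    by (rule time_interval_derivative_unique[OF J that D(1)[OF that] D(1)[OF that]])
  have sm: "smooth_on ?S (\<lambda>p. D 0 p h)" for h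
    unfolding smooth_on_def
  proof
    fix k show "Ck_on k ?S (\<lambda>p. D 0 p h)" by (rule Ck_on_cong[OF D(2)[of k h]]) (simp only: eq[of _ k])
  qed
  have ux: "(u t has_vector_derivative D 0 (t, x) (0, 1)) (at x)" if t: "t \<in> J" for t x
  proof -
    have "(?u \<circ> (\<lambda>y. (t, y)) has_derivative D 0 (t, x) \<circ> (\<lambda>h. (0, h))) (at x within UNIV)"
    proof (rule diff_chain_within)
      show "((\<lambda>y. (t, y)) has_derivative (\<lambda>h. (0, h))) (at x within UNIV)"
        by (auto intro!: derivative_eq_intros)
      show "(?u has_derivative D 0 (t, x)) (at (t, x) within range (\<lambda>y. (t, y)))"
        by (rule has_derivative_subset[OF D(1)]) (use t in auto)
    qed
    moreover have "D 0 (t, x) \<circ> (\<lambda>h. (0, h)) = (\<lambda>h. h *\<^sub>R D 0 (t, x) (0, 1))"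
    proof
      fix h show "(D 0 (t, x) \<circ> (\<lambda>h. (0, h))) h = h *\<^sub>R D 0 (t, x) (0, 1)"
        using linear_cmul[OF has_derivative_linear[OF D(1)[of "(t,x)" 0]], of h "(0,1)"] t by simp
    qed
    ultimately show ?thesis unfolding has_vector_derivative_def by (simp only:) (simp add: o_def)
  qed
  have ut: "((\<lambda>s. u s x) has_vector_derivative D 0 (t, x) (1, 0)) (at t within J)" if t: "t \<in> J" for t x
  proof -
    have "(?u \<circ> (\<lambda>s. (s, x)) has_derivative D 0 (t, x) \<circ> (\<lambda>h. (h, 0))) (at t within J)"
    proof (rule diff_chain_within)
      show "((\<lambda>s. (s, x)) has_derivative (\<lambda>h. (h, 0))) (at t within J)"
        by (auto intro!: derivative_eq_intros)
      show "(?u has_derivative D 0 (t, x)) (at (t, x) within (\<lambda>s. (s, x)) ` J)"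
        by (rule has_derivative_subset[OF D(1)]) (use t in auto)
    qed
    moreover have "D 0 (t, x) \<circ> (\<lambda>h. (h, 0)) = (\<lambda>h. h *\<^sub>R D 0 (t, x) (1, 0))"
    proof
      fix h show "(D 0 (t, x) \<circ> (\<lambda>h. (h, 0))) h = h *\<^sub>R D 0 (t, x) (1, 0)"
        using linear_cmul[OF has_derivative_linear[OF D(1)[of "(t,x)" 0]], of h "(1,0)"] t by simp
    qed
    ultimately show ?thesis unfolding has_vector_derivative_def by (simp only:) (simp add: o_def)
  qed
  have per_x: "D 0 (t, x + 2 * pi) (0, 1) = D 0 (t, x) (0, 1)" if t: "t \<in> J" for t x
  proof -
    have "((u t \<circ> (\<lambda>y. y + 2 * pi)) has_vector_derivative 1 *\<^sub>R D 0 (t, x + 2 * pi) (0, 1)) (at x)"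
      by (rule vector_diff_chain_at[OF _ ux[OF t]]) (auto intro!: derivative_eq_intros)
    moreover have "u t \<circ> (\<lambda>y. y + 2 * pi) = u t" using per[OF t] by auto
    ultimately show ?thesis using vector_derivative_unique_at[OF _ ux[OF t]] by simp
  qed
  have per_t: "D 0 (t, x + 2 * pi) (1, 0) = D 0 (t, x) (1, 0)" if t: "t \<in> J" for t x
  proof -
    obtain b where b: "b > t" "t \<in> {0..b}" "at t within J = at t within {0..b}"
      using time_interval_within[OF J t] by metis
    have "((\<lambda>s. u s (x + 2 * pi)) has_vector_derivative D 0 (t, x) (1, 0)) (at t within J)"
      by (rule has_vector_derivative_transform[OF t _ ut[OF t]]) (use per in auto)
    then show ?thesis
      using vector_derivative_unique_within_closed_interval[of 0 b t] ut[OF t, of "x + 2 * pi"] b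
      unfolding b(3) by (metis atLeastAtMost_iff cbox_interval order_le_less_trans)
  qed
  have "smooth_on ?S (\<lambda>(t, x). D 0 (t, x) (0, 1))" "smooth_on ?S (\<lambda>(t, x). D 0 (t, x) (1, 0))"
    using sm[of "(0,1)"] sm[of "(1,0)"] by (simp_all only: case_prod_beta' prod.collapse)
  then show ?thesis
    by (rule_tac exI[of _ "\<lambda>t x. D 0 (t, x) (0, 1)"], rule_tac exI[of _ "\<lambda>t x. D 0 (t, x) (1, 0)"], 
        intro conjI ballI allI) (assumption | rule per_x per_t ux ut, assumption)+
qed

text \<open>The predicate \<open>P\<close> is closed under both partial derivatives, which is all
  that the inductions defining \<open>CX\<close> and \<open>CT\<close> ask for.\<close>

lemma smooth_on_imp_CT:
  fixes u :: "real \<Rightarrow> real \<Rightarrow> 'a::real_normed_vector"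
  assumes J: "time_interval J" and "smooth_on (J \<times> UNIV) (\<lambda>(t, x). u t x)"
    and "\<And>t x. t \<in> J \<Longrightarrow> u t (x + 2 * pi) = u t x"
  shows "CT k J u"
proof -
  define P where "P = (\<lambda>u :: real \<Rightarrow> real \<Rightarrow> 'a. smooth_on (J \<times> UNIV) (\<lambda>(t, x). u t x) \<and>
    (\<forall>t\<in>J. \<forall>x. u t (x + 2 * pi) = u t x))"
  have P: "\<exists>v w. P v \<and> P w \<and> (\<forall>t\<in>J. \<forall>x. (u t has_vector_derivative v t x) (at x) \<and>
     ((\<lambda>s. u s x) has_vector_derivative w t x) (at t within J))" if u: "P u" for u
  proof -
    from u have u: "smooth_on (J \<times> UNIV) (\<lambda>(t, x). u t x)" "\<And>t x. t \<in> J \<Longrightarrow> u t (x + 2 * pi) = u t x"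
      by (auto simp: P_def)
    show ?thesis unfolding P_def using smooth_on_partials[OF J u] by blast
  qed
  have c: "cont_per J u" if "P u" for u
    using that Ck_on.simps(1) unfolding P_def smooth_on_def cont_per_def by blast
  have X: "P u \<Longrightarrow> CX n J u" for n u
  proof (induction n arbitrary: u)
    case (Suc n)
    then obtain v where "P v" "\<forall>t\<in>J. \<forall>x. (u t has_vector_derivative v t x) (at x)" using P by blast
    with Suc c show ?case by auto
  qed (simp add: c)
  have T: "P u \<Longrightarrow> CT n J u" for n u
  proof (induction n arbitrary: u)
    case (Suc n)
    then obtain v where "P v" "\<forall>t\<in>J. \<forall>x. ((\<lambda>s. u s x) has_vector_derivative v t x) (at t within J)" using P by blast
    with Suc X show ?case by (intro CT_SucI[of J u n v]) auto
  qed (simp add: X)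
  show ?thesis using assms T unfolding P_def by blast
qed

section \<open>Regularity of the geometric quantities and of the velocity\<close>

lemma CT_deriv_s:
  fixes f u :: "real \<Rightarrow> real \<Rightarrow> 'a::euclidean_space"
  assumes "time_interval J" "CT k J f" "\<And>t x. t \<in> J \<Longrightarrow> dx f t x \<noteq> 0" "CT k J u"
  shows "CT k J (\<lambda>t. deriv_s (f t) (u t))"
proof -
  have "CT k J (\<lambda>t x. inverse (norm (dx f t x)) *\<^sub>R dx u t x)"
    by (intro CT_scaleR CT_inverse CT_norm CT_dx assms) (use assms in auto)
  then show ?thesis by (rule CT_cong) (simp add: deriv_s_def dx_def inverse_eq_divide)
qed

lemma CT_nabla_s:
  fixes f u :: "real \<Rightarrow> real \<Rightarrow> 'a::euclidean_space"
  assumes "time_interval J" "CT k J f" "\<And>t x. t \<in> J \<Longrightarrow> dx f t x \<noteq> 0" "CT k J u"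
  shows "CT k J (\<lambda>t. nabla_s (f t) (u t))"
  unfolding nabla_s_def[abs_def] tangent_def by (intro CT_diff CT_scaleR CT_inner CT_deriv_s assms)

lemma CT_flow_velocity:
  fixes f :: "real \<Rightarrow> real \<Rightarrow> 'a::euclidean_space"
  assumes J: "time_interval J" and f: "CT k J f" "\<And>t x. t \<in> J \<Longrightarrow> dx f t x \<noteq> 0"
  shows "CT k J (\<lambda>t. flow_velocity lam (f t))"
proof -
  have c: "CT k J (\<lambda>t. curvature (f t))"
    unfolding curvature_def by (rule CT_deriv_s[OF J f CT_deriv_s[OF J f f(1)]])
  have n: "CT k J (\<lambda>t. nabla_s (f t) (nabla_s (f t) (curvature (f t))))"
    by (rule CT_nabla_s[OF J f CT_nabla_s[OF J f c]])
  have i: "CT k J (\<lambda>t x. inverse (norm (dx f t x)))"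
    by (rule CT_inverse[OF CT_norm[OF CT_dx[OF J f(1)] f(2)]]) (use f(2) in auto)
  have "CT k J (\<lambda>t x. - nabla_s (f t) (nabla_s (f t) (curvature (f t))) x
     - (1/2 * (curvature (f t) x \<bullet> curvature (f t) x)) *\<^sub>R curvature (f t) x
     + (lam * inverse (norm (dx f t x))) *\<^sub>R dx (dx f) t x)"
    by (rule CT_add[OF CT_diff[OF CT_minus[OF n] CT_scaleR[OF CT_mult[OF CT_const CT_inner[OF c c]] c]]
          CT_scaleR[OF CT_mult[OF CT_const i] CT_dx[OF J CT_dx[OF J f(1)]]]])
  then show ?thesis by (rule CT_cong)
    (simp add: flow_velocity_def dx_def power2_norm_eq_inner inverse_eq_divide)
qed

text \<open>The working form of a solution: the initial curve is left out, smoothness is asked in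
  space only, and the slices are regular through \<open>dx f\<close>. Smoothness in time is
  recovered from the equation.\<close>

definition solves :: "real \<Rightarrow> real set \<Rightarrow> (real \<Rightarrow> real \<Rightarrow> 'a::real_inner) \<Rightarrow> bool" where
  "solves lam J f \<longleftrightarrow> CT 0 J f \<and> (\<forall>t\<in>J. \<forall>x. dx f t x \<noteq> 0 \<and>
     ((\<lambda>s. f s x) has_vector_derivative flow_velocity lam (f t) x) (at t within J))"

text \<open>The equation trades one time derivative for space derivatives, which are all under control.\<close>

lemma solves_CT:
  fixes f :: "real \<Rightarrow> real \<Rightarrow> 'a::euclidean_space"
  assumes J: "time_interval J" and f: "solves lam J f"
  shows "CT k J f"
proof (induction k)
  case (Suc k)
  show ?case
  proof (rule CT_SucI)
    show "CT k J (\<lambda>t. flow_velocity lam (f t))"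
      by (rule CT_flow_velocity[OF J Suc]) (use f in \<open>auto simp: solves_def\<close>)
  qed (use f CT_CX[OF Suc] in \<open>auto simp: solves_def\<close>)
qed (use f in \<open>auto simp: solves_def\<close>)

lemma solves_iff_flow_solution:
  fixes f :: "real \<Rightarrow> real \<Rightarrow> 'a::euclidean_space"
  assumes J: "time_interval J"
  shows "flow_solution lam f0 J f \<longleftrightarrow> solves lam J f \<and> f 0 = f0"
proof
  assume f: "flow_solution lam f0 J f"
  then have per: "\<And>t x. t \<in> J \<Longrightarrow> f t (x + 2 * pi) = f t x"
    by (auto simp: flow_solution_def smooth_regular_closed_curve_def)
  have "CT 0 J f" by (intro smooth_on_imp_CT[OF J] per) (use f in \<open>simp_all add: flow_solution_def\<close>)
  then show "solves lam J f \<and> f 0 = f0" using f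
    by (simp add: solves_def flow_solution_def smooth_regular_closed_curve_def dx_def)
next
  assume f: "solves lam J f \<and> f 0 = f0"
  have X: "CX n J f" for n using CT_CX[OF solves_CT[OF J conjunct1[OF f], of 0]] .
  have "\<And>t x. t \<in> J \<Longrightarrow> f t (x + 2 * pi) = f t x"
    using CX_cont_per[OF X[of 0]] by (auto simp: cont_per_def)
  then show "flow_solution lam f0 J f"
    using CT_imp_Ck_on[OF J solves_CT[OF J conjunct1[OF f]]] f CX_imp_Ck_on[OF X]
    by (simp add: flow_solution_def smooth_regular_closed_curve_def smooth_on_def solves_def dx_def)
qed

section \<open>Calculus with respect to a moving arc length\<close>

text \<open>Spatial smoothness is required at all times, also outside the time interval \<open>J\<close>, where curves will be
  frozen and time derivatives are \<open>0\<close>. Thus purely spatial identities hold as equations between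
  functions of \<open>t\<close> and \<open>x\<close>, without the side condition \<open>t \<in> J\<close>.\<close>

definition sm :: "real set \<Rightarrow> (real \<Rightarrow> real \<Rightarrow> 'a::real_normed_vector) \<Rightarrow> bool" where
  "sm J u \<longleftrightarrow> CT 0 J u \<and> (\<forall>t. CT 0 {t} u)"

definition st :: "real set \<Rightarrow> (real \<Rightarrow> real \<Rightarrow> 'a::real_normed_vector) \<Rightarrow> bool" where
  "st J u \<longleftrightarrow> CT 1 J u \<and> (\<forall>t. CT 0 {t} u)"

definition dt :: "real set \<Rightarrow> (real \<Rightarrow> real \<Rightarrow> 'a::real_normed_vector) \<Rightarrow> real \<Rightarrow> real \<Rightarrow> 'a" where
  "dt J u t x = (if t \<in> J then vector_derivative (\<lambda>s. u s x) (at t within J) else 0)"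

lemma CX_subset: "CX n J u \<Longrightarrow> K \<subseteq> J \<Longrightarrow> CX n K u"
proof (induction n arbitrary: u)
  case 0 then show ?case by (auto simp: cont_per_def elim: continuous_on_subset)
next
  case (Suc n)
  note u = CX_dx[OF Suc.prems(1)]
  have "cont_per K u"
    using CX_cont_per[OF Suc.prems(1)] Suc.prems(2) by (auto simp: cont_per_def elim: continuous_on_subset)
  then show ?case by (rule CX_SucI[OF _ Suc.IH[OF u(1) Suc.prems(2)]]) (use u(2) Suc.prems(2) in blast)
qed

lemma CT0_dx: "CT 0 J u \<Longrightarrow> CT 0 J (dx u)"
  using CX_dx(1)[of _ J u] by (simp del: CX.simps)

lemma st_imp_sm: "st J u \<Longrightarrow> sm J u"
  unfolding sm_def st_def using CT_smooth by blast

lemma sm_const [simp]: "sm J (\<lambda>t x. c)" and st_const [simp]: "st J (\<lambda>t x. c)"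
  unfolding sm_def st_def by (blast intro: CT_const)+

lemma sm_add: "sm J u \<Longrightarrow> sm J v \<Longrightarrow> sm J (\<lambda>t x. u t x + v t x)"
  and st_add: "st J u \<Longrightarrow> st J v \<Longrightarrow> st J (\<lambda>t x. u t x + v t x)"
  unfolding sm_def st_def by (blast intro: CT_add)+

lemma sm_minus: "sm J u \<Longrightarrow> sm J (\<lambda>t x. - u t x)"
  and st_minus: "st J u \<Longrightarrow> st J (\<lambda>t x. - u t x)"
  unfolding sm_def st_def by (blast intro: CT_minus)+

lemma sm_diff: "sm J u \<Longrightarrow> sm J v \<Longrightarrow> sm J (\<lambda>t x. u t x - v t x)"
  and st_diff: "st J u \<Longrightarrow> st J v \<Longrightarrow> st J (\<lambda>t x. u t x - v t x)"
  unfolding sm_def st_def by (blast intro: CT_diff)+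

context bounded_bilinear
begin
lemma sm: "sm J u \<Longrightarrow> sm J v \<Longrightarrow> sm J (\<lambda>t x. prod (u t x) (v t x))"
  and st: "st J u \<Longrightarrow> st J v \<Longrightarrow> st J (\<lambda>t x. prod (u t x) (v t x))"
  unfolding sm_def st_def by (blast intro: CT)+
end

lemmas sm_scaleR = bounded_bilinear.sm[OF bounded_bilinear_scaleR]
lemmas sm_inner = bounded_bilinear.sm[OF bounded_bilinear_inner]
lemmas sm_mult = bounded_bilinear.sm[OF bounded_bilinear_mult]
lemmas st_scaleR = bounded_bilinear.st[OF bounded_bilinear_scaleR]
lemmas st_inner = bounded_bilinear.st[OF bounded_bilinear_inner]
lemmas st_mult = bounded_bilinear.st[OF bounded_bilinear_mult]

lemma sm_inverse: "sm J u \<Longrightarrow> (\<And>t x. u t x > (0::real)) \<Longrightarrow> sm J (\<lambda>t x. inverse (u t x))"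
  and st_inverse: "st J u \<Longrightarrow> (\<And>t x. u t x > (0::real)) \<Longrightarrow> st J (\<lambda>t x. inverse (u t x))"
  unfolding sm_def st_def by (blast intro: CT_inverse)+

lemma st_ln: "st J u \<Longrightarrow> (\<And>t x. u t x > (0::real)) \<Longrightarrow> st J (\<lambda>t x. ln (u t x))"
  unfolding sm_def st_def by (blast intro: CT_ln)+

lemma st_norm: "st J u \<Longrightarrow> (\<And>t x. u t x \<noteq> 0) \<Longrightarrow> st J (\<lambda>t x. norm (u t x :: 'a::real_inner))"
  unfolding st_def by (blast intro: CT_norm)+

lemma sm_dx: "sm J u \<Longrightarrow> sm J (dx u)"
  unfolding sm_def by (blast intro: CT0_dx)

lemma st_dx: "time_interval J \<Longrightarrow> st J u \<Longrightarrow> st J (dx (u :: real \<Rightarrow> real \<Rightarrow> 'a::euclidean_space))"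
  unfolding st_def by (blast intro: CT0_dx CT_dx)

lemma sm_cont_per: "sm J u \<Longrightarrow> cont_per {t} u"
  unfolding sm_def by (metis CT_CX CX_cont_per)

lemma sm_per: "sm J u \<Longrightarrow> u t (x + 2 * pi) = u t x"
  using sm_cont_per[of J u t] by (simp add: cont_per_def)

lemma sm_cont: "sm J u \<Longrightarrow> continuous_on A (u t)"
  using cont_per_slices(2)[OF sm_cont_per, of J u t t A] by simp

lemma sm_cont_J: "sm J u \<Longrightarrow> cont_per J u"
  unfolding sm_def by (metis CT_CX CX_cont_per)

lemma sm_deriv: "sm J u \<Longrightarrow> (u t has_vector_derivative dx u t x) (at x)"
  using CX_dx(2)[of 0 "{t}" u t x] CT_CX[of 0 "{t}" u 1] by (simp add: sm_def del: CX.simps CT.simps)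

lemma dt_eqI:
  assumes J: "time_interval J" and t: "t \<in> J" and "((\<lambda>s. u s x) has_vector_derivative v) (at t within J)"
  shows "dt J u t x = v"
proof -
  obtain b where b: "b > t" "t \<in> {0..b}" "at t within J = at t within {0..b}"
    using time_interval_within[OF J t] by metis
  have "vector_derivative (\<lambda>s. u s x) (at t within {0..b}) = v"
    using vector_derivative_within_cbox[of 0 b t "\<lambda>s. u s x" v] assms(3) b by simp
  then show ?thesis using t b by (simp add: dt_def)
qed

lemma st_dt:
  assumes J: "time_interval J" and u: "st J u"
  shows "t \<in> J \<Longrightarrow> ((\<lambda>s. u s x) has_vector_derivative dt J u t x) (at t within J)" "sm J (dt J u)"
proof -
  obtain v where v: "CT 0 J v" "\<And>t x. t \<in> J \<Longrightarrow> ((\<lambda>s. u s x) has_vector_derivative v t x) (at t within J)"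
    using u CT_SucE[of 0 J u] unfolding st_def One_nat_def by metis
  have e: "dt J u t x = v t x" if t: "t \<in> J" for t x by (rule dt_eqI[OF J t v(2)[OF t]])
  show "t \<in> J \<Longrightarrow> ((\<lambda>s. u s x) has_vector_derivative dt J u t x) (at t within J)" using v e by simp
  have "CT 0 J (dt J u)" by (rule CT_cong[OF v(1)]) (simp add: e)
  moreover have "CT 0 {t} (dt J u)" for t
  proof (cases "t \<in> J")
    case True
    show ?thesis by (rule CT_cong[of 0 "{t}" v]) (use v(1) True in \<open>auto simp: e intro: CX_subset\<close>)
  next
    case False
    show ?thesis by (rule CT_cong[OF CT_const[of 0 "{t}" 0]]) (use False in \<open>auto simp: dt_def\<close>)
  qed
  ultimately show "sm J (dt J u)" by (simp add: sm_def)
qed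

lemma periodic_reduce:
  assumes "\<And>x. f (x + 2 * pi) = f x"
  obtains y where "y \<in> {0..2 * pi}" "f x = f y"
proof -
  interpret periodic_fun_simple f "2 * pi" by standard (fact assms)
  define n where "n = \<lfloor>x / (2 * pi)\<rfloor>"
  have "of_int n \<le> x / (2 * pi)" "x / (2 * pi) < of_int n + 1" unfolding n_def by linarith+
  then have "x - of_int n * (2 * pi) \<in> {0..2 * pi}" by (simp add: field_simps)
  moreover have "f (x - of_int n * (2 * pi)) = f x" by (rule minus_of_int)
  ultimately show thesis using that by metis
qed

text \<open>Derivative, integral and norms with respect to arc length depend on the curve only
  through a positive density. The calculus is set up for an arbitrary one and applied to
  \<open>|f_x|\<close> later.\<close>

locale moving =
  fixes J :: "real set" and w :: "real \<Rightarrow> real \<Rightarrow> real"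
  assumes J: "time_interval J" and w_st: "st J w" and w_pos: "\<And>t x. w t x > 0"
begin

definition ds :: "(real \<Rightarrow> real \<Rightarrow> 'a::real_normed_vector) \<Rightarrow> real \<Rightarrow> real \<Rightarrow> 'a" where
  "ds u t x = inverse (w t x) *\<^sub>R dx u t x"

definition It :: "(real \<Rightarrow> real \<Rightarrow> real) \<Rightarrow> real \<Rightarrow> real" where
  "It u t = integral {0..2 * pi} (\<lambda>x. u t x * w t x)"

definition nsq :: "(real \<Rightarrow> real \<Rightarrow> 'a::real_inner) \<Rightarrow> real \<Rightarrow> real" where
  "nsq u = It (\<lambda>t x. u t x \<bullet> u t x)"

definition len :: "real \<Rightarrow> real" where "len = It (\<lambda>t x. 1)"

lemma w_sm: "sm J w" by (rule st_imp_sm[OF w_st])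

lemma sm_ds: "sm J u \<Longrightarrow> sm J (ds u)"
  unfolding ds_def[abs_def] by (intro sm_scaleR sm_inverse sm_dx w_sm w_pos)

lemma st_ds: "st J u \<Longrightarrow> st J (ds (u :: real \<Rightarrow> real \<Rightarrow> 'a::euclidean_space))"
  unfolding ds_def[abs_def] by (intro st_scaleR st_inverse st_dx w_st w_pos J)

lemma sm_ds_pow: "sm J u \<Longrightarrow> sm J ((ds ^^ n) u)"
  by (induction n) (auto intro: sm_ds)

lemma st_ds_pow: "st J u \<Longrightarrow> st J ((ds ^^ n) (u :: real \<Rightarrow> real \<Rightarrow> 'a::euclidean_space))"
  by (induction n) (auto intro: st_ds)

lemma ds_deriv: "sm J u \<Longrightarrow> (u t has_vector_derivative w t x *\<^sub>R ds u t x) (at x)"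
  using sm_deriv[of J u t x] w_pos[of t x] by (simp add: ds_def)

lemma ds_eqI: 
  assumes "(u t has_vector_derivative w t x *\<^sub>R v) (at x)" shows "ds u t x = v"
  using w_pos[of t x] vector_derivative_at[OF assms] by (simp add: ds_def dx_def)

lemma ds_const [simp]: "ds (\<lambda>t x. c) = (\<lambda>t x. 0)"
  by (intro ext ds_eqI) simp

lemma ds_add: "sm J u \<Longrightarrow> sm J v \<Longrightarrow> ds (\<lambda>t x. u t x + v t x) = (\<lambda>t x. ds u t x + ds v t x)"
  by (intro ext ds_eqI) (auto intro!: has_vector_derivative_add ds_deriv simp: scaleR_add_right)

lemma ds_diff: "sm J u \<Longrightarrow> sm J v \<Longrightarrow> ds (\<lambda>t x. u t x - v t x) = (\<lambda>t x. ds u t x - ds v t x)"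
  by (intro ext ds_eqI) (auto intro!: has_vector_derivative_diff ds_deriv simp: scaleR_diff_right)

lemma ds_minus: "sm J u \<Longrightarrow> ds (\<lambda>t x. - u t x) = (\<lambda>t x. - ds u t x)"
  using ds_diff[of "\<lambda>t x. 0" u] by simp

lemma ds_bilinear:
  assumes "bounded_bilinear p" "sm J u" "sm J v"
  shows "ds (\<lambda>t x. p (u t x) (v t x)) = (\<lambda>t x. p (ds u t x) (v t x) + p (u t x) (ds v t x))"
proof (intro ext ds_eqI)
  interpret bounded_bilinear p by fact
  show "((\<lambda>x. p (u t x) (v t x)) has_vector_derivative
    w t x *\<^sub>R (p (ds u t x) (v t x) + p (u t x) (ds v t x))) (at x)" for t x
    using has_vector_derivative[OF ds_deriv[OF assms(2), of t x] ds_deriv[OF assms(3), of t x]]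
    by (simp add: scaleR_left scaleR_right scaleR_add_right add.commute)
qed

lemmas ds_scaleR = ds_bilinear[OF bounded_bilinear_scaleR]
lemmas ds_inner = ds_bilinear[OF bounded_bilinear_inner]
lemmas ds_mult = ds_bilinear[OF bounded_bilinear_mult]

lemma ds_cong: "(\<And>x. u t x = v t x) \<Longrightarrow> ds u t x = ds v t x"
  unfolding ds_def dx_def by (metis ext)

section \<open>Integration along the curve\<close>

lemma integrable: "continuous_on {0..2 * pi} (u t) \<Longrightarrow> (\<lambda>x. u t x * w t x) integrable_on {0..2 * pi}"
  by (intro integrable_continuous_interval continuous_intros sm_cont[OF w_sm])

lemma It_mono:
  assumes "continuous_on {0..2 * pi} (u t)" "continuous_on {0..2 * pi} (v t)"
    "\<And>x. x \<in> {0..2 * pi} \<Longrightarrow> u t x \<le> v t x"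
  shows "It u t \<le> It v t"
  unfolding It_def by (intro integral_le integrable assms mult_right_mono less_imp_le[OF w_pos])

lemma It_add:
  assumes "continuous_on {0..2 * pi} (u t)" "continuous_on {0..2 * pi} (v t)"
  shows "It (\<lambda>t x. u t x + v t x) t = It u t + It v t"
  unfolding It_def distrib_right by (intro integral_add integrable assms)

lemma It_cmult: "It (\<lambda>t x. c * u t x) t = c * It u t"
  unfolding It_def by (simp add: mult.assoc)

lemma It_diff:
  assumes "continuous_on {0..2 * pi} (u t)" "continuous_on {0..2 * pi} (v t)"
  shows "It (\<lambda>t x. u t x - v t x) t = It u t - It v t"
  unfolding It_def left_diff_distrib by (intro integral_diff integrable assms)

lemma It_minus: "It (\<lambda>t x. - u t x) t = - It u t"
  using It_cmult[of "-1" u t] by simp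

lemma It_nonneg:
  assumes "\<And>x. 0 \<le> u t x" shows "0 \<le> It u t"
  unfolding It_def by (cases "(\<lambda>x. u t x * w t x) integrable_on {0..2 * pi}")
    (auto intro!: integral_nonneg mult_nonneg_nonneg assms less_imp_le[OF w_pos] simp: not_integrable_integral)

lemma nsq_nonneg: "0 \<le> nsq u t"
  unfolding nsq_def by (rule It_nonneg) simp

lemma len_pos: "0 < len t"
proof -
  have "0 \<le> len t" unfolding len_def by (rule It_nonneg) simp
  moreover have "len t \<noteq> 0"
  proof
    assume "len t = 0"
    then have "integral {0..2 * pi} (w t) = 0" by (simp add: len_def It_def)
    then have "\<forall>x\<in>{0..2 * pi}. w t x = 0"
      by (subst (asm) integral_eq_0_iff) (auto intro!: sm_cont[OF w_sm] less_imp_le[OF w_pos])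
    then have "w t 0 = 0" by simp
    with w_pos[of t 0] show False by simp
  qed
  ultimately show ?thesis by simp
qed

lemma It_ds: "sm J u \<Longrightarrow> It (ds u) t = 0"
proof -
  assume u: "sm J u"
  have "((\<lambda>x. w t x *\<^sub>R ds u t x) has_integral (u t (2 * pi) - u t 0)) {0..2 * pi}"
    by (rule fundamental_theorem_of_calculus) (use has_vector_derivative_at_within[OF ds_deriv[OF u]] in auto)
  then have "It (ds u) t = u t (2 * pi) - u t 0"
    unfolding It_def by (simp add: integral_unique mult.commute)
  then show ?thesis using sm_per[OF u, of t 0] by simp
qed

lemma IBP:
  assumes "sm J u" "sm J v"
  shows "It (\<lambda>t x. ds u t x \<bullet> v t x) t = - It (\<lambda>t x. u t x \<bullet> ds v t x) t"
proof -
  have "It (\<lambda>t x. ds u t x \<bullet> v t x + u t x \<bullet> ds v t x) t = 0"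
    using It_ds[OF sm_inner[OF assms]] by (simp add: ds_inner assms)
  then show ?thesis
    by (subst (asm) It_add) (auto intro!: sm_cont[of J] sm_inner assms sm_ds)
qed

lemma It_CS:
  assumes u: "continuous_on {0..2 * pi} (u t)" and v: "continuous_on {0..2 * pi} (v t)"
  shows "(It (\<lambda>t x. u t x * v t x) t)\<^sup>2 \<le> It (\<lambda>t x. (u t x)\<^sup>2) t * It (\<lambda>t x. (v t x)\<^sup>2) t"
proof -
  let ?a = "It (\<lambda>t x. (u t x)\<^sup>2) t" and ?b = "It (\<lambda>t x. u t x * v t x) t" and ?c = "It (\<lambda>t x. (v t x)\<^sup>2) t"
  have q: "0 \<le> ?a + 2 * r * ?b + r\<^sup>2 * ?c" for r
  proof -
    have "0 \<le> It (\<lambda>t x. (u t x + r * v t x)\<^sup>2) t" by (rule It_nonneg) simp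
    also have "(\<lambda>t x. (u t x + r * v t x)\<^sup>2) = (\<lambda>t x. ((u t x)\<^sup>2 + (2 * r) * (u t x * v t x)) + r\<^sup>2 * (v t x)\<^sup>2)"
      by (intro ext) (simp add: power2_eq_square algebra_simps)
    also have "It \<dots> t = ?a + 2 * r * ?b + r\<^sup>2 * ?c"
      by (subst It_add, (intro continuous_intros u v)+, subst It_add, (intro continuous_intros u v)+)
        (simp only: It_cmult)
    finally show ?thesis .
  qed
  have c: "0 \<le> ?c" by (rule It_nonneg) simp
  show ?thesis
  proof (cases "?c = 0")
    case True
    have "?b = 0"
    proof (rule ccontr)
      assume b: "?b \<noteq> 0"
      \<comment> \<open>With \<open>?c = 0\<close> the quadratic is affine in \<open>r\<close>, and
        this \<open>r\<close> gives it the value -1.\<close>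
      have "0 \<le> ?a + 2 * (- (?a + 1) / (2 * ?b)) * ?b" using q[of "- (?a + 1) / (2 * ?b)"] True by simp
      with b show False by (simp add: field_simps)
    qed
    then show ?thesis using True by simp
  next
    case False
    with c have c: "?c > 0" by simp
    \<comment> \<open>The quadratic at its minimizer \<open>r = - ?b / ?c\<close>, multiplied by
      \<open>?c\<close>.\<close>
    have "0 \<le> (?a + 2 * (- ?b / ?c) * ?b + (- ?b / ?c)\<^sup>2 * ?c) * ?c"
      using q[of "- ?b / ?c"] c by simp
    also have "\<dots> = ?a * ?c - ?b\<^sup>2"
      using c by (simp add: field_simps power2_eq_square)
    finally show ?thesis by simp
  qed
qed

text \<open>The values of \<open>u\<close> at two points differ by at most the integral of
  \<open>h\<close> over the period. Averaging \<open>u t x \<le> u t y + It h t\<close> over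
  \<open>y\<close> produces the mean value.\<close>

lemma sup_bound:
  assumes u: "sm J u" and h: "continuous_on UNIV (h t)" and uh: "\<And>y. \<bar>ds u t y\<bar> \<le> h t y"
  shows "u t x \<le> It u t / len t + It h t"
proof -
  have ii: "(\<lambda>z. h t z * w t z) integrable_on {a..b}" for a b
    by (intro integrable_continuous_interval continuous_intros sm_cont[OF w_sm] continuous_on_subset[OF h]) simp
  have hnn: "0 \<le> h t z * w t z" for z
    using uh[of z] w_pos[of t z] by (intro mult_nonneg_nonneg) auto
  have inc: "\<bar>u t b - u t a\<bar> \<le> It h t" if ab: "0 \<le> a" "a \<le> b" "b \<le> 2 * pi" for a b
  proof -
    have "((\<lambda>z. w t z *\<^sub>R ds u t z) has_integral (u t b - u t a)) {a..b}"
      by (rule fundamental_theorem_of_calculus) (use has_vector_derivative_at_within[OF ds_deriv[OF u]] ab in auto)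
    then have "norm (u t b - u t a) \<le> integral {a..b} (\<lambda>z. h t z * w t z)"
    proof (subst integral_unique[symmetric], assumption, intro integral_norm_bound_integral)
      show "norm (w t z *\<^sub>R ds u t z) \<le> h t z * w t z" for z
        using uh[of z] w_pos[of t z] by (simp add: abs_mult mult.commute mult_left_mono)
    qed (auto intro: ii has_integral_integrable)
    also have "\<dots> \<le> It h t" unfolding It_def
      by (rule integral_subset_le) (use ab ii hnn in auto)
    finally show ?thesis by simp
  qed
  obtain x' where x': "x' \<in> {0..2 * pi}" "u t x = u t x'"
    using periodic_reduce[of "u t" x] sm_per[OF u] by metis
  have "It (\<lambda>t y. u t x) t \<le> It (\<lambda>t y. u t y + It h t) t"
  proof (rule It_mono)
    fix y :: real assume "y \<in> {0..2 * pi}"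
    then show "u t x \<le> u t y + It h t"
      using inc[of x' y] inc[of y x'] x' by (cases "x' \<le> y") auto
  qed (auto intro!: continuous_intros sm_cont[OF u])
  moreover have "It (\<lambda>t y. u t x) t = u t x * len t"
    using It_cmult[of "u t x" "\<lambda>t x. 1" t] unfolding It_def len_def by simp
  moreover have "It (\<lambda>t y. u t y + It h t) t = It u t + It h t * len t"
  proof -
    have "It (\<lambda>s y. u s y + It h t) t = It u t + It h t * len t"
      by (subst It_add) (auto intro!: continuous_intros sm_cont[OF u] simp: len_def It_def)
    then show ?thesis by (simp add: It_def)
  qed
  ultimately show ?thesis using len_pos[of t] by (simp add: field_simps)
qed

section \<open>Time derivatives of integrals and of arc length derivatives\<close>

lemma It_has_derivative:
  assumes u: "st J u" and t: "t \<in> J"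
  shows "(It u has_real_derivative It (\<lambda>t x. dt J u t x + u t x * (dt J w t x / w t x)) t) (at t within J)"
proof -
  obtain b where b: "b > t" "{0..b} \<subseteq> J" "t \<in> {0..b}" "at t within J = at t within {0..b}"
    using time_interval_within[OF J t] by blast
  note du = st_dt[OF J u] and dw = st_dt[OF J w_st]
  have c: "continuous_on ({0..b} \<times> UNIV) (\<lambda>(t, x). dt J u t x * w t x + u t x * dt J w t x)"
    using du(2) dw(2) st_imp_sm[OF u] w_sm
    by (intro cont_per_slices(3)[of J] sm_cont_J sm_add sm_mult) (use b in auto)
  have "((\<lambda>t. integral (cbox 0 (2 * pi)) (\<lambda>x. u t x * w t x)) has_vector_derivative
     integral (cbox 0 (2 * pi)) (\<lambda>x. dt J u t x * w t x + u t x * dt J w t x)) (at t within {0..b})"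
  proof (rule leibniz_rule_vector_derivative[where fx = "\<lambda>t x. dt J u t x * w t x + u t x * dt J w t x"])
    show "((\<lambda>s. u s x * w s x) has_vector_derivative dt J u s x * w s x + u s x * dt J w s x) (at s within {0..b})"
      if "s \<in> {0..b}" for s x
    proof -
      have "s \<in> J" using that b by auto
      from bounded_bilinear.has_vector_derivative[OF bounded_bilinear_mult du(1)[OF this] dw(1)[OF this]]
      show ?thesis by (rule has_vector_derivative_within_subset[rotated, OF b(2), THEN has_vector_derivative_eq_rhs])
          (simp add: add.commute)
    qed
    show "(\<lambda>x. u s x * w s x) integrable_on cbox 0 (2 * pi)" for s
      using integrable[of u s] sm_cont[OF st_imp_sm[OF u]] by simp
  qed (use b c in \<open>auto elim: continuous_on_subset\<close>)
  moreover have "It (\<lambda>t x. dt J u t x + u t x * (dt J w t x / w t x)) t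
     = integral (cbox 0 (2 * pi)) (\<lambda>x. dt J u t x * w t x + u t x * dt J w t x)"
    unfolding It_def using w_pos[of t] 
    by (auto intro!: integral_cong simp: field_simps less_imp_neq[symmetric] order_less_imp_not_eq2)
  ultimately show ?thesis unfolding b(4) has_real_derivative_iff_has_vector_derivative
    by (simp add: It_def[abs_def])
qed

lemma dt_bilinear:
  assumes "bounded_bilinear p" "st J u" "st J v" "t \<in> J"
  shows "dt J (\<lambda>t x. p (u t x) (v t x)) t x = p (dt J u t x) (v t x) + p (u t x) (dt J v t x)"
proof -
  interpret bounded_bilinear p by fact
  show ?thesis
    by (rule dt_eqI[OF J assms(4)])
      (use has_vector_derivative[OF st_dt(1)[OF J assms(2,4)] st_dt(1)[OF J assms(3,4)], of x x]
        in \<open>simp add: add.commute\<close>)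
qed

lemma dt_dx:
  assumes u: "st J (u :: real \<Rightarrow> real \<Rightarrow> 'a::euclidean_space)" and t: "t \<in> J"
  shows "dt J (dx u) t x = dx (dt J u) t x"
proof (rule dt_eqI[OF J t])
  have "CX 1 J u" "CX 1 J (dt J u)"
    using u st_dt(2)[OF J u] by (auto simp: st_def sm_def intro: CT_CX simp del: CX.simps CT.simps)
  then show "((\<lambda>s. dx u s x) has_vector_derivative dx (dt J u) t x) (at t within J)"
    by (rule dx_dt_exchange[OF J _ _ st_dt(1)[OF J u] t])
qed

lemma dt_ds:
  assumes u: "st J (u :: real \<Rightarrow> real \<Rightarrow> 'a::euclidean_space)" and t: "t \<in> J"
  shows "dt J (ds u) t x = ds (dt J u) t x - (dt J w t x / w t x) *\<^sub>R ds u t x"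
proof (rule dt_eqI[OF J t])
  have i: "((\<lambda>s. inverse (w s x)) has_vector_derivative - (dt J w t x / (w t x)\<^sup>2)) (at t within J)"
    using st_dt(1)[OF J w_st t, of x] w_pos[of t x]
    unfolding has_real_derivative_iff_has_vector_derivative[symmetric]
    by (auto intro!: derivative_eq_intros simp: power2_eq_square field_simps)
  have "((\<lambda>s. dx u s x) has_vector_derivative dx (dt J u) t x) (at t within J)"
    using st_dt(1)[OF J st_dx[OF J u] t] dt_dx[OF u t] by simp
  from bounded_bilinear.has_vector_derivative[OF bounded_bilinear_scaleR i this]
  show "((\<lambda>s. ds u s x) has_vector_derivative ds (dt J u) t x - (dt J w t x / w t x) *\<^sub>R ds u t x) (at t within J)"
    unfolding ds_def[abs_def]
    by (rule has_vector_derivative_eq_rhs) (simp add: power2_eq_square divide_inverse mult.assoc)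
qed

end

section \<open>Geometric evolution equations\<close>

lemmas sm_rules = sm_add sm_minus sm_diff sm_scaleR sm_inner sm_mult sm_const
lemmas st_rules = st_add st_minus st_diff st_scaleR st_inner st_mult st_const

locale flow =
  fixes J :: "real set" and lam :: real and f :: "real \<Rightarrow> real \<Rightarrow> 'a::euclidean_space"
  assumes time: "time_interval J" and lam_pos: "lam > 0" and f_solves: "solves lam J f"
    and f_outside: "\<And>t. t \<notin> J \<Longrightarrow> f t = f 0"
begin

definition w :: "real \<Rightarrow> real \<Rightarrow> real" where "w t x = norm (dx f t x)"

lemma zero_J: "0 \<in> J" using time by (simp add: time_interval_def)

lemma f_st: "st J f"
proof -
  have c: "CT 1 J f" by (rule solves_CT[OF time f_solves])
  have "CT 0 {t} f" for t
  proof (cases "t \<in> J")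
    case True then show ?thesis using CT_CX[OF c] by (auto intro: CX_subset)
  next
    case False
    have "CX n {t} (\<lambda>s. f 0)" for n
    proof -
      have "CX n {0} f" by (rule CX_subset[OF CT_CX[OF c]]) (simp add: zero_J)
      then have "CX n {0} (\<lambda>s. f 0)" by (rule CX_cong) auto
      then show ?thesis
      proof (induction n arbitrary: f)
        case 0
        have "continuous_on UNIV (f 0)" using cont_per_slices(2)[of "{0}" "\<lambda>s. f 0" 0 UNIV] 0 by simp
        then have "continuous_on ({t} \<times> UNIV) (\<lambda>p. f 0 (snd p))"
          by (rule continuous_on_compose2) (auto intro!: continuous_intros)
        then show ?case using 0 by (simp add: cont_per_def case_prod_beta')
      next
        case (Suc n)
        note d = CX_dx[OF Suc.prems]
        have "dx (\<lambda>s. f 0) = (\<lambda>s. dx (\<lambda>s. f 0) 0)" by (intro ext) (simp add: dx_def)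
        then have "CX n {t} (dx (\<lambda>s. f 0))" using Suc.IH[of "dx (\<lambda>s. f 0)"] d(1) by simp
        moreover have "cont_per {t} (\<lambda>s. f 0)"
        proof -
          have "continuous_on UNIV (f 0)" 
            using cont_per_slices(2)[of "{0}" "\<lambda>s. f 0" 0 UNIV] CX_cont_per[OF Suc.prems] by simp
          then have "continuous_on ({t} \<times> UNIV) (\<lambda>p. f 0 (snd p))"
            by (rule continuous_on_compose2) (auto intro!: continuous_intros)
          then show ?thesis using CX_cont_per[OF Suc.prems] by (simp add: cont_per_def case_prod_beta')
        qed
        ultimately show ?case using d(2)[of 0] by (intro CX_SucI[of _ _ n "dx (\<lambda>s. f 0)"]) (auto simp: dx_def)
      qed
    qed
    then show ?thesis using f_outside[OF False] by (intro CT_cong[of 0 "{t}" "\<lambda>s. f 0" f]) auto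
  qed
  with c show ?thesis by (simp add: st_def)
qed

lemma dx_f_nz: "dx f t x \<noteq> 0"
proof (cases "t \<in> J")
  case False
  then have "dx f t x = dx f 0 x" by (simp add: dx_def f_outside)
  then show ?thesis using f_solves zero_J by (simp add: solves_def)
qed (use f_solves in \<open>simp add: solves_def\<close>)

sublocale moving J w
proof
  show "st J w" unfolding w_def[abs_def] by (intro st_norm st_dx time f_st dx_f_nz)
  show "0 < w t x" for t x by (simp add: w_def dx_f_nz)
qed (rule time)

section \<open>Tangent, curvature and the splitting of the velocity\<close>

definition T :: "real \<Rightarrow> real \<Rightarrow> 'a" where "T = ds f"
definition K :: "real \<Rightarrow> real \<Rightarrow> 'a" where "K = ds T"

text \<open>Written out, the term \<open>- nabla_s^2 K\<close> is
  \<open>- K_ss - |K|^2 K - 3 <K, K_s> T\<close>, and \<open>lam f_xx / |f_x|\<close> is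
  \<open>lam (w_s T + w K)\<close>. Collected here is what remains of the velocity without
  \<open>- K_ss\<close> and the tangential \<open>lam w_s T\<close>; the multiple of
  \<open>T\<close> compensates the tangential part of \<open>K_ss\<close>.\<close>

definition V' :: "real \<Rightarrow> real \<Rightarrow> 'a" where
  "V' t x = (lam * w t x) *\<^sub>R K t x - (3/2 * (K t x \<bullet> K t x)) *\<^sub>R K t x - (3 * (K t x \<bullet> ds K t x)) *\<^sub>R T t x"

definition V :: "real \<Rightarrow> real \<Rightarrow> 'a" where "V t x = V' t x - ds (ds K) t x"
text \<open>The relative rate at which normal motion with velocity \<open>V\<close> shortens the
  length element.\<close>

definition g :: "real \<Rightarrow> real \<Rightarrow> real" where "g t x = K t x \<bullet> V t x"

lemma T_st: "st J T" unfolding T_def by (intro st_ds f_st)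
lemma K_st: "st J K" unfolding K_def by (intro st_ds T_st)
lemma V'_st: "st J V'" unfolding V'_def[abs_def] by (intro st_rules st_ds T_st K_st w_st)
lemma V_st: "st J V" unfolding V_def[abs_def] by (intro st_rules st_ds T_st K_st V'_st)
lemma g_st: "st J g" unfolding g_def[abs_def] by (intro st_rules K_st V_st)

lemmas base_st = w_st T_st K_st V'_st V_st g_st f_st
lemmas base_sm = base_st[THEN st_imp_sm]
lemmas sms = sm_rules sm_ds base_sm
lemmas ds_rules = ds_add ds_diff ds_minus ds_scaleR ds_inner ds_mult

lemma dx_f: "dx f t x = w t x *\<^sub>R T t x"
  using w_pos[of t x] by (simp add: T_def ds_def)

lemma TT [simp]: "T t x \<bullet> T t x = 1"
proof -
  have "norm (T t x) = 1" using w_pos[of t x] dx_f_nz by (simp add: T_def ds_def w_def)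
  then show ?thesis by (simp add: norm_eq_1)
qed

lemma norm_T [simp]: "norm (T t x) = 1"
  by (simp add: norm_eq_1)

lemma KT [simp]: "K t x \<bullet> T t x = 0" "T t x \<bullet> K t x = 0"
proof -
  have "ds (\<lambda>t x. T t x \<bullet> T t x) t x = 0" by simp
  then have "2 * (K t x \<bullet> T t x) = 0"
    by (subst (asm) ds_inner) (auto intro: base_sm simp: K_def inner_commute)
  then show "K t x \<bullet> T t x = 0" "T t x \<bullet> K t x = 0" by (simp_all add: inner_commute)
qed

lemma dsK_T: "ds K t x \<bullet> T t x = - (K t x \<bullet> K t x)"
proof -
  have "ds (\<lambda>t x. K t x \<bullet> T t x) t x = 0" by simp
  then show ?thesis
    by (subst (asm) ds_inner) (auto intro: base_sm simp: K_def[symmetric])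
qed

lemma ddsK_T: "ds (ds K) t x \<bullet> T t x = - 3 * (K t x \<bullet> ds K t x)"
proof -
  have "ds (\<lambda>t x. ds K t x \<bullet> T t x) t x = ds (\<lambda>t x. - (K t x \<bullet> K t x)) t x" by (simp add: dsK_T)
  then have "ds (ds K) t x \<bullet> T t x + ds K t x \<bullet> K t x = - (2 * (K t x \<bullet> ds K t x))"
    by (simp add: ds_rules sms K_def[symmetric] inner_commute)
  then show ?thesis by (simp add: inner_commute)
qed

lemma VT [simp]: "V t x \<bullet> T t x = 0"
  by (simp add: V_def V'_def inner_diff_left inner_add_left ddsK_T)

lemma TV [simp]: "T t x \<bullet> V t x = 0"
  using VT[of t x] by (simp add: inner_commute)

lemma dsV_T: "ds V t x \<bullet> T t x = - g t x"
proof -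
  have "ds (\<lambda>t x. V t x \<bullet> T t x) t x = 0" by simp
  then show ?thesis
    by (subst (asm) ds_inner) (auto intro: base_sm simp: K_def[symmetric] g_def inner_commute)
qed

lemma deriv_s_eq: "deriv_s (f t) (u t) = ds u t"
  by (intro ext) (simp add: deriv_s_def ds_def dx_def w_def inverse_eq_divide)

lemma curvature_eq: "curvature (f t) = K t"
  unfolding curvature_def deriv_s_eq K_def T_def ..

lemma nabla_s_eq: "nabla_s (f t) (u t) = (\<lambda>x. ds u t x - (ds u t x \<bullet> T t x) *\<^sub>R T t x)"
  by (intro ext) (simp add: nabla_s_def deriv_s_eq tangent_def T_def)

definition vel :: "real \<Rightarrow> real \<Rightarrow> 'a" where "vel t x = V t x + (lam * ds w t x) *\<^sub>R T t x"

text \<open>The identities \<open><K_s, T> = - |K|^2\<close> and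
  \<open><K_ss, T> = - 3 <K, K_s>\<close> evaluate the two projections, with \<open>P\<close> the
  first normal derivative of the curvature; the second derivative in \<open>x\<close> is read off
  from \<open>dx f = w T\<close>.\<close>

lemma flow_velocity_eq: "flow_velocity lam (f t) x = vel t x"
proof -
  define P where "P = (\<lambda>t x. ds K t x + (K t x \<bullet> K t x) *\<^sub>R T t x)"
  have P: "nabla_s (f t) (curvature (f t)) = P t"
    unfolding curvature_eq nabla_s_eq by (simp add: P_def dsK_T)
  have dP: "ds P = (\<lambda>t x. ds (ds K) t x + (2 * (K t x \<bullet> ds K t x)) *\<^sub>R T t x + (K t x \<bullet> K t x) *\<^sub>R K t x)"
    unfolding P_def by (simp add: ds_rules sms K_def[symmetric] inner_commute) 
      (simp add: algebra_simps flip: mult_2 scaleR_add_left)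
  have P2: "nabla_s (f t) (P t) x = ds (ds K) t x + (3 * (K t x \<bullet> ds K t x)) *\<^sub>R T t x + (K t x \<bullet> K t x) *\<^sub>R K t x"
  proof -
    have "ds P t x \<bullet> T t x = - (K t x \<bullet> ds K t x)"
      unfolding dP by (simp add: inner_add_left ddsK_T)
    then show ?thesis unfolding nabla_s_eq dP by (simp add: algebra_simps flip: scaleR_add_left)
  qed
  have "dx f = (\<lambda>t x. w t x *\<^sub>R T t x)" by (intro ext dx_f)
  then have "ds (dx f) t x = ds w t x *\<^sub>R T t x + w t x *\<^sub>R K t x"
    by (simp add: ds_rules sms K_def)
  then have "dx (dx f) t x = w t x *\<^sub>R (ds w t x *\<^sub>R T t x + w t x *\<^sub>R K t x)"
    using w_pos[of t x] by (simp add: ds_def[of "dx f"]) (metis scaleR_scaleR right_inverse scaleR_one less_irrefl)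
  then have "deriv_x (deriv_x (f t)) x = w t x *\<^sub>R (ds w t x *\<^sub>R T t x + w t x *\<^sub>R K t x)"
    by (simp add: dx_def)
  moreover have "norm (deriv_x (f t) x) = w t x" by (simp add: w_def dx_def)
  ultimately show ?thesis
    unfolding flow_velocity_def P[unfolded curvature_eq] curvature_eq P2 vel_def V_def V'_def
    using w_pos[of t x]
    by (simp add: power2_norm_eq_inner algebra_simps) (simp flip: scaleR_add_left)
qed

lemma dt_f: "t \<in> J \<Longrightarrow> dt J f t x = vel t x"
  by (rule dt_eqI[OF time]) (use f_solves flow_velocity_eq in \<open>auto simp: solves_def\<close>)

lemma ds_vel: "ds vel t x = ds V t x + (lam * ds (ds w) t x) *\<^sub>R T t x + (lam * ds w t x) *\<^sub>R K t x"
  unfolding vel_def[abs_def] by (simp add: ds_rules sms K_def)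

lemma dt_dx_f: assumes t: "t \<in> J" shows "dt J (dx f) t x = w t x *\<^sub>R ds vel t x"
proof -
  have "dx (dt J f) t x = dx vel t x" unfolding dx_def using dt_f[OF t] by (metis ext)
  then show ?thesis using dt_dx[OF f_st t] w_pos[of t x] by (simp add: ds_def)
qed

text \<open>Differentiating \<open>w^2 = |f_x|^2\<close> avoids differentiating the norm; after
  division by \<open>w\<close> the tangential component of \<open>vel_s\<close> is left.\<close>

lemma dt_w: assumes t: "t \<in> J" shows "dt J w t x = w t x * (lam * ds (ds w) t x - g t x)"
proof -
  have "(\<lambda>t x. w t x * w t x) = (\<lambda>t x. dx f t x \<bullet> dx f t x)"
    by (intro ext) (simp add: w_def flip: power2_norm_eq_inner power2_eq_square)
  then have "dt J (\<lambda>t x. w t x * w t x) t x = dt J (\<lambda>t x. dx f t x \<bullet> dx f t x) t x" by simp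
  then have "2 * (w t x * dt J w t x) = 2 * (dx f t x \<bullet> dt J (dx f) t x)"
    using dt_bilinear[OF bounded_bilinear_mult w_st w_st t, of x]
      dt_bilinear[OF bounded_bilinear_inner st_dx[OF time f_st] st_dx[OF time f_st] t, of x]
    by (simp add: inner_commute mult.commute)
  then have "w t x * dt J w t x = w t x * (w t x * (T t x \<bullet> ds vel t x))"
    by (simp add: dt_dx_f[OF t] dx_f)
  then have "dt J w t x = w t x * (T t x \<bullet> ds vel t x)" using w_pos[of t x] by simp
  also have "T t x \<bullet> ds vel t x = lam * ds (ds w) t x - g t x"
    using dsV_T[of t x] by (simp add: ds_vel inner_add_right inner_commute)
  finally show ?thesis .
qed

lemma dt_w_div: "t \<in> J \<Longrightarrow> dt J w t x / w t x = lam * ds (ds w) t x - g t x"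
  using w_pos[of t x] by (simp add: dt_w)

section \<open>The material derivative\<close>

definition Dm :: "(real \<Rightarrow> real \<Rightarrow> 'b::real_normed_vector) \<Rightarrow> real \<Rightarrow> real \<Rightarrow> 'b" where
  "Dm u t x = dt J u t x - (lam * ds w t x) *\<^sub>R ds u t x"

lemma Dm_sm: "st J u \<Longrightarrow> sm J (Dm u)"
  unfolding Dm_def[abs_def] by (intro sms st_dt(2)[OF time]) (auto intro: st_imp_sm)

lemma Dm_T: assumes t: "t \<in> J" shows "Dm T t x = ds V t x + g t x *\<^sub>R T t x"
proof -
  have "dx f = (\<lambda>t x. w t x *\<^sub>R T t x)" by (intro ext dx_f)
  then have "w t x *\<^sub>R ds vel t x = dt J w t x *\<^sub>R T t x + w t x *\<^sub>R dt J T t x"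
    using dt_dx_f[OF t, of x] dt_bilinear[OF bounded_bilinear_scaleR w_st T_st t, of x] by simp
  then have "w t x *\<^sub>R dt J T t x = w t x *\<^sub>R (ds vel t x - (lam * ds (ds w) t x - g t x) *\<^sub>R T t x)"
    by (simp add: dt_w[OF t] scaleR_diff_right)
  then have "dt J T t x = ds vel t x - (lam * ds (ds w) t x - g t x) *\<^sub>R T t x"
    using w_pos[of t x] by simp
  then show ?thesis by (simp add: Dm_def ds_vel K_def algebra_simps)
qed

lemma Dm_ds:
  assumes u: "st J (u :: real \<Rightarrow> real \<Rightarrow> 'b::euclidean_space)" and t: "t \<in> J"
  shows "Dm (ds u) t x = ds (Dm u) t x + g t x *\<^sub>R ds u t x"
proof -
  have "ds (Dm u) t x = ds (dt J u) t x - ((lam * ds (ds w) t x) *\<^sub>R ds u t x + (lam * ds w t x) *\<^sub>R ds (ds u) t x)"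
    unfolding Dm_def[abs_def] using st_dt(2)[OF time u] st_imp_sm[OF u]
    by (simp add: ds_rules sms)
  then show ?thesis unfolding Dm_def[of "ds u"] dt_ds[OF u t] dt_w_div[OF t] by (simp add: algebra_simps)
qed

lemma Dm_bilinear:
  assumes p: "bounded_bilinear p" and u: "st J u" and v: "st J v" and t: "t \<in> J"
  shows "Dm (\<lambda>t x. p (u t x) (v t x)) t x = p (Dm u t x) (v t x) + p (u t x) (Dm v t x)"
proof -
  interpret bounded_bilinear p by fact
  show ?thesis unfolding Dm_def dt_bilinear[OF assms] ds_bilinear[OF p st_imp_sm[OF u] st_imp_sm[OF v]]
    by (simp add: diff_left diff_right scaleR_left scaleR_right scaleR_add_right)
qed

text \<open>Tangential motion leaves no trace in an integral: the stretching of \<open>w\<close> and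
  the transport term combine to \<open>lam (u w_s)_s\<close>, which integrates to zero on a closed
  curve. Only the contraction \<open>- g\<close> of the length element remains.\<close>

lemma It_deriv:
  assumes u: "st J u" and t: "t \<in> J"
  shows "(It u has_real_derivative It (\<lambda>t x. Dm u t x - g t x * u t x) t) (at t within J)"
proof -
  note us = st_imp_sm[OF u]
  have "dt J u t x + u t x * (dt J w t x / w t x)
     = (Dm u t x - g t x * u t x) + lam * ds (\<lambda>t x. u t x * ds w t x) t x" for x
    using us unfolding dt_w_div[OF t] by (simp add: Dm_def ds_rules sms algebra_simps)
  then have "It (\<lambda>t x. dt J u t x + u t x * (dt J w t x / w t x)) t
     = It (\<lambda>t x. (Dm u t x - g t x * u t x) + lam * ds (\<lambda>t x. u t x * ds w t x) t x) t"
    by (simp add: It_def)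
  also have "\<dots> = It (\<lambda>t x. Dm u t x - g t x * u t x) t + It (\<lambda>t x. lam * ds (\<lambda>t x. u t x * ds w t x) t x) t"
    by (intro It_add sm_cont[of J] sms us Dm_sm u)
  also have "It (\<lambda>t x. lam * ds (\<lambda>t x. u t x * ds w t x) t x) t = 0"
    unfolding It_cmult by (subst It_ds) (auto intro!: sms us)
  finally show ?thesis using It_has_derivative[OF u t] by simp
qed

lemma nsq_deriv:
  assumes u: "st J u" and t: "t \<in> J"
  shows "(nsq u has_real_derivative It (\<lambda>t x. 2 * (u t x \<bullet> Dm u t x) - g t x * (u t x \<bullet> u t x)) t) (at t within J)"
proof -
  have "It (\<lambda>t x. Dm (\<lambda>t x. u t x \<bullet> u t x) t x - g t x * (u t x \<bullet> u t x)) t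
    = It (\<lambda>t x. 2 * (u t x \<bullet> Dm u t x) - g t x * (u t x \<bullet> u t x)) t"
    unfolding It_def by (simp add: Dm_bilinear[OF bounded_bilinear_inner u u t] inner_commute)
  then show ?thesis using It_deriv[OF st_inner[OF u u] t] by (simp add: nsq_def)
qed

lemma Dm_w: "t \<in> J \<Longrightarrow> Dm w t x = lam * (w t x * ds (ds w) t x) - w t x * g t x - lam * (ds w t x)\<^sup>2"
  by (simp add: Dm_def dt_w power2_eq_square algebra_simps)

definition lw :: "real \<Rightarrow> real \<Rightarrow> real" where "lw t x = ln (w t x)"

lemma lw_st: "st J lw" unfolding lw_def[abs_def] by (intro st_ln w_st w_pos)

lemma ds_w: "ds w t x = w t x * ds lw t x"
proof -
  have "((\<lambda>x. exp (lw t x)) has_vector_derivative exp (lw t x) * (w t x * ds lw t x)) (at x)"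
    using ds_deriv[OF st_imp_sm[OF lw_st], of t x]
    unfolding has_real_derivative_iff_has_vector_derivative[symmetric]
    by (auto intro!: derivative_eq_intros)
  moreover have "(\<lambda>x. exp (lw t x)) = w t" by (intro ext) (simp add: lw_def w_pos)
  ultimately have "(w t has_vector_derivative w t x * (w t x * ds lw t x)) (at x)"
    using w_pos[of t x] by (simp add: lw_def)
  then show ?thesis by (intro ds_eqI) simp
qed

lemma dds_w: "ds (ds w) t x = w t x * (ds (ds lw) t x + (ds lw t x)\<^sup>2)"
proof -
  have "ds w = (\<lambda>t x. w t x * ds lw t x)" by (intro ext ds_w)
  then have "ds (ds w) t x = ds w t x * ds lw t x + w t x * ds (ds lw) t x"
    using st_imp_sm[OF lw_st] by (simp add: ds_rules sms)
  then show ?thesis by (simp add: ds_w power2_eq_square algebra_simps)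
qed

text \<open>Because of \<open>w_ss = w (lw_ss + lw_s^2)\<close> the quotient \<open>w_t / w\<close>
  contains \<open>lam w lw_s^2\<close>, and the transport term of \<open>Dm\<close> subtracts
  exactly this.\<close>

lemma Dm_lw: assumes t: "t \<in> J" shows "Dm lw t x = lam * (w t x * ds (ds lw) t x) - g t x"
proof -
  have "((\<lambda>s. lw s x) has_real_derivative dt J w t x / w t x) (at t within J)"
    unfolding lw_def[abs_def]
    using st_dt(1)[OF time w_st t, of x] w_pos[of t x]
    unfolding has_real_derivative_iff_has_vector_derivative[symmetric]
    by (auto intro!: derivative_eq_intros)
  then have "dt J lw t x = dt J w t x / w t x"
    by (intro dt_eqI[OF time t]) (simp add: has_real_derivative_iff_has_vector_derivative)
  then show ?thesis unfolding Dm_def dt_w_div[OF t] dds_w ds_w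
    by (simp add: power2_eq_square algebra_simps)
qed

text \<open>As \<open>It\<close> integrates against \<open>w dx\<close>, the term
  \<open>It w\<close> is the Dirichlet integral of the curve in the parameter \<open>x\<close>, and
  this is the functional of the gradient flow.\<close>

definition energy :: "real \<Rightarrow> real" where "energy t = nsq K t / 2 + lam / 2 * It w t"

text \<open>The right-hand side is minus the squared L^2 norm of \<open>vel\<close>, split into its
  normal and tangential parts. Two integrations by parts move the derivatives from \<open>V\<close>
  to \<open>K\<close>, after which the normal part is a pointwise identity.\<close>

lemma energy_deriv:
  assumes t: "t \<in> J"
  shows "(energy has_real_derivative - nsq V t - lam\<^sup>2 * nsq (ds w) t) (at t within J)"
proof -
  note c = sm_cont[of J, OF _, of _ "{0..2 * pi}" t]
  \<comment> \<open>The equation of \<open>T\<close> differentiated along the curve; one of the two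
    copies of \<open>g K\<close> is the commutator.\<close>
  have DK: "Dm K t x = ds (ds V) t x + ds g t x *\<^sub>R T t x + (2 * g t x) *\<^sub>R K t x" for x
  proof -
    have "ds (Dm T) t x = ds (\<lambda>t x. ds V t x + g t x *\<^sub>R T t x) t x"
      by (rule ds_cong) (rule Dm_T[OF t])
    then have "Dm K t x = ds (\<lambda>t x. ds V t x + g t x *\<^sub>R T t x) t x + g t x *\<^sub>R K t x"
      using Dm_ds[OF T_st t, of x] by (simp add: K_def)
    then show ?thesis by (simp add: ds_rules sms K_def[symmetric] algebra_simps)
      (simp flip: scaleR_add_left)
  qed
  have 1: "It (\<lambda>t x. 2 * (K t x \<bullet> Dm K t x) - g t x * (K t x \<bullet> K t x)) t
    = It (\<lambda>t x. 2 * (ds (ds V) t x \<bullet> K t x) + 3 * (g t x * (K t x \<bullet> K t x))) t"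
    unfolding It_def by (simp add: DK inner_add_right inner_commute algebra_simps)
  have 2: "It (\<lambda>t x. Dm w t x - g t x * w t x) t
    = It (\<lambda>t x. (- (2 * lam)) * (ds w t x \<bullet> ds w t x) + (- 2) * (g t x * w t x)) t"
  proof -
    have "It (\<lambda>t x. Dm w t x - g t x * w t x) t
      = It (\<lambda>t x. lam * (ds (ds w) t x \<bullet> w t x) + ((- lam) * (ds w t x \<bullet> ds w t x) + (- 2) * (g t x * w t x))) t"
      unfolding It_def by (simp add: Dm_w[OF t] power2_eq_square algebra_simps)
    also have "\<dots> = lam * It (\<lambda>t x. ds (ds w) t x \<bullet> w t x) t
       + It (\<lambda>t x. (- lam) * (ds w t x \<bullet> ds w t x) + (- 2) * (g t x * w t x)) t"
      by (subst It_add) (intro c sms | simp only: It_cmult)+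
    also have "It (\<lambda>t x. ds (ds w) t x \<bullet> w t x) t = - It (\<lambda>t x. ds w t x \<bullet> ds w t x) t"
      by (intro IBP sms)
    also have "It (\<lambda>t x. (- lam) * (ds w t x \<bullet> ds w t x) + (- 2) * (g t x * w t x)) t
       = - lam * It (\<lambda>t x. ds w t x \<bullet> ds w t x) t - 2 * It (\<lambda>t x. g t x * w t x) t"
      by (subst It_add, (intro c sms)+) (simp only: It_cmult; simp)
    also have "lam * - It (\<lambda>t x. ds w t x \<bullet> ds w t x) t + \<dots>
       = - (2 * lam) * It (\<lambda>t x. ds w t x \<bullet> ds w t x) t - 2 * It (\<lambda>t x. g t x * w t x) t"
      by (simp only: algebra_simps)
    also have "\<dots> = It (\<lambda>t x. (- (2 * lam)) * (ds w t x \<bullet> ds w t x) + (- 2) * (g t x * w t x)) t"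
      by (subst It_add, (intro c sms)+) (simp only: It_cmult; simp)
    finally show ?thesis .
  qed
  have 3: "It (\<lambda>t x. ds (ds V) t x \<bullet> K t x) t = It (\<lambda>t x. V t x \<bullet> ds (ds K) t x) t"
    by (simp add: IBP sms)
  \<comment> \<open>As \<open>V\<close> is normal, the multiple of \<open>T\<close> drops out of
    \<open><V, V'>\<close>, and \<open>V = V' - K_ss\<close> leaves \<open>- |V|^2\<close>.\<close>
  have 4: "V t x \<bullet> ds (ds K) t x + 3/2 * (g t x * (K t x \<bullet> K t x)) - lam * (g t x * w t x) = - (V t x \<bullet> V t x)" for x
  proof -
    have "V t x \<bullet> V t x = V t x \<bullet> V' t x - V t x \<bullet> ds (ds K) t x"
      using inner_diff_right[of "V t x" "V' t x" "ds (ds K) t x"] by (simp add: V_def)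
    also have "V t x \<bullet> V' t x = lam * (g t x * w t x) - 3/2 * (g t x * (K t x \<bullet> K t x))"
      by (simp add: V'_def g_def inner_diff_right inner_commute)
    finally show ?thesis by simp
  qed
  have "((\<lambda>t. nsq K t / 2 + lam / 2 * It w t) has_real_derivative
    It (\<lambda>t x. 2 * (K t x \<bullet> Dm K t x) - g t x * (K t x \<bullet> K t x)) t / 2
     + lam / 2 * It (\<lambda>t x. Dm w t x - g t x * w t x) t) (at t within J)"
    by (intro DERIV_add DERIV_cdivide DERIV_cmult nsq_deriv It_deriv K_st w_st t)
  moreover have "It (\<lambda>t x. 2 * (K t x \<bullet> Dm K t x) - g t x * (K t x \<bullet> K t x)) t / 2
     + lam / 2 * It (\<lambda>t x. Dm w t x - g t x * w t x) t = - nsq V t - lam\<^sup>2 * nsq (ds w) t"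
  proof -
    have "- nsq V t = It (\<lambda>t x. V t x \<bullet> ds (ds K) t x + 3/2 * (g t x * (K t x \<bullet> K t x)) - lam * (g t x * w t x)) t"
      unfolding nsq_def It_minus[symmetric] by (simp only: It_def 4)
    also have "\<dots> = It (\<lambda>t x. V t x \<bullet> ds (ds K) t x) t + 3/2 * It (\<lambda>t x. g t x * (K t x \<bullet> K t x)) t
       - lam * It (\<lambda>t x. g t x * w t x) t"
      by (subst It_diff, (intro c sms)+, subst It_add, (intro c sms)+) (simp only: It_cmult)
    finally have V: "- nsq V t = \<dots>" .
    have a: "It (\<lambda>t x. 2 * (ds (ds V) t x \<bullet> K t x) + 3 * (g t x * (K t x \<bullet> K t x))) t
      = 2 * It (\<lambda>t x. V t x \<bullet> ds (ds K) t x) t + 3 * It (\<lambda>t x. g t x * (K t x \<bullet> K t x)) t"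
      by (subst It_add, (intro c sms)+) (simp only: It_cmult 3)
    have b: "It (\<lambda>t x. (- (2 * lam)) * (ds w t x \<bullet> ds w t x) + (- 2) * (g t x * w t x)) t
      = - (2 * lam) * nsq (ds w) t - 2 * It (\<lambda>t x. g t x * w t x) t"
      unfolding nsq_def by (subst It_add, (intro c sms)+) (simp only: It_cmult; simp)
    show ?thesis unfolding 1 2 a b V by (simp add: algebra_simps power2_eq_square)
  qed
  ultimately show ?thesis unfolding energy_def[abs_def] by simp
qed

end

section \<open>Energy bounds and Gronwall\<close>

locale bounded_flow = flow J lam f for J lam and f :: "real \<Rightarrow> real \<Rightarrow> 'a::euclidean_space" +
  fixes tm :: real
  assumes J_eq: "J = {0..<tm}"
begin

definition bdd :: "(real \<Rightarrow> real) \<Rightarrow> bool" where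
  "bdd F \<longleftrightarrow> (\<exists>C. \<forall>t\<in>J. F t \<le> C)"

text \<open>Integrability in time is expressed by domination by the derivative of a bounded monotone
  function, so that no integral over time is ever formed.\<close>

definition L1 :: "(real \<Rightarrow> real) \<Rightarrow> bool" where
  "L1 a \<longleftrightarrow> (\<exists>A A' C. \<forall>t\<in>J. (A has_real_derivative A' t) (at t within J) \<and> a t \<le> A' t \<and> 0 \<le> A' t \<and> \<bar>A t\<bar> \<le> C)"

lemma L1_le: "L1 b \<Longrightarrow> (\<And>t. t \<in> J \<Longrightarrow> a t \<le> b t) \<Longrightarrow> L1 a"
  unfolding L1_def by (meson order_trans)

lemma L1_const [simp]: "L1 (\<lambda>t. c)"
  unfolding L1_def
proof (rule exI[of _ "\<lambda>t. \<bar>c\<bar> * t"], rule exI[of _ "\<lambda>t. \<bar>c\<bar>"], rule exI[of _ "\<bar>c\<bar> * tm"], intro ballI conjI)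
  fix t assume "t \<in> J"
  then show "\<bar>\<bar>c\<bar> * t\<bar> \<le> \<bar>c\<bar> * tm" by (auto simp: J_eq abs_mult intro!: mult_left_mono)
qed (auto intro!: derivative_eq_intros)

lemma L1_add:
  assumes "L1 a" "L1 b" shows "L1 (\<lambda>t. a t + b t)"
proof -
  obtain A A' C where A: "\<forall>t\<in>J. (A has_real_derivative A' t) (at t within J) \<and> a t \<le> A' t \<and> 0 \<le> A' t \<and> \<bar>A t\<bar> \<le> C"
    using assms(1) unfolding L1_def by blast
  obtain B B' D where B: "\<forall>t\<in>J. (B has_real_derivative B' t) (at t within J) \<and> b t \<le> B' t \<and> 0 \<le> B' t \<and> \<bar>B t\<bar> \<le> D"
    using assms(2) unfolding L1_def by blast
  have "\<forall>t\<in>J. ((\<lambda>t. A t + B t) has_real_derivative A' t + B' t) (at t within J) \<and> a t + b t \<le> A' t + B' t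
    \<and> 0 \<le> A' t + B' t \<and> \<bar>A t + B t\<bar> \<le> C + D"
  proof
    fix t assume t: "t \<in> J"
    with A B have "(A has_real_derivative A' t) (at t within J)" "(B has_real_derivative B' t) (at t within J)"
      "a t \<le> A' t" "0 \<le> A' t" "\<bar>A t\<bar> \<le> C" "b t \<le> B' t" "0 \<le> B' t" "\<bar>B t\<bar> \<le> D" by auto
    then show "((\<lambda>t. A t + B t) has_real_derivative A' t + B' t) (at t within J) \<and> a t + b t \<le> A' t + B' t
      \<and> 0 \<le> A' t + B' t \<and> \<bar>A t + B t\<bar> \<le> C + D" by (auto intro: DERIV_add)
  qed
  then show ?thesis unfolding L1_def by (intro exI)
qed

lemma L1_cmult:
  assumes "L1 a" "0 \<le> c" shows "L1 (\<lambda>t. c * a t)"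
proof -
  obtain A A' C where A: "\<forall>t\<in>J. (A has_real_derivative A' t) (at t within J) \<and> a t \<le> A' t \<and> 0 \<le> A' t \<and> \<bar>A t\<bar> \<le> C"
    using assms(1) unfolding L1_def by blast
  have "\<forall>t\<in>J. ((\<lambda>t. c * A t) has_real_derivative c * A' t) (at t within J) \<and> c * a t \<le> c * A' t
    \<and> 0 \<le> c * A' t \<and> \<bar>c * A t\<bar> \<le> c * C"
    using A assms(2) by (auto simp: abs_mult intro!: DERIV_cmult mult_left_mono)
  then show ?thesis unfolding L1_def by (intro exI)
qed

lemma L1_mult_bdd:
  assumes "L1 a" "bdd F" "\<And>t. t \<in> J \<Longrightarrow> 0 \<le> a t" shows "L1 (\<lambda>t. a t * F t)"
proof -
  obtain C where C: "\<forall>t\<in>J. F t \<le> C" using assms(2) unfolding bdd_def by blast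
  show ?thesis
  proof (rule L1_le[OF L1_cmult[OF assms(1), of "\<bar>C\<bar>"]])
    fix t assume "t \<in> J"
    then have "F t \<le> \<bar>C\<bar>" "0 \<le> a t" using C assms(3) by auto
    then show "a t * F t \<le> \<bar>C\<bar> * a t" by (simp add: mult.commute mult_right_mono)
  qed simp
qed

lemma bdd_L1: "bdd F \<Longrightarrow> L1 F"
  unfolding bdd_def using L1_le[OF L1_const] by blast

lemma bdd_le: "bdd F \<Longrightarrow> (\<And>t. t \<in> J \<Longrightarrow> G t \<le> F t) \<Longrightarrow> bdd G"
  unfolding bdd_def by (meson order_trans)

lemma bdd_add: "bdd F \<Longrightarrow> bdd G \<Longrightarrow> bdd (\<lambda>t. F t + G t)"
  unfolding bdd_def by (meson add_mono)

lemma bdd_cmult: "bdd F \<Longrightarrow> 0 \<le> c \<Longrightarrow> bdd (\<lambda>t. c * F t)"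
  unfolding bdd_def by (meson mult_left_mono)

lemma bdd_mult:
  assumes "bdd F" "bdd G" "\<And>t. 0 \<le> F t" "\<And>t. 0 \<le> G t" shows "bdd (\<lambda>t. F t * G t)"
proof -
  obtain C D where "\<forall>t\<in>J. F t \<le> C" "\<forall>t\<in>J. G t \<le> D" using assms(1,2) unfolding bdd_def by blast
  then have "\<forall>t\<in>J. F t * G t \<le> C * D" using assms(3,4) by (meson mult_mono order_trans)
  then show ?thesis unfolding bdd_def by blast
qed

lemma nonincreasing:
  assumes d: "\<And>t. t \<in> J \<Longrightarrow> (F has_real_derivative F' t) (at t within J)"
    and le: "\<And>t. t \<in> J \<Longrightarrow> F' t \<le> 0" and t: "t \<in> J"
  shows "F t \<le> F 0"
proof (rule DERIV_nonpos_imp_decreasing_open[of 0 t F])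
  show "0 \<le> t" using t by (simp add: J_eq)
  fix s assume s: "0 < s" "s < t"
  then have "s \<in> J" "at s within J = at s" using t by (auto simp: J_eq intro!: at_within_interior)
  then show "\<exists>y. (F has_real_derivative y) (at s) \<and> y \<le> 0" using d[of s] le[of s] by auto
next
  have "continuous_on J F" using d by (meson DERIV_continuous continuous_on_eq_continuous_within)
  then show "continuous_on {0..t} F" by (rule continuous_on_subset) (use t in \<open>auto simp: J_eq\<close>)
qed

text \<open>The function \<open>(1 + F) exp (- A)\<close> is nonincreasing, which bounds
  \<open>F\<close>. With \<open>1 + F \<le> M\<close> the same inequality yields
  \<open>b \<le> M A' - F'\<close>, so \<open>M A - F\<close> is a bounded primitive dominating
  \<open>b\<close>. In applications \<open>b\<close> is the highest-order norm of a parabolic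
  estimate.\<close>

lemma gronwall:
  assumes d: "\<And>t. t \<in> J \<Longrightarrow> (F has_real_derivative F' t) (at t within J)"
    and F: "\<And>t. 0 \<le> F t" and b: "\<And>t. 0 \<le> b t" and a: "L1 a"
    and le: "\<And>t. t \<in> J \<Longrightarrow> F' t + b t \<le> a t * (1 + F t)"
  shows "bdd F" "L1 b"
proof -
  obtain A A' C where A: "\<And>t. t \<in> J \<Longrightarrow> (A has_real_derivative A' t) (at t within J)"
      "\<And>t. t \<in> J \<Longrightarrow> a t \<le> A' t" "\<And>t. t \<in> J \<Longrightarrow> 0 \<le> A' t" "\<And>t. t \<in> J \<Longrightarrow> \<bar>A t\<bar> \<le> C"
    using a unfolding L1_def by blast
  have le': "F' t + b t \<le> A' t * (1 + F t)" if "t \<in> J" for t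
  proof -
    have "a t * (1 + F t) \<le> A' t * (1 + F t)" using A(2)[OF that] F[of t] by (intro mult_right_mono) auto
    then show ?thesis using le[OF that] by linarith
  qed
  have bound: "F t \<le> (1 + F 0) * exp (2 * C)" if t: "t \<in> J" for t
  proof -
    have "(1 + F t) * exp (- A t) \<le> (1 + F 0) * exp (- A 0)"
    proof (rule nonincreasing[OF _ _ t])
      fix s assume s: "s \<in> J"
      show "((\<lambda>t. (1 + F t) * exp (- A t)) has_real_derivative (F' s - A' s * (1 + F s)) * exp (- A s)) (at s within J)"
        by (auto intro!: derivative_eq_intros d[OF s] A(1)[OF s] simp: algebra_simps)
      show "(F' s - A' s * (1 + F s)) * exp (- A s) \<le> 0"
        using le'[OF s] b[of s] by (intro mult_nonpos_nonneg) auto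
    qed
    then have "1 + F t \<le> (1 + F 0) * (exp (- A 0) * exp (A t))"
      by (simp add: exp_minus field_simps)
    also have "exp (- A 0) * exp (A t) \<le> exp (2 * C)"
      using A(4)[OF t] A(4)[OF zero_J] by (simp flip: exp_add)
    finally have "1 + F t \<le> (1 + F 0) * exp (2 * C)" using F[of 0] by (simp add: mult_left_mono)
    then show ?thesis by simp
  qed
  then show bF: "bdd F" unfolding bdd_def by blast
  define M where "M = 1 + (1 + F 0) * exp (2 * C)"
  have M: "0 \<le> M" "\<And>t. t \<in> J \<Longrightarrow> 1 + F t \<le> M" using bound F[of 0] by (auto simp: M_def)
  have "b t \<le> M * A' t - F' t" "0 \<le> M * A' t - F' t" if "t \<in> J" for t
  proof -
    have "A' t * (1 + F t) \<le> A' t * M" using M(2) A(3) that by (intro mult_left_mono) auto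
    then show "b t \<le> M * A' t - F' t" using le'[OF that] by (simp add: mult.commute)
    then show "0 \<le> M * A' t - F' t" using b[of t] by linarith
  qed
  moreover have "\<bar>M * A t - F t\<bar> \<le> M * C + M" if "t \<in> J" for t
  proof -
    have "\<bar>M * A t\<bar> \<le> M * C" using A(4)[OF that] M(1) by (simp add: abs_mult mult_left_mono)
    then show ?thesis using M(2)[OF that] F[of t] by linarith
  qed
  moreover have "((\<lambda>t. M * A t - F t) has_real_derivative M * A' t - F' t) (at t within J)" if "t \<in> J" for t
    by (intro DERIV_diff DERIV_cmult A d that)
  ultimately show "L1 b" unfolding L1_def
    by (intro exI[of _ "\<lambda>t. M * A t - F t"] exI[of _ "\<lambda>t. M * A' t - F' t"] exI[of _ "M * C + M"]) auto
qed

lemma It_w_nonneg: "0 \<le> It w t"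
  by (rule It_nonneg) (simp add: w_pos less_imp_le)

lemma energy_nonneg: "0 \<le> energy t"
  unfolding energy_def using nsq_nonneg[of K t] It_w_nonneg[of t] lam_pos by simp

lemma energy_le: "t \<in> J \<Longrightarrow> energy t \<le> energy 0"
proof (rule nonincreasing[OF energy_deriv])
  fix s show "- nsq V s - lam\<^sup>2 * nsq (ds w) s \<le> 0"
    using nsq_nonneg[of V s] mult_nonneg_nonneg[OF zero_le_power2[of lam] nsq_nonneg[of "ds w" s]] by linarith
qed

text \<open>Minus the energy is nondecreasing and bounded, hence the primitive that
  \<open>L1\<close> asks for.\<close>

lemma L1_V: "L1 (nsq V)" and L1_dsw: "L1 (nsq (ds w))"
proof -
  have 1: "L1 (\<lambda>t. nsq V t + lam\<^sup>2 * nsq (ds w) t)"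
    unfolding L1_def
  proof (rule exI[of _ "\<lambda>t. - energy t"], rule exI[of _ "\<lambda>t. nsq V t + lam\<^sup>2 * nsq (ds w) t"],
      rule exI[of _ "energy 0"], intro ballI conjI)
    fix t assume t: "t \<in> J"
    show "((\<lambda>t. - energy t) has_real_derivative nsq V t + lam\<^sup>2 * nsq (ds w) t) (at t within J)"
      by (rule DERIV_cong[OF DERIV_minus[OF energy_deriv[OF t]]]) simp
    show "\<bar>- energy t\<bar> \<le> energy 0" using energy_nonneg energy_le[OF t] by simp
  qed (auto intro!: add_nonneg_nonneg mult_nonneg_nonneg nsq_nonneg)
  show "L1 (nsq V)" by (rule L1_le[OF 1]) (simp add: nsq_nonneg)
  have "nsq (ds w) t \<le> inverse (lam\<^sup>2) * (nsq V t + lam\<^sup>2 * nsq (ds w) t)" for t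
    using nsq_nonneg[of V t] lam_pos by (simp add: field_simps)
  then show "L1 (nsq (ds w))" by (intro L1_le[OF L1_cmult[OF 1, of "inverse (lam\<^sup>2)"]]) auto
qed

section \<open>Interpolation inequalities on a closed curve\<close>

lemma cont_norm [intro]: "sm J u \<Longrightarrow> continuous_on A (\<lambda>x. norm (u t x))"
  by (intro continuous_intros sm_cont)

lemma CS_norm:
  assumes "sm J u" "sm J v"
  shows "It (\<lambda>t x. norm (u t x) * norm (v t x)) t \<le> sqrt (nsq u t * nsq v t)"
  using It_CS[of "\<lambda>t x. norm (u t x)" t "\<lambda>t x. norm (v t x)"] cont_norm[OF assms(1)] cont_norm[OF assms(2)]
  by (intro real_le_rsqrt) (simp add: nsq_def power2_norm_eq_inner)

text \<open>Integration by parts moves one derivative to the other factor, then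
  Cauchy-Schwarz.\<close>

lemma nsq_ds_interpolate:
  assumes u: "sm J u" shows "nsq (ds u) t \<le> sqrt (nsq u t * nsq (ds (ds u)) t)"
proof -
  have "nsq (ds u) t = - It (\<lambda>t x. u t x \<bullet> ds (ds u) t x) t"
    unfolding nsq_def by (rule IBP) (intro u sm_ds)+
  also have "\<dots> = It (\<lambda>t x. - (u t x \<bullet> ds (ds u) t x)) t" by (simp add: It_minus)
  also have "\<dots> \<le> It (\<lambda>t x. norm (u t x) * norm (ds (ds u) t x)) t"
  proof (rule It_mono[where u = "\<lambda>t x. - (u t x \<bullet> ds (ds u) t x)" and v = "\<lambda>t x. norm (u t x) * norm (ds (ds u) t x)"])
    fix x show "- (u t x \<bullet> ds (ds u) t x) \<le> norm (u t x) * norm (ds (ds u) t x)"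
      using Cauchy_Schwarz_ineq2[of "u t x" "ds (ds u) t x"] by linarith
  qed (intro continuous_intros sm_cont[OF u] sm_cont[OF sm_ds[OF sm_ds[OF u]]])+
  also have "\<dots> \<le> sqrt (nsq u t * nsq (ds (ds u)) t)" by (intro CS_norm u sm_ds)
  finally show ?thesis .
qed

text \<open>Agmon's inequality on a closed curve: \<open>sup_bound\<close> for \<open>|u|^2\<close>,
  whose derivative is at most \<open>2 |u| |u_s|\<close>.\<close>

lemma sup_interpolate:
  assumes u: "sm J u"
  shows "(norm (u t x))\<^sup>2 \<le> nsq u t / len t + 2 * sqrt (nsq u t * nsq (ds u) t)"
proof -
  let ?h = "\<lambda>t x. 2 * (norm (u t x) * norm (ds u t x))"
  have "\<bar>ds (\<lambda>t x. u t x \<bullet> u t x) t y\<bar> \<le> ?h t y" for y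
    using Cauchy_Schwarz_ineq2[of "u t y" "ds u t y"] by (simp add: ds_inner u inner_commute)
  then have "u t x \<bullet> u t x \<le> nsq u t / len t + It ?h t"
    unfolding nsq_def by (intro sup_bound sm_inner u continuous_intros sm_cont[OF u] sm_cont[OF sm_ds[OF u]])
  also have "It ?h t \<le> 2 * sqrt (nsq u t * nsq (ds u) t)"
    unfolding It_cmult using CS_norm[OF u sm_ds[OF u]] by simp
  finally show ?thesis by (simp add: power2_norm_eq_inner)
qed

text \<open>A weak form of Fenchel's theorem. The component of the tangent along its own value
  \<open>T t 0\<close> has mean zero, being the derivative of a component of a closed curve, and
  equals 1 at the parameter 0. Hence the integral of \<open>|K|\<close>, which controls its
  oscillation, is at least 1, and Cauchy-Schwarz brings in the length.\<close>

lemma len_K: "1 \<le> nsq K t * len t"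
proof -
  define u where "u = (\<lambda>s y. T t 0 \<bullet> T s y)"
  have u: "sm J u" unfolding u_def by (intro sms)
  have "ds (\<lambda>s y. T t 0 \<bullet> f s y) = u" unfolding u_def by (simp add: ds_rules sms T_def)
  then have "It u t = 0" using It_ds[OF sm_inner[OF sm_const base_sm(7)], of "T t 0" t] by simp
  moreover have "u t 0 \<le> It u t / len t + It (\<lambda>t x. norm (K t x)) t"
  proof (rule sup_bound[OF u])
    show "\<bar>ds u t y\<bar> \<le> norm (K t y)" for y
      using Cauchy_Schwarz_ineq2[of "T t 0" "K t y"] unfolding u_def by (simp add: ds_rules sms K_def)
  qed (rule cont_norm[OF base_sm(3)])
  ultimately have "1 \<le> It (\<lambda>t x. norm (K t x)) t" by (simp add: u_def)
  then have "1 \<le> (It (\<lambda>t x. norm (K t x) * 1) t)\<^sup>2" by simp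
  also have "\<dots> \<le> nsq K t * len t"
    using It_CS[of "\<lambda>t x. norm (K t x)" t "\<lambda>t x. 1"]
      cont_norm[OF base_sm(3)] by (simp add: nsq_def len_def power2_norm_eq_inner)
  finally show ?thesis .
qed

lemma basic_bounds:
  obtains M where "M \<ge> 1" "\<And>t. t \<in> J \<Longrightarrow> nsq K t \<le> M" "\<And>t. t \<in> J \<Longrightarrow> It w t \<le> M"
    "\<And>t. t \<in> J \<Longrightarrow> len t \<le> M" "\<And>t. t \<in> J \<Longrightarrow> 1 / len t \<le> M"
proof -
  \<comment> \<open>\<open>2 * energy 0\<close> bounds \<open>nsq K\<close> and, by
    \<open>len_K\<close>, also \<open>1 / len\<close>; the last entry bounds the length through
    \<open>w \<le> (1 + w^2) / 2\<close>.\<close>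
  define M where "M = max 1 (max (2 * energy 0) (max (2 * energy 0 / lam) (pi + energy 0 / lam)))"
  have K: "nsq K t \<le> 2 * energy 0" and w: "It w t \<le> 2 * energy 0 / lam" if "t \<in> J" for t
  proof -
    have "nsq K t / 2 + lam / 2 * It w t \<le> energy 0" using energy_le[OF that] by (simp add: energy_def)
    moreover have "0 \<le> lam / 2 * It w t" "0 \<le> nsq K t / 2"
      using It_w_nonneg[of t] nsq_nonneg[of K t] lam_pos by auto
    ultimately have "nsq K t / 2 \<le> energy 0" "lam / 2 * It w t \<le> energy 0" by linarith+
    then show "nsq K t \<le> 2 * energy 0" "It w t \<le> 2 * energy 0 / lam"
      using lam_pos by (auto simp: field_simps)
  qed
  have l: "len t \<le> pi + energy 0 / lam" if "t \<in> J" for t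
  proof -
    have cw: "continuous_on {0..2 * pi} (w t)" by (rule sm_cont[OF base_sm(1)])
    have "len t = integral {0..2 * pi} (w t)" by (simp add: len_def It_def)
    also have "\<dots> \<le> integral {0..2 * pi} (\<lambda>x. 1 / 2 + w t x * w t x / 2)"
    proof (rule integral_le)
      fix x show "w t x \<le> 1 / 2 + w t x * w t x / 2"
        using sum_squares_ge_zero[of "w t x - 1" 0] by (simp add: algebra_simps)
    qed (intro integrable_continuous_interval continuous_intros cw; simp)+
    also have "\<dots> = integral {0..2 * pi} (\<lambda>x. 1 / 2) + integral {0..2 * pi} (\<lambda>x. w t x * w t x / 2)"
      by (intro integral_add integrable_continuous_interval continuous_intros cw) auto
    also have "\<dots> = pi + It w t / 2" by (simp add: It_def)
    also have "\<dots> \<le> pi + energy 0 / lam" using w[OF that] by (simp add: field_simps)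
    finally show ?thesis .
  qed
  have i: "1 / len t \<le> 2 * energy 0" if "t \<in> J" for t
  proof -
    have "1 / len t \<le> nsq K t" using len_K[of t] len_pos[of t] by (simp add: field_simps)
    with K[OF that] show ?thesis by simp
  qed
  have M: "1 \<le> M" "2 * energy 0 \<le> M" "2 * energy 0 / lam \<le> M" "pi + energy 0 / lam \<le> M"
    by (simp_all add: M_def le_max_iff_disj)
  show thesis
    by (rule that[of M]) (rule M(1) | (rule order_trans[OF K M(2)] order_trans[OF w M(3)]
      order_trans[OF l M(4)] order_trans[OF i M(2)], assumption))+
qed

text \<open>The inequality of arithmetic and geometric means removes the square root in
  \<open>sup_interpolate\<close>. One constant serves all fields and times because the length stays
  away from zero.\<close>

lemma sup_bound_sq:
  obtains M where "M \<ge> 1"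
    "\<And>(u :: real \<Rightarrow> real \<Rightarrow> 'b::euclidean_space) t x. sm J u \<Longrightarrow> t \<in> J \<Longrightarrow> (norm (u t x))\<^sup>2 \<le> M * (nsq u t + nsq (ds u) t)"
proof -
  obtain M where M: "M \<ge> 1" "\<And>t. t \<in> J \<Longrightarrow> 1 / len t \<le> M" using basic_bounds by metis
  have "(norm (u t x))\<^sup>2 \<le> (M + 1) * (nsq u t + nsq (ds u) t)" if "sm J u" "t \<in> J"
    for u :: "real \<Rightarrow> real \<Rightarrow> 'b" and t x
  proof -
    have "nsq u t / len t \<le> M * nsq u t"
      using mult_right_mono[OF M(2)[OF that(2)] nsq_nonneg[of u t]] by simp
    moreover have "2 * sqrt (nsq u t * nsq (ds u) t) \<le> nsq u t + nsq (ds u) t"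
      using arith_geo_mean_sqrt[OF nsq_nonneg[of u t] nsq_nonneg[of "ds u" t]] by simp
    moreover have "0 \<le> M * nsq (ds u) t" using M(1) nsq_nonneg[of "ds u" t] by simp
    ultimately show ?thesis using sup_interpolate[OF that(1), of t x] by (simp add: algebra_simps)
  qed
  then show thesis using that[of "M + 1"] M(1) by auto
qed

text \<open>Above the threshold \<open>R\<close> the second and third powers are dominated by
  \<open>d r^4\<close>; below it they are bounded by their values at \<open>R\<close>.\<close>

lemma poly_absorb:
  fixes a b c d :: real
  assumes "d > 0"
  obtains C where "\<And>r. r \<ge> 0 \<Longrightarrow> a + b * r^2 + c * r^3 \<le> d * r^4 + C"
proof -
  define R where "R = max 1 ((\<bar>b\<bar> + \<bar>c\<bar>) / d)"
  have "a + b * r^2 + c * r^3 \<le> d * r^4 + (\<bar>a\<bar> + \<bar>b\<bar> * R^2 + \<bar>c\<bar> * R^3)" if r: "r \<ge> 0" for r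
  proof (cases "r \<ge> R")
    case True
    have r1: "1 \<le> r" "(\<bar>b\<bar> + \<bar>c\<bar>) / d \<le> r" using True by (auto simp: R_def)
    have "b * r^2 \<le> \<bar>b\<bar> * r^3" using r1(1) by (intro mult_mono power_increasing) auto
    moreover have "c * r^3 \<le> \<bar>c\<bar> * r^3" using r by (intro mult_right_mono) auto
    moreover have "(\<bar>b\<bar> + \<bar>c\<bar>) * r^3 \<le> (d * r) * r^3"
      using r1(2) assms r by (intro mult_right_mono) (auto simp: field_simps)
    moreover have "0 \<le> \<bar>b\<bar> * R^2" "0 \<le> \<bar>c\<bar> * R^3" by (auto simp: R_def)
    moreover have "(\<bar>b\<bar> + \<bar>c\<bar>) * r^3 = \<bar>b\<bar> * r^3 + \<bar>c\<bar> * r^3" "(d * r) * r^3 = d * r^4"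
      by (simp_all add: distrib_right power_Suc eval_nat_numeral)
    ultimately show ?thesis by linarith
  next
    case False
    have "b * r^2 \<le> \<bar>b\<bar> * R^2" "c * r^3 \<le> \<bar>c\<bar> * R^3" using False r
      by (intro mult_mono power_mono; auto)+
    moreover have "0 \<le> d * r^4" using assms r by simp
    ultimately show ?thesis by simp
  qed
  then show thesis using that by blast
qed

text \<open>The coefficients may depend on the fixed time \<open>t\<close>, so suprema over the
  curve can be inserted for them.\<close>

lemma It_le4:
  assumes c: "continuous_on {0..2 * pi} (v t)" and le: "\<And>x. v t x \<le> a * (norm (ds w t x))\<^sup>2 + b * (norm (ds K t x))\<^sup>2
     + c * (norm (ds (ds K) t x))\<^sup>2 + d * (norm (K t x))\<^sup>2"
  shows "It v t \<le> a * nsq (ds w) t + b * nsq (ds K) t + c * nsq (ds (ds K)) t + d * nsq K t"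
proof -
  note i = sm_cont[of J, OF _, of _ "{0..2 * pi}" t]
  have "It v t \<le> It (\<lambda>t x. ((a * (ds w t x \<bullet> ds w t x) + b * (ds K t x \<bullet> ds K t x))
     + c * (ds (ds K) t x \<bullet> ds (ds K) t x)) + d * (K t x \<bullet> K t x)) t"
    by (rule It_mono[where u = v and t = t]) (rule c, intro i sms, use le in \<open>simp only: power2_norm_eq_inner\<close>)
  also have "\<dots> = a * nsq (ds w) t + b * nsq (ds K) t + c * nsq (ds (ds K)) t + d * nsq K t"
    unfolding nsq_def
    by (subst It_add, (intro i sms)+, subst It_add, (intro i sms)+, subst It_add, (intro i sms)+)
       (simp only: It_cmult)
  finally show ?thesis .
qed

end

section \<open>Second derivatives of the curvature\<close>

lemma power2_sum3_le: "((x::real) + y + z)\<^sup>2 \<le> 3 * (x\<^sup>2 + y\<^sup>2 + z\<^sup>2)"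
proof -
  have "0 \<le> (x - y)\<^sup>2 + (y - z)\<^sup>2 + (x - z)\<^sup>2" by simp
  then show ?thesis by (simp add: power2_eq_square algebra_simps)
qed

lemma power2_sum2_le: "((x::real) + y)\<^sup>2 \<le> 2 * (x\<^sup>2 + y\<^sup>2)"
  using power2_sum3_le[of x y 0] sum_squares_ge_zero[of "x - y" 0] by (simp add: power2_eq_square algebra_simps)

context bounded_flow
begin

text \<open>The mean of \<open>w\<close> is bounded by means of energy and length, its oscillation
  by \<open>sqrt (len * nsq (ds w))\<close>. The bound is not uniform in time, but its right-hand
  side is integrable in time.\<close>

lemma w_sq_bound:
  obtains C where "C \<ge> 1" "\<And>t x. t \<in> J \<Longrightarrow> (w t x)\<^sup>2 \<le> C * (1 + nsq (ds w) t)"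
proof -
  obtain M where M: "M \<ge> 1" "\<And>t. t \<in> J \<Longrightarrow> It w t \<le> M" "\<And>t. t \<in> J \<Longrightarrow> len t \<le> M" "\<And>t. t \<in> J \<Longrightarrow> 1 / len t \<le> M"
    using basic_bounds by metis
  have "(w t x)\<^sup>2 \<le> (2 * (M * M)\<^sup>2 + 2 * M) * (1 + nsq (ds w) t)" if t: "t \<in> J" for t x
  proof -
    let ?h = "It (\<lambda>t x. norm (ds w t x)) t"
    note c = cont_norm[OF sm_ds[OF w_sm]]
    have "?h\<^sup>2 = (It (\<lambda>t x. norm (ds w t x) * 1) t)\<^sup>2" by simp
    also have "\<dots> \<le> nsq (ds w) t * len t"
      using It_CS[of "\<lambda>t x. norm (ds w t x)" t "\<lambda>t x. 1"] c by (simp add: nsq_def len_def power2_eq_square)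
    also have "\<dots> \<le> nsq (ds w) t * M" by (intro mult_left_mono M nsq_nonneg t)
    finally have h: "?h\<^sup>2 \<le> nsq (ds w) t * M" .
    have "w t x \<le> It w t / len t + ?h" by (rule sup_bound[OF w_sm c]) simp
    moreover have "It w t * (1 / len t) \<le> M * M"
      using M(1) len_pos[of t] by (intro mult_mono M t It_w_nonneg) auto
    ultimately have "w t x \<le> M * M + ?h" by simp
    then have "(w t x)\<^sup>2 \<le> (M * M + ?h)\<^sup>2" using w_pos[of t x] by (intro power_mono) auto
    also have "\<dots> \<le> 2 * ((M * M)\<^sup>2 + ?h\<^sup>2)" by (rule power2_sum2_le)
    also have "\<dots> \<le> 2 * (M * M)\<^sup>2 + 2 * M * nsq (ds w) t" using h by (simp add: mult_ac)
    also have "\<dots> \<le> (2 * (M * M)\<^sup>2 + 2 * M) * (1 + nsq (ds w) t)"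
      using M(1) nsq_nonneg[of "ds w" t] by (simp add: algebra_simps)
    finally show ?thesis .
  qed
  moreover have "1 \<le> 2 * (M * M)\<^sup>2 + 2 * M" using M(1) zero_le_power2[of "M * M"] by linarith
  ultimately show thesis using that by blast
qed

text \<open>At the fixed time \<open>k\<close> and \<open>om\<close> majorize the squares of
  curvature and density. They replace all but one factor of each squared product, so that
  integration leaves only the norms of \<open>K\<close> and \<open>K_s\<close>.\<close>

lemma V'_pointwise:
  assumes k: "\<And>x. (norm (K t x))\<^sup>2 \<le> k" and om: "\<And>x. (w t x)\<^sup>2 \<le> om"
  shows "(norm (V' t x))\<^sup>2 \<le> 3 * (lam\<^sup>2 * om + 9/4 * k\<^sup>2) * (norm (K t x))\<^sup>2 + 27 * k * (norm (ds K t x))\<^sup>2"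
proof -
  let ?a = "norm (K t x)" and ?p = "norm (ds K t x)"
  have "norm (V' t x) \<le> lam * w t x * ?a + 3/2 * ?a^3 + 3 * (?a * ?p)"
  proof -
    have "\<bar>K t x \<bullet> ds K t x\<bar> \<le> ?a * ?p" by (rule Cauchy_Schwarz_ineq2)
    then show ?thesis
      unfolding V'_def
      using norm_triangle_ineq4[of "(lam * w t x) *\<^sub>R K t x - (3/2 * (K t x \<bullet> K t x)) *\<^sub>R K t x" "(3 * (K t x \<bullet> ds K t x)) *\<^sub>R T t x"]
        norm_triangle_ineq4[of "(lam * w t x) *\<^sub>R K t x" "(3/2 * (K t x \<bullet> K t x)) *\<^sub>R K t x"]
        lam_pos w_pos[of t x]
      by (simp add: abs_mult power3_eq_cube flip: power2_norm_eq_inner) (simp add: power2_eq_square)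
  qed
  then have "(norm (V' t x))\<^sup>2 \<le> (lam * w t x * ?a + 3/2 * ?a^3 + 3 * (?a * ?p))\<^sup>2"
    by (intro power_mono) auto
  also have "\<dots> \<le> 3 * ((lam * w t x * ?a)\<^sup>2 + (3/2 * ?a^3)\<^sup>2 + (3 * (?a * ?p))\<^sup>2)" by (rule power2_sum3_le)
  also have "\<dots> = 3 * (lam\<^sup>2 * (w t x)\<^sup>2 * ?a\<^sup>2 + 9/4 * (?a\<^sup>2)\<^sup>2 * ?a\<^sup>2 + 9 * ?a\<^sup>2 * ?p\<^sup>2)"
    by (simp add: power2_eq_square power3_eq_cube algebra_simps)
  also have "\<dots> \<le> 3 * (lam\<^sup>2 * om * ?a\<^sup>2 + 9/4 * k\<^sup>2 * ?a\<^sup>2 + 9 * k * ?p\<^sup>2)"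
    by (intro mult_left_mono add_mono mult_right_mono power_mono k om) auto
  finally show ?thesis by (simp add: algebra_simps)
qed

lemma K_inner_V': "K t x \<bullet> V' t x = lam * w t x * (norm (K t x))\<^sup>2 - 3/2 * (norm (K t x))^4"
  by (simp add: V'_def inner_diff_right power2_norm_eq_inner power4_eq_xxxx flip: power2_norm_eq_inner)
     (simp add: power2_eq_square)?

lemma g_pointwise:
  assumes k: "\<And>x. (norm (K t x))\<^sup>2 \<le> k" and om: "\<And>x. (w t x)\<^sup>2 \<le> om"
  shows "(g t x)\<^sup>2 \<le> 3 * k * (norm (ds (ds K) t x))\<^sup>2 + 3 * (9/4 * k^3 + lam\<^sup>2 * om * k) * (norm (K t x))\<^sup>2"
proof -
  let ?a = "norm (K t x)" and ?q = "norm (ds (ds K) t x)"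
  have k0: "0 \<le> k" using k[of x] by (meson order_trans zero_le_power2)
  have om0: "0 \<le> om" using om[of x] by (meson order_trans zero_le_power2)
  have "\<bar>g t x\<bar> \<le> ?a * ?q + 3/2 * ?a^4 + lam * w t x * ?a\<^sup>2"
  proof -
    have "g t x = lam * w t x * ?a\<^sup>2 - 3/2 * ?a^4 - K t x \<bullet> ds (ds K) t x"
      unfolding g_def V_def inner_diff_right K_inner_V' ..
    moreover have "\<bar>K t x \<bullet> ds (ds K) t x\<bar> \<le> ?a * ?q" by (rule Cauchy_Schwarz_ineq2)
    moreover have "0 \<le> lam * w t x * ?a\<^sup>2" "0 \<le> ?a^4" using lam_pos w_pos[of t x] by auto
    ultimately show ?thesis by linarith
  qed
  then have "(g t x)\<^sup>2 \<le> (?a * ?q + 3/2 * ?a^4 + lam * w t x * ?a\<^sup>2)\<^sup>2"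
    using power_mono[of "\<bar>g t x\<bar>" _ 2] by simp
  also have "\<dots> \<le> 3 * ((?a * ?q)\<^sup>2 + (3/2 * ?a^4)\<^sup>2 + (lam * w t x * ?a\<^sup>2)\<^sup>2)" by (rule power2_sum3_le)
  also have "\<dots> = 3 * (?a\<^sup>2 * ?q\<^sup>2 + 9/4 * (?a\<^sup>2)^3 * ?a\<^sup>2 + lam\<^sup>2 * (w t x)\<^sup>2 * ?a\<^sup>2 * ?a\<^sup>2)"
    by (simp add: power2_eq_square power3_eq_cube power4_eq_xxxx algebra_simps)
  also have "\<dots> \<le> 3 * (k * ?q\<^sup>2 + 9/4 * k^3 * ?a\<^sup>2 + lam\<^sup>2 * om * k * ?a\<^sup>2)"
  proof -
    have "lam\<^sup>2 * (w t x)\<^sup>2 * ?a\<^sup>2 \<le> lam\<^sup>2 * om * k" using om0 by (intro mult_mono k om) auto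
    moreover have "9/4 * (?a\<^sup>2)^3 \<le> 9/4 * k^3" by (intro mult_left_mono power_mono k) auto
    ultimately show ?thesis by (intro mult_left_mono add_mono mult_right_mono k) auto
  qed
  finally show ?thesis by (simp add: algebra_simps)
qed

lemma sm_divide: "sm J u \<Longrightarrow> sm J (\<lambda>t x. u t x / (c::real))"
  using sm_mult[of J u "\<lambda>t x. inverse c"] by (simp add: divide_inverse)

lemma ds_divide: "sm J u \<Longrightarrow> ds (\<lambda>t x. u t x / (c::real)) = (\<lambda>t x. ds u t x / c)"
  using ds_mult[of u "\<lambda>t x. inverse c"] by (simp add: divide_inverse)

lemma dsV'_eq: "ds V' t x = (lam * ds w t x) *\<^sub>R K t x + (lam * w t x) *\<^sub>R ds K t x
   - (6 * (K t x \<bullet> ds K t x)) *\<^sub>R K t x - (3/2 * (K t x \<bullet> K t x)) *\<^sub>R ds K t x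
   - (3 * (ds K t x \<bullet> ds K t x + K t x \<bullet> ds (ds K) t x)) *\<^sub>R T t x"
  unfolding V'_def[abs_def]
  by (simp add: ds_rules ds_divide sm_divide sms K_def[symmetric] inner_commute)
    (simp add: algebra_simps flip: scaleR_add_left)

lemma dsV'_pointwise:
  assumes k: "\<And>x. (norm (K t x))\<^sup>2 \<le> k" and om: "\<And>x. (w t x)\<^sup>2 \<le> om" and P: "\<And>x. (norm (ds K t x))\<^sup>2 \<le> P"
  shows "(norm (ds V' t x))\<^sup>2 \<le> 9 * lam\<^sup>2 * k * (norm (ds w t x))\<^sup>2
    + (9 * lam\<^sup>2 * om + 1000 * k\<^sup>2 + 100 * P) * (norm (ds K t x))\<^sup>2 + 100 * k * (norm (ds (ds K) t x))\<^sup>2"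
proof -
  let ?a = "norm (K t x)" and ?p = "norm (ds K t x)" and ?q = "norm (ds (ds K) t x)" and ?o = "norm (ds w t x)"
  define A where "A = lam * ?o * ?a"
  define B where "B = lam * w t x * ?p"
  \<comment> \<open>\<open>15/2 = 6 + 3/2\<close> adds up the two terms bounded by multiples of
    \<open>|K|^2 |K_s|\<close>.\<close>
  define C where "C = 15/2 * ?a\<^sup>2 * ?p + 3 * ?p\<^sup>2 + 3 * (?a * ?q)"
  have 1: "\<bar>K t x \<bullet> ds K t x\<bar> \<le> ?a * ?p" "\<bar>K t x \<bullet> ds (ds K) t x\<bar> \<le> ?a * ?q" by (rule Cauchy_Schwarz_ineq2)+
  have "norm (ds V' t x) \<le> norm ((lam * ds w t x) *\<^sub>R K t x) + norm ((lam * w t x) *\<^sub>R ds K t x)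
    + norm ((6 * (K t x \<bullet> ds K t x)) *\<^sub>R K t x) + norm ((3/2 * (K t x \<bullet> K t x)) *\<^sub>R ds K t x)
    + norm ((3 * (ds K t x \<bullet> ds K t x + K t x \<bullet> ds (ds K) t x)) *\<^sub>R T t x)"
    unfolding dsV'_eq by (intro order_trans[OF norm_triangle_ineq4] add_mono order_trans[OF norm_triangle_ineq] order_refl)
  also have "norm ((lam * ds w t x) *\<^sub>R K t x) = A" using lam_pos by (simp add: A_def abs_mult)
  also have "norm ((lam * w t x) *\<^sub>R ds K t x) = B" using lam_pos w_pos[of t x] by (simp add: B_def abs_mult)
  also have "norm ((6 * (K t x \<bullet> ds K t x)) *\<^sub>R K t x) \<le> 6 * ?a\<^sup>2 * ?p"
    using mult_right_mono[OF 1(1), of ?a] by (simp add: abs_mult power2_eq_square algebra_simps)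
  also have "norm ((3/2 * (K t x \<bullet> K t x)) *\<^sub>R ds K t x) = 3/2 * ?a\<^sup>2 * ?p"
    by (simp add: abs_mult power2_norm_eq_inner)
  also have "norm ((3 * (ds K t x \<bullet> ds K t x + K t x \<bullet> ds (ds K) t x)) *\<^sub>R T t x) \<le> 3 * ?p\<^sup>2 + 3 * (?a * ?q)"
    using 1(2) unfolding power2_norm_eq_inner by (simp add: abs_mult) (smt (verit) inner_ge_zero)
  finally have "norm (ds V' t x) \<le> A + B + C" by (simp add: C_def algebra_simps)
  then have "(norm (ds V' t x))\<^sup>2 \<le> (A + B + C)\<^sup>2" by (intro power_mono) auto
  also have "\<dots> \<le> 3 * (A\<^sup>2 + B\<^sup>2 + C\<^sup>2)" by (rule power2_sum3_le)
  also have "A\<^sup>2 \<le> lam\<^sup>2 * k * ?o\<^sup>2"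
  proof -
    have "A\<^sup>2 = lam\<^sup>2 * ?a\<^sup>2 * ?o\<^sup>2" by (simp add: A_def power_mult_distrib algebra_simps)
    also have "\<dots> \<le> lam\<^sup>2 * k * ?o\<^sup>2" by (intro mult_right_mono mult_left_mono k) auto
    finally show ?thesis .
  qed
  also have "B\<^sup>2 \<le> lam\<^sup>2 * om * ?p\<^sup>2"
  proof -
    have "B\<^sup>2 = lam\<^sup>2 * (w t x)\<^sup>2 * ?p\<^sup>2" by (simp add: B_def power_mult_distrib algebra_simps)
    also have "\<dots> \<le> lam\<^sup>2 * om * ?p\<^sup>2" by (intro mult_right_mono mult_left_mono om) auto
    finally show ?thesis .
  qed
  also have "C\<^sup>2 \<le> 3 * (225/4 * k\<^sup>2 * ?p\<^sup>2 + 9 * P * ?p\<^sup>2 + 9 * k * ?q\<^sup>2)"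
  proof -
    have "C\<^sup>2 \<le> 3 * ((15/2 * ?a\<^sup>2 * ?p)\<^sup>2 + (3 * ?p\<^sup>2)\<^sup>2 + (3 * (?a * ?q))\<^sup>2)" unfolding C_def by (rule power2_sum3_le)
    also have "\<dots> = 3 * (225/4 * (?a\<^sup>2)\<^sup>2 * ?p\<^sup>2 + 9 * ?p\<^sup>2 * ?p\<^sup>2 + 9 * ?a\<^sup>2 * ?q\<^sup>2)"
      by (simp add: power2_eq_square algebra_simps)
    also have "\<dots> \<le> 3 * (225/4 * k\<^sup>2 * ?p\<^sup>2 + 9 * P * ?p\<^sup>2 + 9 * k * ?q\<^sup>2)"
      by (intro mult_left_mono add_mono mult_right_mono power_mono k P) auto
    finally show ?thesis .
  qed
  finally have "(norm (ds V' t x))\<^sup>2 \<le> 3 * (lam\<^sup>2 * k * ?o\<^sup>2 + lam\<^sup>2 * om * ?p\<^sup>2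
      + 3 * (225/4 * k\<^sup>2 * ?p\<^sup>2 + 9 * P * ?p\<^sup>2 + 9 * k * ?q\<^sup>2))" by simp
  \<comment> \<open>The constants are rounded up from \<open>3 lam^2\<close>, \<open>2025/4\<close>
    and \<open>81\<close>.\<close>
  also have "\<dots> \<le> 9 * lam\<^sup>2 * k * ?o\<^sup>2 + (9 * lam\<^sup>2 * om + 1000 * k\<^sup>2 + 100 * P) * ?p\<^sup>2 + 100 * k * ?q\<^sup>2"
  proof -
    have k0: "0 \<le> k" "0 \<le> om" "0 \<le> P" using k[of x] om[of x] P[of x] by (meson order_trans zero_le_power2)+
    then have "0 \<le> lam\<^sup>2 * k * ?o\<^sup>2" "0 \<le> lam\<^sup>2 * om * ?p\<^sup>2" "0 \<le> k\<^sup>2 * ?p\<^sup>2" "0 \<le> P * ?p\<^sup>2" "0 \<le> k * ?q\<^sup>2"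
      by auto
    then show ?thesis by (simp add: algebra_simps)
  qed
  finally show ?thesis .
qed

text \<open>The square root in Agmon's inequality is kept: the supremum of \<open>|K|^2\<close>
  grows only linearly in the norm of \<open>K_s\<close>. Hence \<open>k^2\<close> costs no more than
  a multiple of \<open>1 + nsq (ds K)\<close>, on which both \<open>L1_ddK\<close> and
  \<open>dsK_estimate\<close> rely.\<close>

lemma K_sup:
  obtains c where "c \<ge> 1"
    "\<And>t. t \<in> J \<Longrightarrow> \<exists>k. (\<forall>x. (norm (K t x))\<^sup>2 \<le> k) \<and> k \<le> c * (1 + sqrt (nsq (ds K) t))"
proof -
  obtain M where M: "M \<ge> 1" "\<And>t. t \<in> J \<Longrightarrow> nsq K t \<le> M" "\<And>t. t \<in> J \<Longrightarrow> 1 / len t \<le> M"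
    using basic_bounds by metis
  have "(norm (K t x))\<^sup>2 \<le> (2 * M * M) * (1 + sqrt (nsq (ds K) t))" if t: "t \<in> J" for t x
  proof -
    have "(norm (K t x))\<^sup>2 \<le> nsq K t * (1 / len t) + 2 * (sqrt (nsq K t) * sqrt (nsq (ds K) t))"
      using sup_interpolate[OF base_sm(3), of t x] by (simp add: real_sqrt_mult)
    also have "nsq K t * (1 / len t) \<le> M * M"
      using M(1) len_pos[of t] by (intro mult_mono M t nsq_nonneg) auto
    also have "2 * (sqrt (nsq K t) * sqrt (nsq (ds K) t)) \<le> 2 * (M * M * sqrt (nsq (ds K) t))"
    proof -
      \<comment> \<open>Crude, so that \<open>M * M\<close> bounds the square root of
        \<open>nsq K\<close> too.\<close>
      have "nsq K t \<le> (M * M)\<^sup>2"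
      proof -
        have "(M * M)\<^sup>2 = M^4" by (simp add: power2_eq_square power4_eq_xxxx)
        then show ?thesis using M(2)[OF t] self_le_power[of M 4] M(1) by linarith
      qed
      then have "sqrt (nsq K t) \<le> M * M" using M(1) by (intro real_le_lsqrt) auto
      then show ?thesis by (intro mult_left_mono mult_right_mono) (auto simp: nsq_nonneg)
    qed
    finally have "(norm (K t x))\<^sup>2 \<le> M * M + 2 * (M * M * sqrt (nsq (ds K) t))" by simp
    moreover have "0 \<le> M * M" using M(1) by simp
    moreover have "2 * M * M * (1 + sqrt (nsq (ds K) t)) = 2 * (M * M) + 2 * (M * M * sqrt (nsq (ds K) t))"
      by (simp add: algebra_simps)
    ultimately show ?thesis by linarith
  qed
  moreover have "1 \<le> 2 * M * M" using mult_mono[of 1 M 1 M] M(1) by simp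
  ultimately show thesis using that[of "2 * M * M"] by blast
qed

text \<open>By definition \<open>K_ss = V' - V\<close>, and \<open>nsq V\<close> is integrable in
  time. Up to an integrable contribution of \<open>w\<close>, the squared norm of \<open>V'\<close>
  is at most cubic in the norm \<open>r\<close> of \<open>K_s\<close>, whereas interpolation bounds
  \<open>r^4\<close> by \<open>M * nsq (ds (ds K))\<close>. So it is absorbed by half of the
  left-hand side.\<close>

lemma L1_ddK: "L1 (nsq (ds (ds K)))"
proof -
  obtain M where M: "M \<ge> 1" "\<And>t. t \<in> J \<Longrightarrow> nsq K t \<le> M" using basic_bounds by metis
  obtain C where C: "C \<ge> 1" "\<And>t x. t \<in> J \<Longrightarrow> (w t x)\<^sup>2 \<le> C * (1 + nsq (ds w) t)" using w_sq_bound by metis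
  obtain c where c: "c \<ge> 1" "\<And>t. t \<in> J \<Longrightarrow> \<exists>k. (\<forall>x. (norm (K t x))\<^sup>2 \<le> k) \<and> k \<le> c * (1 + sqrt (nsq (ds K) t))"
    using K_sup by metis
  \<comment> \<open>The factor \<open>1 / (2 * M)\<close> is chosen to turn \<open>r^4\<close> into
    at most half of \<open>nsq (ds (ds K))\<close>.\<close>
  obtain R where R: "\<And>r. r \<ge> 0 \<Longrightarrow> 2 * (27/2 * c\<^sup>2 * M) + 2 * (27/2 * c\<^sup>2 * M + 27 * c) * r^2 + 2 * (27 * c) * r^3 \<le> 1 / (2 * M) * r^4 + R"
    using poly_absorb[of "1 / (2 * M)" "2 * (27/2 * c\<^sup>2 * M)" "2 * (27/2 * c\<^sup>2 * M + 27 * c)" "2 * (27 * c)"] M(1) by auto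
  have le: "nsq (ds (ds K)) t \<le> 4 * nsq V t + 12 * (lam\<^sup>2 * (C * (1 + nsq (ds w) t))) * M + 2 * R" if t: "t \<in> J" for t
  proof -
    note i = sm_cont[of J, OF _, of _ "{0..2 * pi}" t]
    define om where "om = C * (1 + nsq (ds w) t)"
    define r where "r = sqrt (nsq (ds K) t)"
    define B where "B = nsq (ds (ds K)) t"
    have r: "0 \<le> r" "r\<^sup>2 = nsq (ds K) t" by (auto simp: r_def nsq_nonneg)
    obtain k where k: "\<And>x. (norm (K t x))\<^sup>2 \<le> k" "k \<le> c * (1 + r)" using c(2)[OF t] unfolding r_def by blast
    have k0: "0 \<le> k" using k(1)[of 0] by (meson order_trans zero_le_power2)
    have "(norm (ds (ds K) t x))\<^sup>2 \<le> 2 * (norm (V t x))\<^sup>2 + 2 * (norm (V' t x))\<^sup>2" for x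
    proof -
      have "ds (ds K) t x = V' t x - V t x" by (simp add: V_def)
      then have "norm (ds (ds K) t x) \<le> norm (V t x) + norm (V' t x)" using norm_triangle_ineq4 add.commute by metis
      then have "(norm (ds (ds K) t x))\<^sup>2 \<le> (norm (V t x) + norm (V' t x))\<^sup>2" by (intro power_mono) auto
      from order_trans[OF this power2_sum2_le] show ?thesis by (simp only: distrib_left)
    qed
    then have "B \<le> It (\<lambda>t x. 2 * (V t x \<bullet> V t x) + 2 * (V' t x \<bullet> V' t x)) t"
      unfolding B_def nsq_def
      by (intro It_mono[where u = "\<lambda>t x. ds (ds K) t x \<bullet> ds (ds K) t x" and t = t
          and v = "\<lambda>t x. 2 * (V t x \<bullet> V t x) + 2 * (V' t x \<bullet> V' t x)"] i sms)
        (simp add: power2_norm_eq_inner)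
    also have "\<dots> = 2 * nsq V t + 2 * nsq V' t"
      unfolding nsq_def by (subst It_add, (intro i sms)+) (simp only: It_cmult)
    also have "nsq V' t \<le> 0 * nsq (ds w) t + (27 * k) * nsq (ds K) t + 0 * nsq (ds (ds K)) t
        + (3 * (lam\<^sup>2 * om + 9/4 * k\<^sup>2)) * nsq K t"
      unfolding nsq_def[of V'] 
    proof (rule It_le4)
      show "continuous_on {0..2 * pi} (\<lambda>x. V' t x \<bullet> V' t x)"
        using sm_cont[OF sm_inner[OF base_sm(4) base_sm(4)]] .
      fix x
      show "V' t x \<bullet> V' t x \<le> 0 * (norm (ds w t x))\<^sup>2 + 27 * k * (norm (ds K t x))\<^sup>2 +
         0 * (norm (ds (ds K) t x))\<^sup>2 + 3 * (lam\<^sup>2 * om + 9 / 4 * k\<^sup>2) * (norm (K t x))\<^sup>2"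
        using V'_pointwise[of t k om x] k(1) C(2)[OF t] by (simp add: om_def power2_norm_eq_inner add.commute)
    qed
    also have "0 * nsq (ds w) t + (27 * k) * nsq (ds K) t + 0 * nsq (ds (ds K)) t
        + (3 * (lam\<^sup>2 * om + 9/4 * k\<^sup>2)) * nsq K t
       \<le> 27 * (c * (1 + r)) * r\<^sup>2 + 3 * (lam\<^sup>2 * om + 9/4 * (2 * c\<^sup>2 * (1 + r\<^sup>2))) * M"
    proof -
      have "k\<^sup>2 \<le> (c * (1 + r))\<^sup>2" using k0 k(2) by (intro power_mono)
      also have "\<dots> = c\<^sup>2 * (1 + r)\<^sup>2" by (simp add: power_mult_distrib)
      also have "\<dots> \<le> c\<^sup>2 * (2 * (1 + r\<^sup>2))" using power2_sum2_le[of 1 r] by (intro mult_left_mono) auto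
      finally have k2: "k\<^sup>2 \<le> 2 * c\<^sup>2 * (1 + r\<^sup>2)" by (simp add: algebra_simps)
      have om0: "0 \<le> om" using C(1) nsq_nonneg[of "ds w" t] by (simp add: om_def)
      have "(3 * (lam\<^sup>2 * om + 9/4 * k\<^sup>2)) * nsq K t \<le> (3 * (lam\<^sup>2 * om + 9/4 * (2 * c\<^sup>2 * (1 + r\<^sup>2)))) * M"
        using k2 om0 c(1) by (intro mult_mono add_mono mult_left_mono M(2) t) (auto simp: nsq_nonneg)
      moreover have "27 * k * nsq (ds K) t \<le> 27 * (c * (1 + r)) * r\<^sup>2"
        unfolding r(2)[symmetric] using k(2) by (intro mult_right_mono mult_left_mono) auto
      ultimately show ?thesis by simp
    qed
    finally have "B \<le> 2 * nsq V t + 2 * (27 * (c * (1 + r)) * r\<^sup>2 + 3 * (lam\<^sup>2 * om + 9/4 * (2 * c\<^sup>2 * (1 + r\<^sup>2))) * M)"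
      by simp
    also have "\<dots> = 2 * nsq V t + 6 * (lam\<^sup>2 * om) * M
      + (2 * (27/2 * c\<^sup>2 * M) + 2 * (27/2 * c\<^sup>2 * M + 27 * c) * r^2 + 2 * (27 * c) * r^3)"
      by (simp add: algebra_simps power2_eq_square power3_eq_cube)
    also have "\<dots> \<le> 2 * nsq V t + 6 * (lam\<^sup>2 * om) * M + (1 / (2 * M) * r^4 + R)" using R[OF r(1)] by linarith
    also have "1 / (2 * M) * r^4 \<le> B / 2"
    proof -
      have "r\<^sup>2 \<le> sqrt (nsq K t * B)"
        unfolding r(2) B_def by (rule nsq_ds_interpolate) (rule base_sm(3))
      also have "\<dots> \<le> sqrt (M * B)" using M(2)[OF t] nsq_nonneg by (auto intro!: mult_right_mono simp: B_def)
      finally have "(r\<^sup>2)\<^sup>2 \<le> M * B"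
        using M(1) nsq_nonneg[of "ds (ds K)" t] by (intro sqrt_ge_absD) (auto simp: B_def)
      then show ?thesis using M(1) by (simp add: field_simps power2_eq_square power4_eq_xxxx)
    qed
    finally show ?thesis unfolding B_def om_def by simp
  qed
  show ?thesis
  proof (rule L1_le[OF _ le])
    have "L1 (\<lambda>t. 4 * nsq V t + (12 * lam\<^sup>2 * C * M) * (1 + nsq (ds w) t) + 2 * R)"
      using C(1) M(1) by (intro L1_add L1_cmult L1_const L1_V L1_dsw) auto
    then show "L1 (\<lambda>t. 4 * nsq V t + 12 * (lam\<^sup>2 * (C * (1 + nsq (ds w) t))) * M + 2 * R)"
      by (simp add: mult_ac)
  qed
qed

end

section \<open>The first parabolic estimate\<close>

context bounded_flow
begin

text \<open>Energy estimate for \<open>D u = - \<partial>\<^sub>s\<^sup>4 u + h\<close>, obtained by testing with the fourth derivative of \<open>u\<close>, so that \<open>h\<close> is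
  never differentiated.\<close>

lemma parabolic4:
  fixes u :: "real \<Rightarrow> real \<Rightarrow> 'b::euclidean_space"
  assumes u: "st J u" and a: "L1 a"
    and le: "\<And>t. t \<in> J \<Longrightarrow> nsq (\<lambda>t x. Dm u t x + ds (ds (ds (ds u))) t x) t + nsq (ds (ds (ds u))) t
      + It (\<lambda>t x. (g t x)\<^sup>2 * (norm (ds u t x))\<^sup>2) t + It (\<lambda>t x. \<bar>g t x\<bar> * (norm (ds (ds u) t x))\<^sup>2) t
      \<le> a t * (1 + nsq (ds (ds u)) t)"
  shows "bdd (nsq (ds (ds u)))" "L1 (nsq (ds (ds (ds (ds u)))))"
proof -
  define u1 where "u1 = ds u"
  define u2 where "u2 = ds u1"
  define u3 where "u3 = ds u2"
  define u4 where "u4 = ds u3"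
  define h where "h = (\<lambda>t x. Dm u t x + u4 t x)"
  define X where "X = Dm u1"
  have st: "st J u1" "st J u2" "st J u3" "st J u4" by (auto simp: u1_def u2_def u3_def u4_def intro!: st_ds u)
  note sm' = st[THEN st_imp_sm]
  have hs: "sm J h" unfolding h_def by (intro sm_add Dm_sm u sm')
  have Xs: "sm J X" unfolding X_def by (intro Dm_sm st)
  have Ds: "sm J (Dm u)" by (intro Dm_sm u)
  note S = sms sm' hs Xs Ds
  define d where "d = (\<lambda>t. It (\<lambda>t x. 2 * (u2 t x \<bullet> Dm u2 t x) - g t x * (u2 t x \<bullet> u2 t x)) t)"
  have le: "d t + nsq u4 t \<le> a t * (1 + nsq u2 t)" if t: "t \<in> J" for t
  proof -
    note i = sm_cont[of J, OF _, of _ "{0..2 * pi}" t]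
    have cg: "continuous_on {0..2 * pi} (g t)" and c1: "continuous_on {0..2 * pi} (u1 t)" and c2: "continuous_on {0..2 * pi} (u2 t)"
      by (rule i, rule base_sm sm')+
    \<comment> \<open>Two commutations with \<open>Dm\<close> and two integrations by parts turn
      \<open>2 <u2, D u2>\<close> into \<open>2 <u4, D u>\<close>; each commutation leaves a term
      with \<open>g\<close>.\<close>
    have "d t = It (\<lambda>t x. 2 * (u2 t x \<bullet> ds X t x) + g t x * (u2 t x \<bullet> u2 t x)) t"
      unfolding d_def It_def X_def using Dm_ds[OF st(1) t]
      by (simp add: u2_def[symmetric] inner_add_right algebra_simps)
    also have "\<dots> = 2 * It (\<lambda>t x. u2 t x \<bullet> ds X t x) t + It (\<lambda>t x. g t x * (u2 t x \<bullet> u2 t x)) t"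
      by (subst It_add, (intro i S)+) (simp only: It_cmult)
    also have "It (\<lambda>t x. u2 t x \<bullet> ds X t x) t = - It (\<lambda>t x. u3 t x \<bullet> X t x) t"
      using IBP[OF sm'(2) Xs, of t] by (simp add: u3_def)
    also have "It (\<lambda>t x. u3 t x \<bullet> X t x) t = It (\<lambda>t x. u3 t x \<bullet> ds (Dm u) t x + g t x * (u3 t x \<bullet> u1 t x)) t"
      unfolding It_def X_def using Dm_ds[OF u t] by (simp add: u1_def[symmetric] inner_add_right)
    also have "\<dots> = It (\<lambda>t x. u3 t x \<bullet> ds (Dm u) t x) t + It (\<lambda>t x. g t x * (u3 t x \<bullet> u1 t x)) t"
      by (subst It_add, (intro i S)+) simp
    also have "It (\<lambda>t x. u3 t x \<bullet> ds (Dm u) t x) t = - It (\<lambda>t x. u4 t x \<bullet> Dm u t x) t"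
      using IBP[OF sm'(3) Ds, of t] by (simp add: u4_def)
    finally have d: "d t = It (\<lambda>t x. 2 * (u4 t x \<bullet> Dm u t x)) t + It (\<lambda>t x. (- 2) * (g t x * (u3 t x \<bullet> u1 t x))) t
        + It (\<lambda>t x. g t x * (u2 t x \<bullet> u2 t x)) t" by (simp only: It_cmult) simp
    have "It (\<lambda>t x. 2 * (u4 t x \<bullet> Dm u t x)) t \<le> It (\<lambda>t x. h t x \<bullet> h t x - u4 t x \<bullet> u4 t x) t"
    proof (rule It_mono[where u = "\<lambda>t x. 2 * (u4 t x \<bullet> Dm u t x)" and v = "\<lambda>t x. h t x \<bullet> h t x - u4 t x \<bullet> u4 t x"])
      fix x
      \<comment> \<open>Completing the square with \<open>D u = h - u4\<close>: the good term
        \<open>- |u4|^2\<close> is obtained at the price of \<open>|h|^2\<close>.\<close>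
      have "h t x \<bullet> h t x - u4 t x \<bullet> u4 t x - 2 * (u4 t x \<bullet> Dm u t x) = Dm u t x \<bullet> Dm u t x"
        by (simp add: h_def inner_add_left inner_add_right inner_commute)
      then show "2 * (u4 t x \<bullet> Dm u t x) \<le> h t x \<bullet> h t x - u4 t x \<bullet> u4 t x"
        using inner_ge_zero[of "Dm u t x"] by linarith
    qed (intro i S)+
    also have "\<dots> = nsq h t - nsq u4 t" unfolding nsq_def by (subst It_diff, (intro i S)+) simp
    finally have 1: "It (\<lambda>t x. 2 * (u4 t x \<bullet> Dm u t x)) t \<le> nsq h t - nsq u4 t" .
    have "It (\<lambda>t x. (- 2) * (g t x * (u3 t x \<bullet> u1 t x))) t \<le> It (\<lambda>t x. u3 t x \<bullet> u3 t x + (g t x)\<^sup>2 * (norm (u1 t x))\<^sup>2) t"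
    proof (rule It_mono[where u = "\<lambda>t x. (- 2) * (g t x * (u3 t x \<bullet> u1 t x))" and v = "\<lambda>t x. u3 t x \<bullet> u3 t x + (g t x)\<^sup>2 * (norm (u1 t x))\<^sup>2"])
      fix x
      have "0 \<le> (u3 t x + g t x *\<^sub>R u1 t x) \<bullet> (u3 t x + g t x *\<^sub>R u1 t x)" by simp
      also have "\<dots> = u3 t x \<bullet> u3 t x + 2 * (g t x * (u3 t x \<bullet> u1 t x)) + (g t x)\<^sup>2 * (norm (u1 t x))\<^sup>2"
        by (simp add: inner_add_left inner_add_right inner_commute power2_norm_eq_inner power2_eq_square[of "g t x"])
      finally show "(- 2) * (g t x * (u3 t x \<bullet> u1 t x)) \<le> u3 t x \<bullet> u3 t x + (g t x)\<^sup>2 * (norm (u1 t x))\<^sup>2" by simp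
    next
      show "continuous_on {0..2 * pi} (\<lambda>x. - 2 * (g t x * (u3 t x \<bullet> u1 t x)))" by (intro i S)
      show "continuous_on {0..2 * pi} (\<lambda>x. u3 t x \<bullet> u3 t x + (g t x)\<^sup>2 * (norm (u1 t x))\<^sup>2)"
        unfolding power2_norm_eq_inner power2_eq_square[of "g t _"] by (intro i S)
    qed
    also have "\<dots> = nsq u3 t + It (\<lambda>t x. (g t x)\<^sup>2 * (norm (u1 t x))\<^sup>2) t"
      unfolding nsq_def power2_norm_eq_inner unfolding power2_eq_square by (subst It_add, (intro i S)+) simp
    finally have 2: "It (\<lambda>t x. (- 2) * (g t x * (u3 t x \<bullet> u1 t x))) t \<le> \<dots>" .
    have 3: "It (\<lambda>t x. g t x * (u2 t x \<bullet> u2 t x)) t \<le> It (\<lambda>t x. \<bar>g t x\<bar> * (norm (u2 t x))\<^sup>2) t"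
    proof (rule It_mono[where u = "\<lambda>t x. g t x * (u2 t x \<bullet> u2 t x)" and v = "\<lambda>t x. \<bar>g t x\<bar> * (norm (u2 t x))\<^sup>2"])
      show "g t x * (u2 t x \<bullet> u2 t x) \<le> \<bar>g t x\<bar> * (norm (u2 t x))\<^sup>2" for x
        unfolding power2_norm_eq_inner by (intro mult_right_mono) auto
    qed (intro continuous_intros cg c2)+
    show ?thesis
      using d 1 2 3 le[OF t] unfolding u1_def[symmetric] u2_def[symmetric] u3_def[symmetric] u4_def[symmetric] h_def[symmetric]
      by linarith
  qed
  have D: "\<And>t. t \<in> J \<Longrightarrow> (nsq u2 has_real_derivative d t) (at t within J)"
    unfolding d_def by (rule nsq_deriv[OF st(2)])
  have "bdd (nsq u2)" "L1 (nsq u4)"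
    using gronwall[of "nsq u2" d "nsq u4" a, OF D nsq_nonneg nsq_nonneg a le] by simp_all
  then show "bdd (nsq (ds (ds u)))" "L1 (nsq (ds (ds (ds (ds u)))))"
    by (simp_all add: u1_def u2_def u3_def u4_def)
qed

text \<open>The fourth-order equation of the tangent: \<open>K_sss\<close> is the fourth derivative
  of \<open>T\<close>, and the right-hand side is the inhomogeneity in the sense of
  \<open>parabolic4\<close>.\<close>

lemma Dm_T_h: "t \<in> J \<Longrightarrow> Dm T t x + ds (ds (ds K)) t x = ds V' t x + g t x *\<^sub>R T t x"
  unfolding Dm_T V_def[abs_def] by (simp add: ds_rules sms)

text \<open>This is \<open>parabolic4\<close> for \<open>u = T\<close>, whose second derivative is
  \<open>K_s\<close>. The inhomogeneity is superlinear, so each monomial has to be distributed to a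
  time-integrable factor \<open>bt = 1 + nsq (ds w) + nsq (ds (ds K))\<close> and a single Gronwall
  factor \<open>E = 1 + nsq (ds K)\<close>.\<close>

lemma dsK_estimate: "bdd (nsq (ds K))" "L1 (nsq (ds (ds (ds K))))"
proof -
  obtain M where M: "M \<ge> 1" "\<And>t. t \<in> J \<Longrightarrow> nsq K t \<le> M" using basic_bounds by metis
  obtain C where C: "C \<ge> 1" "\<And>t x. t \<in> J \<Longrightarrow> (w t x)\<^sup>2 \<le> C * (1 + nsq (ds w) t)" using w_sq_bound by metis
  obtain c where c: "c \<ge> 1" "\<And>t. t \<in> J \<Longrightarrow> \<exists>k. (\<forall>x. (norm (K t x))\<^sup>2 \<le> k) \<and> k \<le> c * (1 + sqrt (nsq (ds K) t))"
    using K_sup by metis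
  obtain N where N: "N \<ge> 1" "\<And>t x. t \<in> J \<Longrightarrow> (norm (ds K t x))\<^sup>2 \<le> N * (nsq (ds K) t + nsq (ds (ds K)) t)"
    using sup_bound_sq[where 'b = 'a] sm_ds[OF base_sm(3)] by metis
  \<comment> \<open>\<open>L\<close> majorizes the coefficients that arise when the powers of
    \<open>k\<close> and the quantities \<open>e\<close>, \<open>P\<close>, \<open>om\<close> are
    bounded by \<open>E\<close>, \<open>bt\<close> or their product; \<open>Z\<close> also covers
    products of two of these coefficients and a factor \<open>M\<close> from
    \<open>nsq K\<close>.\<close>
  define L where "L = 1 + 2 * c\<^sup>2 + 4 * c^4 * (1 + M) + 2 * c\<^sup>2 * (1 + M) + N * (1 + M) + C"
  define Z where "Z = L\<^sup>2 * M"
  define b where "b = (\<lambda>t. 1 + nsq (ds w) t + nsq (ds (ds K)) t)"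
  \<comment> \<open>3000 and 60 round up the total coefficients in the last linear estimate of the
    proof.\<close>
  define a where "a = (\<lambda>t. ((3000 + 60 * lam\<^sup>2) * Z) * b t)"
  have c2: "1 \<le> c\<^sup>2" "1 \<le> c^4" using c(1) by simp_all
  have L: "1 \<le> L" "1 + 2 * c\<^sup>2 \<le> L" "4 * c^4 * (1 + M) \<le> L" "2 * c\<^sup>2 * (1 + M) + 4 * c^4 * (1 + M) \<le> L"
      "N * (1 + M) \<le> L" "C \<le> L" "1 + M \<le> L"
  proof -
    have p: "0 \<le> 2 * c\<^sup>2" "0 \<le> 4 * c^4 * (1 + M)" "0 \<le> 2 * c\<^sup>2 * (1 + M)" "0 \<le> N * (1 + M)" "0 \<le> C"
      using c2 M(1) N(1) C(1) by auto
    have "1 * (1 + M) \<le> N * (1 + M)" using M(1) N(1) by (intro mult_right_mono) auto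
    moreover show "N * (1 + M) \<le> L" using p unfolding L_def by linarith
    ultimately have "1 * (1 + M) \<le> L" by (rule order_trans)
    then show "1 + M \<le> L" by simp
    show "1 \<le> L" "1 + 2 * c\<^sup>2 \<le> L" "4 * c^4 * (1 + M) \<le> L" "2 * c\<^sup>2 * (1 + M) + 4 * c^4 * (1 + M) \<le> L"
      "C \<le> L" using p unfolding L_def by linarith+
  qed
  have Z: "L \<le> Z" "L * L \<le> Z" "L * M \<le> Z" "L * L * M \<le> Z" "1 \<le> Z"
  proof -
    have 1: "1 \<le> L * M" "1 \<le> L * L" "1 \<le> L * L * M" using L(1) M(1) by (intro mult_ge1_I; simp)+
    have "L * 1 \<le> L * (L * M)" "L * L * 1 \<le> L * L * M" "L * M * 1 \<le> L * M * L"
      using 1 L(1) M(1) by (intro mult_left_mono; simp)+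
    then show "L \<le> Z" "L * L \<le> Z" "L * M \<le> Z" "L * L * M \<le> Z" "1 \<le> Z"
      using 1 by (simp_all add: Z_def power2_eq_square mult_ac)
  qed
  have b1: "1 \<le> b t" for t unfolding b_def using nsq_nonneg[of "ds w" t] nsq_nonneg[of "ds (ds K)" t] by simp
  have "L1 a" unfolding a_def b_def using Z(5)
    by (intro L1_cmult L1_add L1_const L1_dsw L1_ddK) auto
  moreover have "nsq (\<lambda>t x. Dm T t x + ds (ds (ds (ds T))) t x) t + nsq (ds (ds (ds T))) t
      + It (\<lambda>t x. (g t x)\<^sup>2 * (norm (ds T t x))\<^sup>2) t + It (\<lambda>t x. \<bar>g t x\<bar> * (norm (ds (ds T) t x))\<^sup>2) t
      \<le> a t * (1 + nsq (ds (ds T)) t)" if t: "t \<in> J" for t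
  proof -
    note i = sm_cont[of J, OF _, of _ "{0..2 * pi}" t]
    define e where "e = nsq (ds K) t"
    define B where "B = nsq (ds (ds K)) t"
    define D where "D = nsq (ds w) t"
    define A where "A = nsq K t"
    define om where "om = C * (1 + D)"
    define P where "P = N * (e + B)"
    define l where "l = lam\<^sup>2"
    have nn: "0 \<le> e" "0 \<le> B" "0 \<le> D" "0 \<le> A" "A \<le> M" "0 \<le> l"
      unfolding e_def B_def D_def A_def l_def using M(2)[OF t] by (auto simp: nsq_nonneg)
    obtain k where k: "\<And>x. (norm (K t x))\<^sup>2 \<le> k" "k \<le> c * (1 + sqrt e)" using c(2)[OF t] unfolding e_def by blast
    have k0: "0 \<le> k" using k(1)[of 0] by (meson order_trans zero_le_power2)
    have om: "\<And>x. (w t x)\<^sup>2 \<le> om" "0 \<le> om" using C(2)[OF t] C(1) nn by (auto simp: om_def D_def)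
    have P: "\<And>x. (norm (ds K t x))\<^sup>2 \<le> P" "0 \<le> P" using N(2)[OF t] N(1) nn by (auto simp: P_def e_def B_def)
    define bt where "bt = b t"
    have bt: "bt = 1 + D + B" "1 \<le> bt" using b1[of t] by (auto simp: bt_def b_def D_def B_def)
    define E where "E = 1 + e"
    have E1: "1 \<le> E" using nn by (simp add: E_def)
    have eB: "e \<le> M + B"
    proof -
      have "e \<le> sqrt (A * B)" unfolding e_def A_def B_def by (rule nsq_ds_interpolate[OF base_sm(3)])
      also have "\<dots> \<le> (A + B) / 2" by (rule arith_geo_mean_sqrt) (use nn in auto)
      finally show ?thesis using nn by simp
    qed
    \<comment> \<open>Interpolation bounds \<open>E\<close> by a multiple of \<open>bt\<close>: of
      two factors \<open>E\<close> one can be traded for a time-integrable one.\<close>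
    have EB: "E \<le> (1 + M) * bt"
    proof -
      have "1 + M + B \<le> (1 + M) * bt" unfolding bt(1) using M(1) nn by (simp add: algebra_simps)
      then show ?thesis using eB by (simp add: E_def)
    qed
    have k2: "k\<^sup>2 \<le> 2 * c\<^sup>2 * E"
    proof -
      have "k\<^sup>2 \<le> (c * (1 + sqrt e))\<^sup>2" using k0 k(2) by (intro power_mono)
      also have "\<dots> = c\<^sup>2 * (1 + sqrt e)\<^sup>2" by (simp add: power_mult_distrib)
      also have "\<dots> \<le> c\<^sup>2 * (2 * (1 + e))" using power2_sum2_le[of 1 "sqrt e"] nn by (intro mult_left_mono) auto
      finally show ?thesis by (simp add: E_def algebra_simps)
    qed
    have kE: "k \<le> L * E"
    proof -
      have "k \<le> 1 + k\<^sup>2" using zero_le_power2[of "k - 1"] k0 by (simp add: power2_eq_square algebra_simps)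
      also have "\<dots> \<le> 1 * E + 2 * c\<^sup>2 * E" using k2 E1 by simp
      also have "\<dots> = (1 + 2 * c\<^sup>2) * E" by (simp add: algebra_simps)
      also have "\<dots> \<le> L * E" using L(2) E1 by (intro mult_right_mono) auto
      finally show ?thesis .
    qed
    have k2E: "k\<^sup>2 \<le> L * E"
      using k2 mult_right_mono[OF L(2), of E] E1 by (simp add: algebra_simps)
    have k4: "k^4 \<le> 4 * c^4 * (1 + M) * (bt * E)"
    proof -
      have "k^4 = (k\<^sup>2)\<^sup>2" by (simp flip: power_mult)
      also have "\<dots> \<le> (2 * c\<^sup>2 * E)\<^sup>2" using k2 by (intro power_mono) auto
      also have "\<dots> = 4 * c^4 * (E * E)" by (simp add: power2_eq_square power4_eq_xxxx)
      also have "\<dots> \<le> 4 * c^4 * ((1 + M) * bt * E)" using EB E1 by (intro mult_left_mono mult_right_mono) auto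
      finally show ?thesis by (simp add: mult_ac)
    qed
    have k2b: "k\<^sup>2 \<le> 2 * c\<^sup>2 * (1 + M) * (bt * E)"
    proof -
      have "E * 1 \<le> E * ((1 + M) * bt)" using E1 bt M(1) mult_mono[of 1 "1 + M" 1 bt] by (intro mult_left_mono) auto
      then have "2 * c\<^sup>2 * E \<le> 2 * c\<^sup>2 * (E * ((1 + M) * bt))" by (intro mult_left_mono) auto
      then show ?thesis using k2 by (simp add: mult_ac)
    qed
    \<comment> \<open>The target of all estimates below: one factor of each kind.\<close>
    define Q where "Q = bt * E"
    have Q0: "1 \<le> Q" using mult_mono[OF bt(2) E1] bt(2) by (simp add: Q_def)
    have k4Q: "k^4 \<le> L * Q"
      using k4 mult_right_mono[OF L(3), of Q] Q0 by (simp add: Q_def)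
    have k3Q: "k^3 \<le> L * Q"
    proof -
      have "0 \<le> (k * (k - 1))\<^sup>2" by simp
      then have "2 * k^3 \<le> k\<^sup>2 + k^4"
        by (simp add: power2_eq_square power3_eq_cube power4_eq_xxxx algebra_simps)
      then have "k^3 \<le> k\<^sup>2 + k^4" using k0 zero_le_power[OF k0, of 3] by linarith
      also have "\<dots> \<le> (2 * c\<^sup>2 * (1 + M) + 4 * c^4 * (1 + M)) * Q" using k4 k2b by (simp add: Q_def distrib_right)
      also have "\<dots> \<le> L * Q" using L(4) Q0 by (intro mult_right_mono) auto
      finally show ?thesis .
    qed
    have eb: "e \<le> L * bt"
    proof -
      have "e \<le> (1 + M) * bt" using EB by (simp add: E_def)
      also have "\<dots> \<le> L * bt" using L(7) bt(2) by (intro mult_right_mono) auto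
      finally show ?thesis .
    qed
    have Pb: "P \<le> L * bt"
    proof -
      have "e + B \<le> M + 2 * B" using eB by simp
      also have "\<dots> \<le> (1 + M) * bt"
      proof -
        have "B * 1 \<le> B * M" using M(1) nn by (intro mult_left_mono) auto
        moreover have "0 \<le> D * M" using M(1) nn by simp
        moreover have "(1 + M) * bt = 1 + M + D + B + B * M + D * M" by (simp add: bt(1) algebra_simps)
        ultimately show ?thesis using nn by linarith
      qed
      finally have "P \<le> N * ((1 + M) * bt)" unfolding P_def using N(1) by (intro mult_left_mono) auto
      also have "\<dots> \<le> L * bt" using mult_right_mono[OF L(5), of bt] bt(2) by (simp add: mult_ac)
      finally show ?thesis .
    qed
    have ob: "om \<le> L * bt"
    proof -
      have "om \<le> C * bt" unfolding om_def bt(1) using C(1) nn by (intro mult_left_mono) auto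
      also have "\<dots> \<le> L * bt" using L(6) bt(2) by (intro mult_right_mono) auto
      finally show ?thesis .
    qed
    have DB: "D \<le> bt" "B \<le> bt" "e \<le> E" using nn by (auto simp: bt(1) E_def)
    have L0: "0 \<le> L" "0 \<le> M" "0 \<le> bt" "0 \<le> E" "0 \<le> Q" using L(1) M(1) bt(2) E1 Q0 by auto
    have ZQ: "L * Q \<le> Z * Q" "L * L * Q \<le> Z * Q" "L * M * Q \<le> Z * Q" "L * L * M * Q \<le> Z * Q"
      using Z L0(5) by (auto intro!: mult_right_mono)
    have f1: "k * D \<le> Z * Q"
      using mult_mono[OF kE DB(1)] L0 nn ZQ(1) by (simp add: Q_def mult_ac)
    have f2: "om * e \<le> Z * Q"
      using mult_mono[OF ob DB(3)] L0 nn ZQ(1) by (simp add: Q_def mult_ac)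
    have f3: "k\<^sup>2 * e \<le> Z * Q"
      using mult_mono[OF k2E eb] L0 nn ZQ(2) by (simp add: Q_def mult_ac)
    have f4: "P * e \<le> Z * Q"
      using mult_mono[OF Pb DB(3)] L0 nn ZQ(1) by (simp add: Q_def mult_ac)
    have f5: "k * B \<le> Z * Q"
      using mult_mono[OF kE DB(2)] L0 nn ZQ(1) by (simp add: Q_def mult_ac)
    have f6: "k^3 * A \<le> Z * Q"
      using mult_mono[OF k3Q nn(5)] L0 nn ZQ(3) by (simp add: mult_ac)
    have ok: "om * k \<le> L * L * Q"
      using mult_mono[OF ob kE] L0 k0 by (simp add: Q_def mult_ac)
    have ok2: "om * k\<^sup>2 \<le> L * L * Q"
      using mult_mono[OF ob k2E] L0 k0 by (simp add: Q_def mult_ac)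
    have f7: "om * k * A \<le> Z * Q"
      using mult_mono[OF ok nn(5)] L0 nn ZQ(4) by (simp add: mult_ac)
    have f8: "k\<^sup>2 * B \<le> Z * Q"
      using mult_mono[OF k2E DB(2)] L0 nn ZQ(1) by (simp add: Q_def mult_ac)
    have f9: "k^4 * A \<le> Z * Q"
      using mult_mono[OF k4Q nn(5)] L0 nn ZQ(3) by (simp add: mult_ac)
    have f10: "om * k\<^sup>2 * A \<le> Z * Q"
      using mult_mono[OF ok2 nn(5)] L0 nn ZQ(4) by (simp add: mult_ac)
    have f11: "B \<le> Z * Q"
    proof -
      have "B * 1 \<le> bt * E" using DB(2) E1 nn L0 by (intro mult_mono) auto
      also have "\<dots> \<le> Z * Q" using mult_right_mono[OF Z(5) L0(5)] by (simp add: Q_def)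
      finally show ?thesis by simp
    qed
    define G where "G = It (\<lambda>t x. (g t x)\<^sup>2) t"
    have cg: "continuous_on {0..2 * pi} (g t)" and cK: "continuous_on {0..2 * pi} (K t)"
      and cdK: "continuous_on {0..2 * pi} (ds K t)" by (rule i, rule sms sm_ds, (rule sms)?)+
    have G: "G \<le> 3 * (k * B) + 27/4 * (k^3 * A) + 3 * (l * (om * k * A))"
    proof -
      have "G \<le> 0 * nsq (ds w) t + 0 * nsq (ds K) t + (3 * k) * nsq (ds (ds K)) t + (3 * (9/4 * k^3 + lam\<^sup>2 * om * k)) * nsq K t"
        unfolding G_def
      proof (rule It_le4)
        show "continuous_on {0..2 * pi} (\<lambda>x. (g t x)\<^sup>2)" by (intro continuous_intros cg)
        show "(g t x)\<^sup>2 \<le> 0 * (norm (ds w t x))\<^sup>2 + 0 * (norm (ds K t x))\<^sup>2 + 3 * k * (norm (ds (ds K) t x))\<^sup>2 +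
           3 * (9 / 4 * k^3 + lam\<^sup>2 * om * k) * (norm (K t x))\<^sup>2" for x
          using g_pointwise[OF k(1) om(1), of x] by simp
      qed
      then show ?thesis by (simp add: A_def B_def l_def algebra_simps)
    qed
    have DV: "nsq (ds V') t \<le> 9 * (l * (k * D)) + 9 * (l * (om * e)) + 1000 * (k\<^sup>2 * e) + 100 * (P * e) + 100 * (k * B)"
    proof -
      have "nsq (ds V') t \<le> (9 * lam\<^sup>2 * k) * nsq (ds w) t + (9 * lam\<^sup>2 * om + 1000 * k\<^sup>2 + 100 * P) * nsq (ds K) t
          + (100 * k) * nsq (ds (ds K)) t + 0 * nsq K t"
        unfolding nsq_def[of "ds V'"]
      proof (rule It_le4)
        show "continuous_on {0..2 * pi} (\<lambda>x. ds V' t x \<bullet> ds V' t x)" by (rule i) (intro sms)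
        show "ds V' t x \<bullet> ds V' t x \<le> 9 * lam\<^sup>2 * k * (norm (ds w t x))\<^sup>2 +
         (9 * lam\<^sup>2 * om + 1000 * k\<^sup>2 + 100 * P) * (norm (ds K t x))\<^sup>2 +
         100 * k * (norm (ds (ds K) t x))\<^sup>2 + 0 * (norm (K t x))\<^sup>2" for x
          using dsV'_pointwise[OF k(1) om(1) P(1), of x] by (simp add: power2_norm_eq_inner)
      qed
      then show ?thesis by (simp add: e_def B_def D_def l_def algebra_simps)
    qed
    have 1: "nsq (\<lambda>t x. Dm T t x + ds (ds (ds (ds T))) t x) t \<le> 2 * nsq (ds V') t + 2 * G"
    proof -
      have "nsq (\<lambda>t x. Dm T t x + ds (ds (ds (ds T))) t x) t = It (\<lambda>t x. (norm (ds V' t x + g t x *\<^sub>R T t x))\<^sup>2) t"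
        unfolding nsq_def It_def using Dm_T_h[OF t] by (simp add: K_def[symmetric] power2_norm_eq_inner)
      also have "\<dots> \<le> It (\<lambda>t x. 2 * (ds V' t x \<bullet> ds V' t x) + 2 * (g t x)\<^sup>2) t"
      proof (rule It_mono[where u = "\<lambda>t x. (norm (ds V' t x + g t x *\<^sub>R T t x))\<^sup>2" and v = "\<lambda>t x. 2 * (ds V' t x \<bullet> ds V' t x) + 2 * (g t x)\<^sup>2"])
        fix x
        have "norm (ds V' t x + g t x *\<^sub>R T t x) \<le> norm (ds V' t x) + \<bar>g t x\<bar>"
          using norm_triangle_ineq[of "ds V' t x" "g t x *\<^sub>R T t x"] by simp
        then have "(norm (ds V' t x + g t x *\<^sub>R T t x))\<^sup>2 \<le> (norm (ds V' t x) + \<bar>g t x\<bar>)\<^sup>2" by (intro power_mono) auto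
        also have "\<dots> \<le> 2 * ((norm (ds V' t x))\<^sup>2 + \<bar>g t x\<bar>\<^sup>2)" by (rule power2_sum2_le)
        finally show "(norm (ds V' t x + g t x *\<^sub>R T t x))\<^sup>2 \<le> 2 * (ds V' t x \<bullet> ds V' t x) + 2 * (g t x)\<^sup>2"
          by (simp add: power2_norm_eq_inner)
      next
        show "continuous_on {0..2 * pi} (\<lambda>x. (norm (ds V' t x + g t x *\<^sub>R T t x))\<^sup>2)"
          unfolding power2_norm_eq_inner by (rule i) (intro sms)
        show "continuous_on {0..2 * pi} (\<lambda>x. 2 * (ds V' t x \<bullet> ds V' t x) + 2 * (g t x)\<^sup>2)"
          unfolding power2_eq_square by (rule i) (intro sms)
      qed
      also have "\<dots> = 2 * nsq (ds V') t + 2 * G"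
        unfolding nsq_def G_def power2_eq_square by (subst It_add, (intro i sms)+) (simp only: It_cmult)
      finally show ?thesis .
    qed
    have 2: "It (\<lambda>t x. (g t x)\<^sup>2 * (norm (ds T t x))\<^sup>2) t \<le> k * G"
    proof -
      have "It (\<lambda>t x. (g t x)\<^sup>2 * (norm (ds T t x))\<^sup>2) t \<le> It (\<lambda>t x. k * (g t x)\<^sup>2) t"
      proof (rule It_mono[where u = "\<lambda>t x. (g t x)\<^sup>2 * (norm (ds T t x))\<^sup>2" and v = "\<lambda>t x. k * (g t x)\<^sup>2"])
        show "(g t x)\<^sup>2 * (norm (ds T t x))\<^sup>2 \<le> k * (g t x)\<^sup>2" for x
          using mult_left_mono[OF k(1)[of x], of "(g t x)\<^sup>2"] by (simp add: K_def mult.commute)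
      qed ((unfold K_def[symmetric])?, intro continuous_intros cg cK)+
      then show ?thesis by (simp add: G_def It_cmult)
    qed
    have 3: "It (\<lambda>t x. \<bar>g t x\<bar> * (norm (ds (ds T) t x))\<^sup>2) t \<le> G / 2 + P * e / 2"
    proof -
      have "It (\<lambda>t x. \<bar>g t x\<bar> * (norm (ds (ds T) t x))\<^sup>2) t \<le> It (\<lambda>t x. (1/2) * (g t x)\<^sup>2 + (P/2) * (ds K t x \<bullet> ds K t x)) t"
      proof (rule It_mono[where u = "\<lambda>t x. \<bar>g t x\<bar> * (norm (ds (ds T) t x))\<^sup>2" and v = "\<lambda>t x. (1/2) * (g t x)\<^sup>2 + (P/2) * (ds K t x \<bullet> ds K t x)"])
        fix x
        let ?p = "(norm (ds K t x))\<^sup>2"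
        have "2 * (\<bar>g t x\<bar> * ?p) \<le> \<bar>g t x\<bar>\<^sup>2 + ?p\<^sup>2"
          using zero_le_power2[of "\<bar>g t x\<bar> - ?p"] by (simp add: power2_eq_square algebra_simps)
        also have "?p\<^sup>2 \<le> P * ?p" unfolding power2_eq_square[of ?p] using P(1)[of x] by (intro mult_right_mono) auto
        finally have "2 * (\<bar>g t x\<bar> * ?p) \<le> (g t x)\<^sup>2 + P * ?p" by simp
        then show "\<bar>g t x\<bar> * (norm (ds (ds T) t x))\<^sup>2 \<le> (1/2) * (g t x)\<^sup>2 + (P/2) * (ds K t x \<bullet> ds K t x)"
          by (simp add: K_def[symmetric] power2_norm_eq_inner)
      qed ((unfold K_def[symmetric])?, intro continuous_intros cg cdK)+
      also have "\<dots> = (1/2) * G + (P/2) * e"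
        unfolding e_def nsq_def G_def power2_eq_square by (subst It_add, (intro i sms)+) (simp only: It_cmult)
      finally show ?thesis by simp
    qed
    have kG: "k * G \<le> 3 * (k\<^sup>2 * B) + 27/4 * (k^4 * A) + 3 * (l * (om * k\<^sup>2 * A))"
      using mult_left_mono[OF G k0] by (simp add: algebra_simps power2_eq_square power3_eq_cube power4_eq_xxxx)
    have lf: "l * (k * D) \<le> l * (Z * Q)" "l * (om * e) \<le> l * (Z * Q)" "l * (om * k * A) \<le> l * (Z * Q)"
        "l * (om * k\<^sup>2 * A) \<le> l * (Z * Q)"
      using f1 f2 f7 f10 nn(6) by (intro mult_left_mono; simp)+
    have q: "0 \<le> l * (Z * Q)" "0 \<le> Z * Q" using nn(6) Z(5) L0(5) by auto
    have "nsq (\<lambda>t x. Dm T t x + ds (ds (ds (ds T))) t x) t + nsq (ds (ds (ds T))) t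
      + It (\<lambda>t x. (g t x)\<^sup>2 * (norm (ds T t x))\<^sup>2) t + It (\<lambda>t x. \<bar>g t x\<bar> * (norm (ds (ds T) t x))\<^sup>2) t
      \<le> 2 * nsq (ds V') t + 2 * G + B + k * G + (G / 2 + P * e / 2)"
      using 1 2 3 by (simp add: K_def[symmetric] B_def)
    also have "\<dots> \<le> 3000 * (Z * Q) + 60 * (l * (Z * Q))"
      using DV G kG f1 f2 f3 f4 f5 f6 f7 f8 f9 f10 f11 lf q by linarith
    also have "\<dots> = a t * (1 + nsq (ds (ds T)) t)"
      by (simp add: a_def Q_def bt_def E_def e_def l_def K_def[symmetric] algebra_simps)
    finally show ?thesis .
  qed
  ultimately have "bdd (nsq (ds (ds T)))" "L1 (nsq (ds (ds (ds (ds T)))))"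
    using parabolic4[OF T_st, of a] by blast+
  then show "bdd (nsq (ds K))" "L1 (nsq (ds (ds (ds K))))" by (simp_all add: K_def)
qed

end

section \<open>Product estimates\<close>

context moving
begin

lemma It_mono_sm: "sm J u \<Longrightarrow> sm J v \<Longrightarrow> (\<And>x. u t x \<le> v t x) \<Longrightarrow> It u t \<le> It v t"
  by (rule It_mono) (auto intro: sm_cont)

lemma It_add_sm: "sm J u \<Longrightarrow> sm J v \<Longrightarrow> It (\<lambda>t x. u t x + v t x) t = It u t + It v t"
  by (rule It_add) (auto intro: sm_cont)

lemma It_diff_sm: "sm J u \<Longrightarrow> sm J v \<Longrightarrow> It (\<lambda>t x. u t x - v t x) t = It u t - It v t"
  by (rule It_diff) (auto intro: sm_cont)

lemma nsq_cong: "(\<And>x. u t x = v t x) \<Longrightarrow> nsq u t = nsq v t"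
  by (simp add: nsq_def It_def)

lemma nsq_add_le: 
  assumes "sm J u" "sm J v" shows "nsq (\<lambda>t x. u t x + v t x) t \<le> 2 * nsq u t + 2 * nsq v t"
proof -
  have "nsq (\<lambda>t x. u t x + v t x) t \<le> It (\<lambda>t x. 2 * (u t x \<bullet> u t x) + 2 * (v t x \<bullet> v t x)) t"
    unfolding nsq_def
  proof (intro It_mono_sm sm_rules assms)
    fix x
    have "0 \<le> (u t x - v t x) \<bullet> (u t x - v t x)" by simp
    then show "(u t x + v t x) \<bullet> (u t x + v t x) \<le> 2 * (u t x \<bullet> u t x) + 2 * (v t x \<bullet> v t x)"
      by (simp add: inner_add_left inner_add_right inner_diff_left inner_diff_right inner_commute)
  qed
  also have "\<dots> = 2 * nsq u t + 2 * nsq v t"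
    unfolding nsq_def by (subst It_add_sm, (intro sm_rules assms)+) (simp only: It_cmult)
  finally show ?thesis .
qed

lemma nsq_scaleR: "nsq (\<lambda>t x. c *\<^sub>R u t x) t = c\<^sup>2 * nsq u t"
  using It_cmult[of "c\<^sup>2" "\<lambda>t x. u t x \<bullet> u t x" t] by (simp add: nsq_def power2_eq_square mult.assoc)

lemma ds_pow_add: "sm J u \<Longrightarrow> sm J v \<Longrightarrow> (ds ^^ j) (\<lambda>t x. u t x + v t x) = (\<lambda>t x. (ds ^^ j) u t x + (ds ^^ j) v t x)"
  by (induction j) (auto simp: ds_add sm_ds_pow)

lemma ds_pow_scaleR: "sm J u \<Longrightarrow> (ds ^^ j) (\<lambda>t x. c *\<^sub>R u t x) = (\<lambda>t x. c *\<^sub>R (ds ^^ j) u t x)"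
  by (induction j) (auto simp: ds_scaleR sm_ds_pow)

lemma ds_pow_cong: "(\<And>x. u t x = v t x) \<Longrightarrow> (ds ^^ j) u t x = (ds ^^ j) v t x"
  by (induction j arbitrary: x) (auto intro: ds_cong)

lemma ds_pow_Suc: "(ds ^^ Suc j) u = (ds ^^ j) (ds u)"
  by (simp add: funpow_swap1)

end

context bounded_flow
begin

text \<open>Mixed parabolic norms over arc length: L^infinity in time with values in H^(a-1) and L^2
  in time with values in H^(b-1). The parameters count derivatives, so that 0 imposes
  nothing.\<close>

definition S :: "nat \<Rightarrow> nat \<Rightarrow> (real \<Rightarrow> real \<Rightarrow> 'b::euclidean_space) \<Rightarrow> bool" where
  "S a b u \<longleftrightarrow> sm J u \<and> (\<forall>j<a. bdd (nsq ((ds ^^ j) u))) \<and> (\<forall>j<b. L1 (nsq ((ds ^^ j) u)))"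

lemma S_sm: "S a b u \<Longrightarrow> sm J u" by (simp add: S_def)
lemma S_bdd: "S a b u \<Longrightarrow> j < a \<Longrightarrow> bdd (nsq ((ds ^^ j) u))" by (simp add: S_def)
lemma S_L1: "S a b u \<Longrightarrow> j < b \<Longrightarrow> L1 (nsq ((ds ^^ j) u))" by (simp add: S_def)

lemma S_mono: "S a b u \<Longrightarrow> a' \<le> a \<Longrightarrow> b' \<le> b \<Longrightarrow> S a' b' u"
  by (simp add: S_def)

lemma S_ds: "S a b u \<Longrightarrow> S (a - 1) (b - 1) (ds u)"
  unfolding S_def by (auto intro!: sm_ds simp flip: ds_pow_Suc simp del: funpow.simps)

lemma S_ds_pow: "S a b u \<Longrightarrow> S (a - j) (b - j) ((ds ^^ j) u)"
proof (induction j)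
  case (Suc j)
  from S_ds[OF Suc.IH[OF Suc.prems]] show ?case by simp
qed simp

lemma S_SucI:
  assumes "sm J u" "bdd (nsq u)" "L1 (nsq u)" "S a b (ds u)" shows "S (Suc a) (Suc b) u"
  using assms unfolding S_def by (auto simp: less_Suc_eq_0_disj ds_pow_Suc simp del: funpow.simps(2))

lemma S_0_SucI:
  assumes "sm J u" "L1 (nsq u)" "S 0 b (ds u)" shows "S 0 (Suc b) u"
  using assms unfolding S_def by (auto simp: less_Suc_eq_0_disj ds_pow_Suc simp del: funpow.simps(2))

lemma S_cong:
  assumes u: "S a b u" and e: "\<And>t x. t \<in> J \<Longrightarrow> u t x = v t x" and v: "sm J v" shows "S a b v"
proof -
  have n: "nsq ((ds ^^ j) u) t = nsq ((ds ^^ j) v) t" if "t \<in> J" for j t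
    by (rule nsq_cong, rule ds_pow_cong) (rule e[OF that])
  show ?thesis unfolding S_def
  proof (intro conjI allI impI v)
    show "bdd (nsq ((ds ^^ j) v))" if "j < a" for j by (rule bdd_le[OF S_bdd[OF u that]]) (simp add: n)
    show "L1 (nsq ((ds ^^ j) v))" if "j < b" for j by (rule L1_le[OF S_L1[OF u that]]) (simp add: n)
  qed
qed

lemma S_add:
  assumes "S a b u" "S a b v" shows "S a b (\<lambda>t x. u t x + v t x)"
  unfolding S_def
proof (intro conjI allI impI)
  show "sm J (\<lambda>t x. u t x + v t x)" by (intro sm_add S_sm[OF assms(1)] S_sm[OF assms(2)])
  note s = sm_ds_pow[OF S_sm[OF assms(1)]] sm_ds_pow[OF S_sm[OF assms(2)]]
  show "bdd (nsq ((ds ^^ j) (\<lambda>t x. u t x + v t x)))" if "j < a" for j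
    unfolding ds_pow_add[OF S_sm[OF assms(1)] S_sm[OF assms(2)]]
    by (rule bdd_le[OF bdd_add[OF bdd_cmult[OF S_bdd[OF assms(1) that]] bdd_cmult[OF S_bdd[OF assms(2) that]]] nsq_add_le[OF s]]) auto
  show "L1 (nsq ((ds ^^ j) (\<lambda>t x. u t x + v t x)))" if "j < b" for j
    unfolding ds_pow_add[OF S_sm[OF assms(1)] S_sm[OF assms(2)]]
    by (rule L1_le[OF L1_add[OF L1_cmult[OF S_L1[OF assms(1) that]] L1_cmult[OF S_L1[OF assms(2) that]]] nsq_add_le[OF s]]) auto
qed

lemma S_scaleR:
  assumes "S a b u" shows "S a b (\<lambda>t x. c *\<^sub>R u t x)"
  unfolding S_def
proof (intro conjI allI impI)
  show "sm J (\<lambda>t x. c *\<^sub>R u t x)" by (intro sm_scaleR sm_const S_sm[OF assms])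
  show "bdd (nsq ((ds ^^ j) (\<lambda>t x. c *\<^sub>R u t x)))" if "j < a" for j
    unfolding ds_pow_scaleR[OF S_sm[OF assms]]
    by (rule bdd_le[OF bdd_cmult[OF S_bdd[OF assms that], of "c\<^sup>2"]]) (simp_all add: nsq_scaleR)
  show "L1 (nsq ((ds ^^ j) (\<lambda>t x. c *\<^sub>R u t x)))" if "j < b" for j
    unfolding ds_pow_scaleR[OF S_sm[OF assms]]
    by (rule L1_le[OF L1_cmult[OF S_L1[OF assms that], of "c\<^sup>2"]]) (simp_all add: nsq_scaleR)
qed

lemma S_diff:
  assumes "S a b u" "S a b v" shows "S a b (\<lambda>t x. u t x - v t x)"
  using S_add[OF assms(1) S_scaleR[OF assms(2), of "-1"]] by simp

text \<open>One derivative of the first factor pays for its supremum; the second factor stays in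
  L^2.\<close>

lemma nsq_product:
  fixes p :: "'b::euclidean_space \<Rightarrow> 'c::euclidean_space \<Rightarrow> 'd::euclidean_space"
  assumes p: "bounded_bilinear p" and u: "sm J u" and v: "sm J v"
  shows "\<exists>C\<ge>0. \<forall>t\<in>J. nsq (\<lambda>t x. p (u t x) (v t x)) t \<le> C * (nsq u t + nsq (ds u) t) * nsq v t"
proof -
  obtain k where k: "k \<ge> 0" "\<And>a b. norm (p a b) \<le> norm a * norm b * k"
    using bounded_bilinear.nonneg_bounded[OF p] by blast
  obtain N where N: "N \<ge> 1" "\<And>(u :: real \<Rightarrow> real \<Rightarrow> 'b) t x. sm J u \<Longrightarrow> t \<in> J \<Longrightarrow> (norm (u t x))\<^sup>2 \<le> N * (nsq u t + nsq (ds u) t)"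
    using sup_bound_sq[where 'b = 'b] by metis
  have "nsq (\<lambda>t x. p (u t x) (v t x)) t \<le> (k\<^sup>2 * N) * (nsq u t + nsq (ds u) t) * nsq v t"
    if t: "t \<in> J" for t
  proof -
    define q where "q = (k\<^sup>2 * N) * (nsq u t + nsq (ds u) t)"
    have "nsq (\<lambda>t x. p (u t x) (v t x)) t \<le> It (\<lambda>s x. q * (v s x \<bullet> v s x)) t"
      unfolding nsq_def
    proof (intro It_mono_sm sm_rules bounded_bilinear.sm[OF p] u v)
      fix x
      have "p (u t x) (v t x) \<bullet> p (u t x) (v t x) = (norm (p (u t x) (v t x)))\<^sup>2" by (simp add: power2_norm_eq_inner)
      also have "\<dots> \<le> (norm (u t x) * norm (v t x) * k)\<^sup>2" by (intro power_mono k) simp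
      also have "\<dots> = k\<^sup>2 * (norm (u t x))\<^sup>2 * (v t x \<bullet> v t x)"
        by (simp add: power_mult_distrib power2_norm_eq_inner mult_ac)
      also have "\<dots> \<le> k\<^sup>2 * (N * (nsq u t + nsq (ds u) t)) * (v t x \<bullet> v t x)"
        by (intro mult_right_mono mult_left_mono N u t) auto
      finally show "p (u t x) (v t x) \<bullet> p (u t x) (v t x) \<le> q * (v t x \<bullet> v t x)" by (simp add: q_def mult_ac)
    qed
    then show ?thesis by (simp add: It_cmult nsq_def q_def)
  qed
  moreover have "0 \<le> k\<^sup>2 * N" using N(1) by simp
  ultimately show ?thesis by blast
qed

text \<open>This and the next two lemmas are the ways of distributing integrability in time over the
  factors of \<open>nsq_product\<close>: at least one of them is always bounded in time.\<close>

lemma product_bdd_bdd: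
  fixes u :: "real \<Rightarrow> real \<Rightarrow> 'b::euclidean_space" and v :: "real \<Rightarrow> real \<Rightarrow> 'c::euclidean_space"
    and p :: "'b \<Rightarrow> 'c \<Rightarrow> 'd::euclidean_space"
  assumes p: "bounded_bilinear p" and u: "sm J u" and v: "sm J v"
    and b: "bdd (nsq u)" "bdd (nsq (ds u))" "bdd (nsq v)"
  shows "bdd (nsq (\<lambda>t x. p (u t x) (v t x)))"
proof -
  obtain C where C: "C \<ge> 0" "\<And>t. t \<in> J \<Longrightarrow> nsq (\<lambda>t x. p (u t x) (v t x)) t \<le> C * (nsq u t + nsq (ds u) t) * nsq v t"
    using nsq_product[OF p u v] by blast
  have "bdd (\<lambda>t. C * (nsq u t + nsq (ds u) t) * nsq v t)"
    by (intro bdd_mult bdd_cmult bdd_add b C(1) mult_nonneg_nonneg add_nonneg_nonneg nsq_nonneg)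
  then show ?thesis using C(2) by (rule bdd_le)
qed

lemma product_bdd_L1:
  fixes u :: "real \<Rightarrow> real \<Rightarrow> 'b::euclidean_space" and v :: "real \<Rightarrow> real \<Rightarrow> 'c::euclidean_space"
    and p :: "'b \<Rightarrow> 'c \<Rightarrow> 'd::euclidean_space"
  assumes p: "bounded_bilinear p" and u: "sm J u" and v: "sm J v"
    and b: "bdd (nsq u)" "bdd (nsq (ds u))" "L1 (nsq v)"
  shows "L1 (nsq (\<lambda>t x. p (u t x) (v t x)))"
proof -
  obtain C where C: "C \<ge> 0" "\<And>t. t \<in> J \<Longrightarrow> nsq (\<lambda>t x. p (u t x) (v t x)) t \<le> C * (nsq u t + nsq (ds u) t) * nsq v t"
    using nsq_product[OF p u v] by blast
  have "L1 (\<lambda>t. nsq v t * (C * (nsq u t + nsq (ds u) t)))"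
    by (intro L1_mult_bdd bdd_cmult bdd_add b C(1) nsq_nonneg)
  then show ?thesis by (rule L1_le) (use C(2) in \<open>simp add: mult.commute\<close>)
qed

lemma product_L1_bdd:
  fixes u :: "real \<Rightarrow> real \<Rightarrow> 'b::euclidean_space" and v :: "real \<Rightarrow> real \<Rightarrow> 'c::euclidean_space"
    and p :: "'b \<Rightarrow> 'c \<Rightarrow> 'd::euclidean_space"
  assumes p: "bounded_bilinear p" and u: "sm J u" and v: "sm J v"
    and b: "L1 (nsq u)" "L1 (nsq (ds u))" "bdd (nsq v)"
  shows "L1 (nsq (\<lambda>t x. p (u t x) (v t x)))"
proof -
  obtain C where C: "C \<ge> 0" "\<And>t. t \<in> J \<Longrightarrow> nsq (\<lambda>t x. p (u t x) (v t x)) t \<le> C * (nsq u t + nsq (ds u) t) * nsq v t"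
    using nsq_product[OF p u v] by blast
  have "L1 (\<lambda>t. (C * (nsq u t + nsq (ds u) t)) * nsq v t)"
    by (intro L1_mult_bdd L1_cmult L1_add b C(1) nsq_nonneg mult_nonneg_nonneg add_nonneg_nonneg)
  then show ?thesis using C(2) by (rule L1_le)
qed

lemma S_0_1: "S 0 1 u \<longleftrightarrow> sm J u \<and> L1 (nsq u)"
  by (auto simp: S_def)

text \<open>The natural spaces for the fourth-order equation of \<open>T\<close> and for the second-order equation of \<open>w\<close>.\<close>

abbreviation U where "U k \<equiv> S (k - 1) (Suc k)"
abbreviation W where "W k \<equiv> S k (Suc k)"

lemma S_product_SucI:
  fixes u :: "real \<Rightarrow> real \<Rightarrow> 'b::euclidean_space" and v :: "real \<Rightarrow> real \<Rightarrow> 'c::euclidean_space"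
    and p :: "'b \<Rightarrow> 'c \<Rightarrow> 'd::euclidean_space"
  assumes p: "bounded_bilinear p" and u: "sm J u" and v: "sm J v"
    and "bdd (nsq (\<lambda>t x. p (u t x) (v t x)))" "L1 (nsq (\<lambda>t x. p (u t x) (v t x)))"
    and "S a b (\<lambda>t x. p (ds u t x) (v t x))" "S a b (\<lambda>t x. p (u t x) (ds v t x))"
  shows "S (Suc a) (Suc b) (\<lambda>t x. p (u t x) (v t x))"
  using S_add[OF assms(6,7)] assms(4,5) 
  by (intro S_SucI bounded_bilinear.sm[OF p] u v) (simp_all add: ds_bilinear[OF p u v])

lemma S_0_product_SucI:
  fixes u :: "real \<Rightarrow> real \<Rightarrow> 'b::euclidean_space" and v :: "real \<Rightarrow> real \<Rightarrow> 'c::euclidean_space"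
    and p :: "'b \<Rightarrow> 'c \<Rightarrow> 'd::euclidean_space"
  assumes p: "bounded_bilinear p" and u: "sm J u" and v: "sm J v"
    and "L1 (nsq (\<lambda>t x. p (u t x) (v t x)))"
    and "S 0 b (\<lambda>t x. p (ds u t x) (v t x))" "S 0 b (\<lambda>t x. p (u t x) (ds v t x))"
  shows "S 0 (Suc b) (\<lambda>t x. p (u t x) (v t x))"
  using S_add[OF assms(5,6)] assms(4) 
  by (intro S_0_SucI bounded_bilinear.sm[OF p] u v) (simp_all add: ds_bilinear[OF p u v])

text \<open>Induction by the Leibniz rule. The factor \<open>u\<close> is one level above the
  product and at least on level 3, so that \<open>u\<close> and \<open>u_s\<close> are bounded in
  time and \<open>u\<close> is bounded uniformly; \<open>v\<close> has just the regularity of the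
  product.\<close>

lemma U_product:
  fixes p :: "'b::euclidean_space \<Rightarrow> 'c::euclidean_space \<Rightarrow> 'd::euclidean_space"
  assumes p: "bounded_bilinear p"
  shows "U (max 3 (Suc k)) u \<Longrightarrow> U k v \<Longrightarrow> U k (\<lambda>t x. p (u t x) (v t x))"
proof (induction k arbitrary: u v)
  case 0
  have u: "S 2 4 u" and v: "S 0 1 v" using 0 by (simp_all add: eval_nat_numeral)
  show ?case
    using S_bdd[OF u, of 0] S_bdd[OF u, of 1] S_L1[OF v, of 0] S_sm[OF u] S_sm[OF v]
    by (auto simp: S_def intro!: product_bdd_L1[OF p] bounded_bilinear.sm[OF p])
next
  case (Suc k)
  note q = bounded_bilinear.flip[OF p]
  note us = S_sm[OF Suc.prems(1)] and vs = S_sm[OF Suc.prems(2)]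
  note s = us vs sm_ds[OF us] sm_ds[OF vs]
  have u3: "S 2 4 u" using Suc.prems(1) by (rule S_mono) auto
  have u: "bdd (nsq u)" "bdd (nsq (ds u))" "L1 (nsq (ds u))" "L1 (nsq (ds (ds u)))" "L1 (nsq (ds (ds (ds u))))"
    using S_bdd[OF u3, of 0] S_bdd[OF u3, of 1] S_L1[OF u3, of 1] S_L1[OF u3, of 2] S_L1[OF u3, of 3]
    by (simp_all add: eval_nat_numeral)
  have v: "L1 (nsq v)" "L1 (nsq (ds v))"
    using S_L1[OF Suc.prems(2), of 0] S_L1[OF Suc.prems(2), of 1] by simp_all
  have uv: "L1 (nsq (\<lambda>t x. p (u t x) (v t x)))" by (rule product_bdd_L1[OF p s(1,2) u(1,2) v(1)])
  have duv: "L1 (nsq (\<lambda>t x. p (ds u t x) (v t x)))" by (rule product_L1_bdd[OF q s(2,3) v(1,2) u(2)])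
  have udv: "L1 (nsq (\<lambda>t x. p (u t x) (ds v t x)))" by (rule product_bdd_L1[OF p s(1,4) u(1,2) v(2)])
  \<comment> \<open>The induction hypothesis asks for level \<open>max 3 (Suc k)\<close> of
    \<open>ds u\<close>, one level below that of \<open>u\<close>; because of the floor 3 this is
    available only for \<open>k \<ge> 2\<close>.\<close>
  consider "k = 0" | "k = 1" | "k \<ge> 2" by linarith
  then show ?case
  proof cases
    case 1
    have "S 0 (Suc 1) (\<lambda>t x. p (u t x) (v t x))"
      by (rule S_0_product_SucI[OF p us vs uv])
        (use duv udv s in \<open>auto simp: S_0_1[unfolded One_nat_def] intro!: bounded_bilinear.sm[OF p]\<close>)
    then show ?thesis using 1 by simp
  next
    case 2
    have vb: "bdd (nsq v)" using S_bdd[OF Suc.prems(2), of 0] 2 by simp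
    have vb: "bdd (nsq v)" "L1 (nsq (ds (ds v)))"
      using S_bdd[OF Suc.prems(2), of 0] S_L1[OF Suc.prems(2), of 2] 2 by (simp_all add: eval_nat_numeral)
    have "S 0 2 (\<lambda>t x. p (u t x) (ds v t x))"
      using Suc.IH[of u "ds v"] u3 S_ds[OF Suc.prems(2)] 2 by (simp add: eval_nat_numeral)
    moreover have "S 0 2 (\<lambda>t x. p (ds u t x) (v t x))"
      unfolding numeral_2_eq_2
    proof (rule S_0_product_SucI[OF p s(3,2) duv])
      show "S 0 (Suc 0) (\<lambda>t x. p (ds (ds u) t x) (v t x))"
        using product_L1_bdd[OF p sm_ds[OF s(3)] s(2) u(4,5) vb(1)] s
        by (auto simp: S_0_1[unfolded One_nat_def] intro!: bounded_bilinear.sm[OF p] sm_ds)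
      show "S 0 (Suc 0) (\<lambda>t x. p (ds u t x) (ds v t x))"
        using product_L1_bdd[OF q s(4,3) v(2) vb(2) u(2)] s
        by (auto simp: S_0_1[unfolded One_nat_def] intro!: bounded_bilinear.sm[OF p] sm_ds)
    qed
    ultimately have "S (Suc 0) (Suc 2) (\<lambda>t x. p (u t x) (v t x))"
      using product_bdd_bdd[OF p us vs u(1,2) vb(1)] uv by (intro S_product_SucI[OF p us vs])
    then show ?thesis using 2 by (simp add: eval_nat_numeral)
  next
    case 3
    have "U k (\<lambda>t x. p (ds u t x) (v t x))"
    proof (rule Suc.IH)
      show "U (max 3 (Suc k)) (ds u)" by (rule S_mono[OF S_ds[OF Suc.prems(1)]]) (use 3 in auto)
      show "U k v" by (rule S_mono[OF Suc.prems(2)]) auto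
    qed
    moreover have "U k (\<lambda>t x. p (u t x) (ds v t x))"
    proof (rule Suc.IH)
      show "U (max 3 (Suc k)) u" by (rule S_mono[OF Suc.prems(1)]) (use 3 in auto)
      show "U k (ds v)" by (rule S_mono[OF S_ds[OF Suc.prems(2)]]) auto
    qed
    moreover have "bdd (nsq v)" using S_bdd[OF Suc.prems(2), of 0] 3 by simp
    from product_bdd_bdd[OF p us vs u(1,2) this] have "bdd (nsq (\<lambda>t x. p (u t x) (v t x)))" .
    ultimately have "S (Suc (k - 1)) (Suc (Suc k)) (\<lambda>t x. p (u t x) (v t x))"
      using uv by (intro S_product_SucI[OF p us vs])
    then show ?thesis using 3 by simp
  qed
qed

text \<open>As in \<open>U_product\<close>, with the floor lowered to 2: \<open>W 2\<close> already
  bounds \<open>u\<close> and \<open>u_s\<close> in time.\<close>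

lemma W_product:
  fixes p :: "'b::euclidean_space \<Rightarrow> 'c::euclidean_space \<Rightarrow> 'd::euclidean_space"
  assumes p: "bounded_bilinear p"
  shows "W (max 2 (Suc k)) u \<Longrightarrow> W k v \<Longrightarrow> W k (\<lambda>t x. p (u t x) (v t x))"
proof (induction k arbitrary: u v)
  case 0
  have u: "S 2 3 u" and v: "S 0 1 v" using 0 by (simp_all add: eval_nat_numeral)
  show ?case
    using S_bdd[OF u, of 0] S_bdd[OF u, of 1] S_L1[OF v, of 0] S_sm[OF u] S_sm[OF v]
    by (auto simp: S_def intro!: product_bdd_L1[OF p] bounded_bilinear.sm[OF p])
next
  case (Suc k)
  note q = bounded_bilinear.flip[OF p]
  note us = S_sm[OF Suc.prems(1)] and vs = S_sm[OF Suc.prems(2)]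
  note s = us vs sm_ds[OF us] sm_ds[OF vs]
  have u2: "S 2 3 u" using Suc.prems(1) by (rule S_mono) auto
  have u: "bdd (nsq u)" "bdd (nsq (ds u))" using S_bdd[OF u2, of 0] S_bdd[OF u2, of 1] by simp_all
  have v: "bdd (nsq v)" "L1 (nsq v)" "L1 (nsq (ds v))"
    using S_bdd[OF Suc.prems(2), of 0] S_L1[OF Suc.prems(2), of 0] S_L1[OF Suc.prems(2), of 1] by simp_all
  \<comment> \<open>For \<open>k = 0\<close> the field \<open>ds u\<close> reaches only level 1,
    below the floor, and the supremum is taken of \<open>v\<close> instead.\<close>
  have "W k (\<lambda>t x. p (ds u t x) (v t x))"
  proof (cases k)
    case 0
    have "L1 (nsq (\<lambda>t x. p (ds u t x) (v t x)))" by (rule product_L1_bdd[OF q s(2,3) v(2,3) u(2)])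
    then show ?thesis using 0 s by (auto simp: S_0_1[unfolded One_nat_def] intro!: bounded_bilinear.sm[OF p])
  next
    case (Suc m)
    show ?thesis
    proof (rule Suc.IH)
      show "W (max 2 (Suc k)) (ds u)" by (rule S_mono[OF S_ds[OF Suc.prems(1)]]) (use Suc in auto)
      show "W k v" by (rule S_mono[OF Suc.prems(2)]) auto
    qed
  qed
  moreover have "W k (\<lambda>t x. p (u t x) (ds v t x))"
  proof (rule Suc.IH)
    show "W (max 2 (Suc k)) u" by (rule S_mono[OF Suc.prems(1)]) auto
    show "W k (ds v)" by (rule S_mono[OF S_ds[OF Suc.prems(2)]]) auto
  qed
  ultimately show ?case
    using product_bdd_bdd[OF p us vs u v(1)] product_bdd_L1[OF p us vs u v(2)]
    by (intro S_product_SucI[OF p us vs])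
qed

text \<open>The borderline case below the floor of \<open>W_product\<close>: on level 1 the supremum
  of \<open>u\<close> is only square integrable in time, which is compensated by \<open>v\<close>
  being bounded in time.\<close>

lemma W_1_product:
  fixes p :: "'b::euclidean_space \<Rightarrow> 'c::euclidean_space \<Rightarrow> 'd::euclidean_space"
  assumes p: "bounded_bilinear p" and u: "W 1 u" and v: "W 1 v"
  shows "W 0 (\<lambda>t x. p (u t x) (v t x))"
  using product_L1_bdd[OF p S_sm[OF u] S_sm[OF v]] S_L1[OF u, of 0] S_L1[OF u, of 1] S_bdd[OF v, of 0]
    S_sm[OF u] S_sm[OF v]
  by (auto simp: S_0_1[unfolded One_nat_def] intro!: bounded_bilinear.sm[OF p])

end

section \<open>The length density\<close>

context bounded_flow
begin

lemmas U_inner = U_product[OF bounded_bilinear_inner]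
lemmas U_scaleR = U_product[OF bounded_bilinear_scaleR]
lemmas U_scaleR_flip = U_product[OF bounded_bilinear.flip[OF bounded_bilinear_scaleR]]
lemmas U_mult = U_product[OF bounded_bilinear_mult]

section \<open>Regularity of the normal velocity\<close>

lemma V'_decomp: "V' = (\<lambda>t x. lam *\<^sub>R (w t x *\<^sub>R K t x) - (3/2) *\<^sub>R ((K t x \<bullet> K t x) *\<^sub>R K t x) - 3 *\<^sub>R ((K t x \<bullet> ds K t x) *\<^sub>R T t x))"
  by (intro ext) (simp add: V'_def)

lemma T_levels:
  assumes T: "U (Suc m) T" and m: "2 \<le> m" shows "U m K" "U (m - 1) (ds K)" "U (m - 2) (ds (ds K))"
proof -
  show K: "U m K" unfolding K_def by (rule S_mono[OF S_ds[OF T]]) auto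
  show dK: "U (m - 1) (ds K)" by (rule S_mono[OF S_ds[OF K]]) (use m in auto)
  show "U (m - 2) (ds (ds K))" by (rule S_mono[OF S_ds[OF dK]]) (use m in auto)
qed

lemma V'_level:
  assumes m: "3 \<le> m" and T: "U (Suc m) T" and wK: "U (m - 1) (\<lambda>t x. w t x *\<^sub>R K t x)"
  shows "U (m - 1) V'"
proof -
  have m2: "2 \<le> m" using m by simp
  note K = T_levels[OF T m2]
  have mx: "max 3 (Suc (m - 1)) = m" using m by simp
  have K': "U (m - 1) K" by (rule S_mono[OF K(1)]) auto
  have T': "U m T" by (rule S_mono[OF T]) auto
  have KK: "U (m - 1) (\<lambda>t x. K t x \<bullet> K t x)" by (rule U_inner) (use K(1) K' mx in auto)
  have 1: "U (m - 1) (\<lambda>t x. (K t x \<bullet> K t x) *\<^sub>R K t x)" by (rule U_scaleR_flip) (use K(1) KK mx in auto)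
  have KdK: "U (m - 1) (\<lambda>t x. K t x \<bullet> ds K t x)" by (rule U_inner) (use K mx in auto)
  have 2: "U (m - 1) (\<lambda>t x. (K t x \<bullet> ds K t x) *\<^sub>R T t x)" by (rule U_scaleR_flip) (use T' KdK mx in auto)
  show ?thesis unfolding V'_decomp by (intro S_diff S_scaleR wK 1 2)
qed

lemma g_level:
  assumes "U (max 3 (Suc k)) K" "U k V'" "U k (ds (ds K))" shows "U k g"
proof -
  have "U k V" unfolding V_def[abs_def] by (intro S_diff assms)
  then show ?thesis unfolding g_def[abs_def] by (intro U_inner assms)
qed

text \<open>Orders 0 and 1 are length and curvature energy; boundedness of order 2 and integrability
  of order 4 come from \<open>dsK_estimate\<close>, integrability of order 3 from
  \<open>L1_ddK\<close>.\<close>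

lemma T_base: "U 4 T"
proof -
  obtain M where M: "\<And>t. t \<in> J \<Longrightarrow> nsq K t \<le> M" "\<And>t. t \<in> J \<Longrightarrow> len t \<le> M" using basic_bounds by metis
  have T: "bdd (nsq T)" using M(2) unfolding bdd_def nsq_def by (auto simp: len_def It_def)
  have K: "bdd (nsq K)" using M(1) unfolding bdd_def by auto
  have "S 3 5 T"
    using T K bdd_L1[OF T] bdd_L1[OF K] dsK_estimate bdd_L1[OF dsK_estimate(1)] L1_ddK base_sm(2)
    by (auto simp: S_def eval_nat_numeral less_Suc_eq K_def[symmetric])
  then show ?thesis by (simp add: eval_nat_numeral)
qed

lemma L1_w: "L1 (nsq w)"
proof -
  obtain M where M: "M \<ge> 1" "\<And>t. t \<in> J \<Longrightarrow> len t \<le> M" using basic_bounds by metis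
  obtain C where C: "C \<ge> 1" "\<And>t x. t \<in> J \<Longrightarrow> (w t x)\<^sup>2 \<le> C * (1 + nsq (ds w) t)" using w_sq_bound by metis
  have "nsq w t \<le> (C * M) * (1 + nsq (ds w) t)" if t: "t \<in> J" for t
  proof -
    have "nsq w t \<le> It (\<lambda>s x. (C * (1 + nsq (ds w) t)) * 1) t"
      unfolding nsq_def[of w] by (intro It_mono_sm sms) (use C(2)[OF t] in \<open>simp add: power2_eq_square\<close>)
    also have "\<dots> = C * (1 + nsq (ds w) t) * len t" unfolding It_cmult len_def ..
    also have "\<dots> \<le> C * (1 + nsq (ds w) t) * M"
      using C(1) nsq_nonneg[of "ds w" t] by (intro mult_left_mono M t) auto
    finally show ?thesis by (simp add: mult_ac)
  qed
  moreover have "L1 (\<lambda>t. (C * M) * (1 + nsq (ds w) t))"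
    using C(1) M(1) by (intro L1_cmult L1_add L1_const L1_dsw) auto
  ultimately show ?thesis by (rule L1_le[rotated])
qed

text \<open>At this stage \<open>w\<close> is known only in \<open>U 1\<close>, with two orders
  square integrable in time, which is too little for \<open>V'_level\<close>. Level 1 is still
  within reach because \<open>K\<close> is already on level 3 and multiplies
  \<open>w\<close>.\<close>

lemma g_base: "U 1 g"
proof (rule g_level)
  have U4: "U (Suc 3) T" using T_base by simp
  have m: "2 \<le> (3::nat)" by simp
  note K = T_levels[OF U4 m]
  have w1: "U 1 w" using L1_w L1_dsw base_sm(1) by (auto simp: S_def less_Suc_eq)
  have wK: "U 1 (\<lambda>t x. w t x *\<^sub>R K t x)" by (rule U_scaleR_flip[OF S_mono[OF K(1)] w1]) auto
  have KK: "U 2 (\<lambda>t x. K t x \<bullet> K t x)" by (rule U_inner[OF S_mono[OF K(1)] S_mono[OF K(1)]]) auto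
  have 1: "U 2 (\<lambda>t x. (K t x \<bullet> K t x) *\<^sub>R K t x)" by (rule U_scaleR_flip[OF S_mono[OF K(1)] KK]) auto
  have KdK: "U 2 (\<lambda>t x. K t x \<bullet> ds K t x)" by (rule U_inner[OF S_mono[OF K(1)] S_mono[OF K(2)]]) auto
  have 2: "U 2 (\<lambda>t x. (K t x \<bullet> ds K t x) *\<^sub>R T t x)" by (rule U_scaleR_flip[OF S_mono[OF U4] KdK]) auto
  show "U 1 V'" unfolding V'_decomp
    by (intro S_diff S_scaleR wK S_mono[OF 1] S_mono[OF 2]) auto
  show "U (max 3 (Suc 1)) K" by (rule S_mono[OF K(1)]) auto
  show "U 1 (ds (ds K))" by (rule S_mono[OF K(3)]) auto
qed

text \<open>A time-integrable bound of the supremum of \<open>g^2\<close> makes \<open>g\<close>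
  admissible as a coefficient in Gronwall's inequality.\<close>

lemma g_sup:
  obtains \<gamma> where "L1 \<gamma>" "\<And>t. 0 \<le> \<gamma> t" "\<And>t x. t \<in> J \<Longrightarrow> (g t x)\<^sup>2 \<le> \<gamma> t" "\<And>t x. t \<in> J \<Longrightarrow> \<bar>g t x\<bar> \<le> 1 + \<gamma> t"
proof -
  obtain N where N: "N \<ge> 1" "\<And>(u :: real \<Rightarrow> real \<Rightarrow> real) t x. sm J u \<Longrightarrow> t \<in> J \<Longrightarrow> (norm (u t x))\<^sup>2 \<le> N * (nsq u t + nsq (ds u) t)"
    using sup_bound_sq[where 'b = real] by metis
  define \<gamma> where "\<gamma> = (\<lambda>t. N * (nsq g t + nsq (ds g) t))"
  have "L1 \<gamma>" unfolding \<gamma>_def using S_L1[OF g_base, of 0] S_L1[OF g_base, of 1] N(1)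
    by (intro L1_cmult L1_add) auto
  moreover have "0 \<le> \<gamma> t" for t unfolding \<gamma>_def using N(1) by (simp add: nsq_nonneg)
  moreover have g: "(g t x)\<^sup>2 \<le> \<gamma> t" if "t \<in> J" for t x using N(2)[OF base_sm(6) that, of x] by (simp add: \<gamma>_def)
  moreover have "\<bar>g t x\<bar> \<le> 1 + \<gamma> t" if "t \<in> J" for t x
  proof -
    have "0 \<le> (\<bar>g t x\<bar> - 1)\<^sup>2" by simp
    then have "2 * \<bar>g t x\<bar> \<le> 1 + (g t x)\<^sup>2" by (simp add: power2_eq_square algebra_simps)
    then show ?thesis using g[OF that, of x] by linarith
  qed
  ultimately show thesis using that by blast
qed

text \<open>One commutation and one integration by parts; the commutator turns the coefficient
  \<open>- g\<close> of \<open>nsq_deriv\<close> into \<open>+ g\<close>.\<close>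

lemma nsq_ds_deriv:
  fixes u :: "real \<Rightarrow> real \<Rightarrow> 'b::euclidean_space"
  assumes u: "st J u" and t: "t \<in> J"
  shows "(nsq (ds u) has_real_derivative
    - 2 * It (\<lambda>t x. ds (ds u) t x \<bullet> Dm u t x) t + It (\<lambda>t x. g t x * (ds u t x \<bullet> ds u t x)) t) (at t within J)"
proof -
  note s = sms st_imp_sm[OF u] Dm_sm[OF u]
  have "It (\<lambda>t x. 2 * (ds u t x \<bullet> Dm (ds u) t x) - g t x * (ds u t x \<bullet> ds u t x)) t
    = It (\<lambda>t x. 2 * (ds u t x \<bullet> ds (Dm u) t x) + g t x * (ds u t x \<bullet> ds u t x)) t"
    unfolding It_def using Dm_ds[OF u t] by (simp add: inner_add_right algebra_simps)
  also have "\<dots> = 2 * It (\<lambda>t x. ds u t x \<bullet> ds (Dm u) t x) t + It (\<lambda>t x. g t x * (ds u t x \<bullet> ds u t x)) t"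
    by (subst It_add_sm, (intro s)+) (simp only: It_cmult)
  also have "It (\<lambda>t x. ds u t x \<bullet> ds (Dm u) t x) t = - It (\<lambda>t x. ds (ds u) t x \<bullet> Dm u t x) t"
    using IBP[OF sm_ds[OF st_imp_sm[OF u]] Dm_sm[OF u], of t] by simp
  finally show ?thesis using nsq_deriv[OF st_ds[OF u] t] by simp
qed

lemma It_g_le:
  assumes u: "sm J u" and le: "\<And>x. \<bar>g t x\<bar> \<le> c" shows "It (\<lambda>t x. g t x * (u t x \<bullet> u t x)) t \<le> c * nsq u t"
proof -
  have "It (\<lambda>t x. g t x * (u t x \<bullet> u t x)) t \<le> It (\<lambda>t x. c * (u t x \<bullet> u t x)) t"
    using le by (intro It_mono_sm sms u mult_right_mono) (auto intro: order_trans[OF abs_ge_self])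
  then show ?thesis by (simp add: It_cmult nsq_def)
qed

text \<open>The equation \<open>D u = lam w u_ss + h\<close> is tested with \<open>u_ss\<close>. The
  lower bound \<open>c\<close> of \<open>w\<close> provides the coercivity constant
  \<open>l = lam c\<close>, and \<open>h\<close> is absorbed without being differentiated.\<close>

lemma parabolic2:
  fixes u :: "real \<Rightarrow> real \<Rightarrow> 'b::euclidean_space"
  assumes u: "st J u" and a: "L1 a" and c: "c > 0" "\<And>t x. t \<in> J \<Longrightarrow> c \<le> w t x"
    and le: "\<And>t. t \<in> J \<Longrightarrow> nsq (\<lambda>t x. Dm u t x - (lam * w t x) *\<^sub>R ds (ds u) t x) t \<le> a t * (1 + nsq (ds u) t)"
  shows "bdd (nsq (ds u))" "L1 (nsq (ds (ds u)))"
proof -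
  obtain \<gamma> where \<gamma>: "L1 \<gamma>" "\<And>t. 0 \<le> \<gamma> t" "\<And>t x. t \<in> J \<Longrightarrow> \<bar>g t x\<bar> \<le> 1 + \<gamma> t" using g_sup by metis
  define h where "h = (\<lambda>t x. Dm u t x - (lam * w t x) *\<^sub>R ds (ds u) t x)"
  define l where "l = lam * c"
  have l: "l > 0" using c lam_pos by (simp add: l_def)
  note s = sms st_imp_sm[OF u] Dm_sm[OF u]
  have hs: "sm J h" unfolding h_def by (intro s)
  define d where "d = (\<lambda>t. - 2 * It (\<lambda>t x. ds (ds u) t x \<bullet> Dm u t x) t + It (\<lambda>t x. g t x * (ds u t x \<bullet> ds u t x)) t)"
  have main: "d t + l * nsq (ds (ds u)) t \<le> (inverse l * a t + (1 + \<gamma> t)) * (1 + nsq (ds u) t)" if t: "t \<in> J" for t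
  proof -
    have "- It (\<lambda>t x. ds (ds u) t x \<bullet> Dm u t x) t = It (\<lambda>t x. - (ds (ds u) t x \<bullet> Dm u t x)) t"
      by (simp add: It_minus)
    also have "\<dots> \<le> It (\<lambda>t x. (inverse l / 2) * (h t x \<bullet> h t x) - (l / 2) * (ds (ds u) t x \<bullet> ds (ds u) t x)) t"
    proof (intro It_mono_sm s hs)
      fix x
      let ?z = "ds (ds u) t x"
      \<comment> \<open>A square completed with weight \<open>l\<close>, so that half of the
        coercive term survives.\<close>
      have "0 \<le> (l *\<^sub>R ?z + h t x) \<bullet> (l *\<^sub>R ?z + h t x)" by simp
      also have "\<dots> = l * (l * (?z \<bullet> ?z) + 2 * (?z \<bullet> h t x) + inverse l * (h t x \<bullet> h t x))"
        using l by (simp add: inner_add_left inner_add_right inner_commute field_simps)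
      finally have "0 \<le> l * (?z \<bullet> ?z) + 2 * (?z \<bullet> h t x) + inverse l * (h t x \<bullet> h t x)"
        using l by (simp add: zero_le_mult_iff)
      moreover have "l * (?z \<bullet> ?z) \<le> lam * w t x * (?z \<bullet> ?z)"
        unfolding l_def using c(2)[OF t, of x] lam_pos by (intro mult_right_mono mult_left_mono) auto
      moreover have "?z \<bullet> Dm u t x = lam * w t x * (?z \<bullet> ?z) + ?z \<bullet> h t x"
        by (simp add: h_def inner_diff_right)
      ultimately show "- (?z \<bullet> Dm u t x) \<le> (inverse l / 2) * (h t x \<bullet> h t x) - (l / 2) * (?z \<bullet> ?z)" by simp
    qed
    also have "\<dots> = (inverse l / 2) * nsq h t - (l / 2) * nsq (ds (ds u)) t"
      unfolding nsq_def by (subst It_diff_sm, (intro s hs)+) (simp only: It_cmult)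
    finally have 1: "- It (\<lambda>t x. ds (ds u) t x \<bullet> Dm u t x) t \<le> \<dots>" .
    have 2: "It (\<lambda>t x. g t x * (ds u t x \<bullet> ds u t x)) t \<le> (1 + \<gamma> t) * nsq (ds u) t"
      by (rule It_g_le[OF sm_ds[OF st_imp_sm[OF u]] \<gamma>(3)[OF t]])
    have 3: "inverse l * nsq h t \<le> inverse l * (a t * (1 + nsq (ds u) t))"
      using le[OF t] l unfolding h_def[symmetric] by (intro mult_left_mono) auto
    have "d t + l * nsq (ds (ds u)) t \<le> inverse l * nsq h t + (1 + \<gamma> t) * nsq (ds u) t"
      using 1 2 unfolding d_def by (simp add: field_simps)
    also have "\<dots> \<le> inverse l * (a t * (1 + nsq (ds u) t)) + (1 + \<gamma> t) * (1 + nsq (ds u) t)"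
      using \<gamma>(2)[of t] by (intro add_mono 3 mult_left_mono) auto
    finally show ?thesis by (simp add: algebra_simps)
  qed
  have A: "L1 (\<lambda>t. inverse l * a t + (1 + \<gamma> t))" using l by (intro L1_add L1_cmult a \<gamma> L1_const) auto
  have D: "\<And>t. t \<in> J \<Longrightarrow> (nsq (ds u) has_real_derivative d t) (at t within J)"
    unfolding d_def by (rule nsq_ds_deriv[OF u])
  have nn: "0 \<le> l * nsq (ds (ds u)) t" for t using l by (simp add: nsq_nonneg)
  have r: "bdd (nsq (ds u))" "L1 (\<lambda>t. l * nsq (ds (ds u)) t)"
    using gronwall[of "nsq (ds u)" d "\<lambda>t. l * nsq (ds (ds u)) t", OF D nsq_nonneg nn A main] by simp_all
  then show "bdd (nsq (ds u))" by simp
  show "L1 (nsq (ds (ds u)))"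
  proof (rule L1_le[OF L1_cmult[OF r(2), of "inverse l"]])
    show "nsq (ds (ds u)) t \<le> inverse l * (l * nsq (ds (ds u)) t)" for t using l by (simp add: field_simps)
  qed (use l in simp)
qed

text \<open>The equation of \<open>ln w\<close> has no quadratic gradient term, and after an integration by parts its estimate needs
  no lower bound of \<open>w\<close>.\<close>

lemma lw_estimate: "bdd (nsq (ds lw))" "L1 (It (\<lambda>t x. w t x * (ds (ds lw) t x)\<^sup>2))"
proof -
  obtain \<gamma> where \<gamma>: "L1 \<gamma>" "\<And>t. 0 \<le> \<gamma> t" "\<And>t x. t \<in> J \<Longrightarrow> \<bar>g t x\<bar> \<le> 1 + \<gamma> t" using g_sup by metis
  note s = sms st_imp_sm[OF lw_st] Dm_sm[OF lw_st]
  define d where "d = (\<lambda>t. - 2 * It (\<lambda>t x. ds (ds lw) t x \<bullet> Dm lw t x) t + It (\<lambda>t x. g t x * (ds lw t x \<bullet> ds lw t x)) t)"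
  let ?B = "It (\<lambda>t x. w t x * (ds (ds lw) t x)\<^sup>2)"
  have main: "d t + 2 * lam * ?B t \<le> (2 + \<gamma> t + nsq (ds g) t) * (1 + nsq (ds lw) t)" if t: "t \<in> J" for t
  proof -
    have "It (\<lambda>t x. ds (ds lw) t x \<bullet> Dm lw t x) t = It (\<lambda>t x. lam * (w t x * (ds (ds lw) t x * ds (ds lw) t x)) - ds (ds lw) t x \<bullet> g t x) t"
      unfolding It_def by (simp add: Dm_lw[OF t] algebra_simps)
    also have "\<dots> = lam * ?B t - It (\<lambda>t x. ds (ds lw) t x \<bullet> g t x) t"
      unfolding power2_eq_square by (subst It_diff_sm, (intro s)+) (simp only: It_cmult)
    \<comment> \<open>With the derivative moved onto \<open>g\<close>, the second derivative of
      \<open>lw\<close> occurs only in the weighted norm \<open>?B\<close>.\<close>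
    also have "It (\<lambda>t x. ds (ds lw) t x \<bullet> g t x) t = - It (\<lambda>t x. ds lw t x \<bullet> ds g t x) t" by (intro IBP s)
    finally have 1: "It (\<lambda>t x. ds (ds lw) t x \<bullet> Dm lw t x) t = lam * ?B t + It (\<lambda>t x. ds lw t x \<bullet> ds g t x) t" by simp
    have "- 2 * It (\<lambda>t x. ds lw t x \<bullet> ds g t x) t = It (\<lambda>t x. - 2 * (ds lw t x \<bullet> ds g t x)) t"
      by (simp only: It_cmult)
    also have "\<dots> \<le> It (\<lambda>t x. ds lw t x \<bullet> ds lw t x + ds g t x \<bullet> ds g t x) t"
    proof (intro It_mono_sm s)
      show "- 2 * (ds lw t x \<bullet> ds g t x) \<le> ds lw t x \<bullet> ds lw t x + ds g t x \<bullet> ds g t x" for x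
        using zero_le_power2[of "ds lw t x + ds g t x"] by (simp add: power2_eq_square algebra_simps)
    qed
    also have "\<dots> = nsq (ds lw) t + nsq (ds g) t"
      unfolding nsq_def by (subst It_add_sm, (intro s)+) simp
    finally have 2: "- 2 * It (\<lambda>t x. ds lw t x \<bullet> ds g t x) t \<le> \<dots>" .
    have 3: "It (\<lambda>t x. g t x * (ds lw t x \<bullet> ds lw t x)) t \<le> (1 + \<gamma> t) * nsq (ds lw) t"
      by (rule It_g_le[OF sm_ds[OF st_imp_sm[OF lw_st]] \<gamma>(3)[OF t]])
    have "d t + 2 * lam * ?B t \<le> nsq (ds lw) t + nsq (ds g) t + (1 + \<gamma> t) * nsq (ds lw) t"
      using 2 3 unfolding d_def 1 by (simp add: algebra_simps)
    also have "\<dots> = (2 + \<gamma> t) * nsq (ds lw) t + nsq (ds g) t * 1" by (simp add: algebra_simps)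
    also have "\<dots> \<le> (2 + \<gamma> t) * (1 + nsq (ds lw) t) + nsq (ds g) t * (1 + nsq (ds lw) t)"
      using \<gamma>(2)[of t] nsq_nonneg[of "ds g" t] nsq_nonneg[of "ds lw" t] by (intro add_mono mult_left_mono) auto
    finally show ?thesis by (simp add: algebra_simps)
  qed
  have A: "L1 (\<lambda>t. 2 + \<gamma> t + nsq (ds g) t)"
    using S_L1[OF g_base, of 1] by (intro L1_add \<gamma> L1_const) auto
  have D: "\<And>t. t \<in> J \<Longrightarrow> (nsq (ds lw) has_real_derivative d t) (at t within J)"
    unfolding d_def by (rule nsq_ds_deriv[OF lw_st])
  have "0 \<le> ?B t" for t by (rule It_nonneg) (simp add: w_pos less_imp_le)
  then have nn: "0 \<le> 2 * lam * ?B t" for t using lam_pos by (intro mult_nonneg_nonneg) auto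
  have r: "bdd (nsq (ds lw))" "L1 (\<lambda>t. 2 * lam * ?B t)"
    using gronwall[of "nsq (ds lw)" d "\<lambda>t. 2 * lam * ?B t", OF D nsq_nonneg nn A main] by simp_all
  then show "bdd (nsq (ds lw))" by simp
  show "L1 ?B"
  proof (rule L1_le[OF L1_cmult[OF r(2), of "inverse (2 * lam)"]])
    show "?B t \<le> inverse (2 * lam) * (2 * lam * ?B t)" for t using lam_pos by (simp add: field_simps)
  qed (use lam_pos in simp)
qed

text \<open>Let \<open>m\<close> be the maximum of \<open>u\<close>. Cauchy-Schwarz and
  \<open>u^2 \<le> m u\<close> bound the oscillation by \<open>sqrt (m A nsq q)\<close>, and the
  inequality of arithmetic and geometric means leaves \<open>m / 2\<close>, which is absorbed. An
  L^2 bound of the logarithmic derivative thus turns an integral bound of a positive function into a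
  pointwise one.\<close>

lemma positive_sup_bound:
  assumes u: "sm J u" and pos: "\<And>x. 0 < u t x" and q: "sm J q"
    and le: "\<And>x. \<bar>ds u t x\<bar> \<le> u t x * \<bar>q t x\<bar>" and A: "It u t \<le> A"
  shows "u t x \<le> 2 * A / len t + A * nsq q t"
proof -
  have cu: "continuous_on A (u t)" and cq: "continuous_on A (q t)" for A by (intro sm_cont[OF u] sm_cont[OF q])+
  obtain x0 where x0: "x0 \<in> {0..2 * pi}" "\<And>y. y \<in> {0..2 * pi} \<Longrightarrow> u t y \<le> u t x0"
    using continuous_attains_sup[of "{0..2 * pi}" "u t"] cu by auto
  have max: "u t y \<le> u t x0" for y
    using periodic_reduce[of "u t" y] sm_per[OF u] x0(2) by metis
  have A0: "0 \<le> A" using It_nonneg[of u t] pos A by (meson less_imp_le order_trans)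
  define m where "m = u t x0"
  let ?I = "It (\<lambda>t x. u t x * \<bar>q t x\<bar>) t"
  have "m \<le> It u t / len t + ?I" unfolding m_def
    by (rule sup_bound[where u = u and h = "\<lambda>t x. u t x * \<bar>q t x\<bar>" and t = t])
      (intro u continuous_intros cu cq le)+
  moreover have "It u t / len t \<le> A / len t" using A len_pos[of t] by (simp add: divide_right_mono less_imp_le)
  moreover have "?I \<le> (m + A * nsq q t) / 2"
  proof -
    have "?I\<^sup>2 \<le> It (\<lambda>t x. (u t x)\<^sup>2) t * It (\<lambda>t x. \<bar>q t x\<bar>\<^sup>2) t"
      by (rule It_CS[of u t "\<lambda>t x. \<bar>q t x\<bar>"]) (intro continuous_intros cu cq)+
    also have "It (\<lambda>t x. \<bar>q t x\<bar>\<^sup>2) t = nsq q t" by (simp add: nsq_def power2_eq_square)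
    also have "It (\<lambda>t x. (u t x)\<^sup>2) t \<le> It (\<lambda>t x. m * u t x) t"
      unfolding power2_eq_square
      by (intro It_mono_sm sms u mult_right_mono) (use max pos m_def less_imp_le in auto)
    also have "\<dots> \<le> m * A" unfolding It_cmult using A pos[of x0] by (simp add: m_def)
    finally have "?I\<^sup>2 \<le> m * A * nsq q t" using nsq_nonneg[of q t] by (simp add: mult_right_mono)
    then have "?I \<le> sqrt (m * (A * nsq q t))" by (intro real_le_rsqrt) (simp add: mult_ac)
    also have "\<dots> \<le> (m + A * nsq q t) / 2"
      using pos[of x0] A0 nsq_nonneg[of q t] by (intro arith_geo_mean_sqrt) (auto simp: m_def)
    finally show ?thesis .
  qed
  moreover have "m \<le> 2 * a + n" if "m \<le> i + I" "i \<le> a" "I \<le> (m + n) / 2" for a i I n :: real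
    using that by argo
  ultimately have "m \<le> 2 * (A / len t) + A * nsq q t" by blast
  then show ?thesis using max[of x] by (simp add: m_def)
qed

text \<open>Up to sign, \<open>w\<close> and \<open>1 / w\<close> have the same logarithmic
  derivative. The integral of the first is bounded by the energy; that of the second is
  \<open>2 * pi\<close> at all times, since the density cancels.\<close>

lemma w_bounds:
  obtains c C where "c > 0" "C \<ge> 1" "\<And>t x. t \<in> J \<Longrightarrow> c \<le> w t x" "\<And>t x. t \<in> J \<Longrightarrow> w t x \<le> C"
proof -
  obtain M where M: "M \<ge> 1" "\<And>t. t \<in> J \<Longrightarrow> It w t \<le> M" "\<And>t. t \<in> J \<Longrightarrow> 1 / len t \<le> M" using basic_bounds by metis
  obtain F where F: "\<And>t. t \<in> J \<Longrightarrow> nsq (ds lw) t \<le> F" using lw_estimate(1) unfolding bdd_def by blast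
  have F0: "0 \<le> F" using F[OF zero_J] nsq_nonneg[of "ds lw" 0] by linarith
  note q = sm_ds[OF st_imp_sm[OF lw_st]]
  have *: "2 * A / len t + A * nsq (ds lw) t \<le> 2 * A * M + A * F" if "t \<in> J" "A \<ge> 0" for t A
    using mult_left_mono[OF M(3)[OF that(1)], of "2 * A"] mult_left_mono[OF F[OF that(1)], of A] that(2) by simp
  have up: "w t x \<le> 2 * M * M + M * F" if t: "t \<in> J" for t x
  proof -
    have "w t x \<le> 2 * M / len t + M * nsq (ds lw) t"
      by (rule positive_sup_bound[OF base_sm(1) w_pos q _ M(2)[OF t]]) (simp add: ds_w abs_mult w_pos less_imp_le)
    then show ?thesis using *[OF t, of M] M(1) by simp
  qed
  define v where "v = (\<lambda>t x. inverse (w t x))"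
  have v: "sm J v" unfolding v_def by (intro sm_inverse base_sm w_pos)
  have vp: "0 < v t x" for t x by (simp add: v_def w_pos)
  have dv: "ds v t x = - (v t x * ds lw t x)" for t x
  proof -
    have "(\<lambda>t x. v t x * w t x) = (\<lambda>t x. 1)" by (intro ext) (simp add: v_def less_imp_neq[OF w_pos, symmetric])
    then have "ds v t x * w t x + v t x * ds w t x = 0" using ds_mult[OF v base_sm(1)] by (metis ds_const)
    then show ?thesis using w_pos[of t x] unfolding ds_w v_def by (simp add: field_simps)
  qed
  have low: "v t x \<le> 2 * (2 * pi) * M + (2 * pi) * F" if t: "t \<in> J" for t x
  proof -
    have "It v t = integral {0..2 * pi} (\<lambda>x. 1)"
      unfolding It_def by (intro integral_cong) (simp add: v_def less_imp_neq[OF w_pos, symmetric])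
    then have "It v t \<le> 2 * pi" by simp
    then have "v t x \<le> 2 * (2 * pi) / len t + (2 * pi) * nsq (ds lw) t"
      by (intro positive_sup_bound[OF v _ q]) (simp_all add: dv abs_mult vp less_imp_le)
    then show ?thesis using *[OF t, of "2 * pi"] by simp
  qed
  define R where "R = 2 * (2 * pi) * M + (2 * pi) * F"
  have R: "R > 0" using M(1) F0 by (simp add: R_def add_pos_nonneg)
  have "inverse R \<le> w t x" if "t \<in> J" for t x
    using le_imp_inverse_le[OF low[OF that, of x]] w_pos[of t x] by (simp add: v_def R_def)
  moreover have "1 \<le> 2 * M * M + M * F + 1" using M(1) F0 by simp
  ultimately show thesis using that[of "inverse R" "2 * M * M + M * F + 1"] R up by (meson add_increasing2 inverse_positive_iff_positive zero_le_one)
qed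

text \<open>Transfers the estimate of \<open>ln w\<close> by \<open>w_s = w lw_s\<close> and
  \<open>w_ss = lw_s w_s + w lw_ss\<close>; the lower bound of \<open>w\<close> removes the weight
  from the integrable term.\<close>

lemma W_2_w: "W 2 w"
proof -
  obtain c C where c: "c > 0" "C \<ge> 1" "\<And>t x. t \<in> J \<Longrightarrow> c \<le> w t x" "\<And>t x. t \<in> J \<Longrightarrow> w t x \<le> C"
    using w_bounds by metis
  obtain M where M: "\<And>t. t \<in> J \<Longrightarrow> It w t \<le> M" using basic_bounds by metis
  define q where "q = ds lw"
  have q: "sm J q" "sm J (ds q)" unfolding q_def by (intro sm_ds st_imp_sm[OF lw_st])+
  have dw: "ds w = (\<lambda>t x. w t x * q t x)" by (intro ext) (simp add: ds_w q_def)
  have ddw: "ds (ds w) = (\<lambda>t x. q t x * ds w t x + w t x * ds q t x)"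
    by (subst dw) (simp add: ds_mult base_sm q mult.commute add.commute)
  have bq: "bdd (nsq q)" using lw_estimate(1) by (simp add: q_def)
  have bw: "bdd (nsq w)"
  proof (rule bdd_le)
    show "bdd (\<lambda>t. C * It w t)" using M c(2) by (intro bdd_cmult) (auto simp: bdd_def)
    show "nsq w t \<le> C * It w t" if "t \<in> J" for t
      unfolding nsq_def It_cmult[symmetric]
      by (intro It_mono_sm sms) (use c(4)[OF that] w_pos less_imp_le in \<open>auto intro!: mult_right_mono\<close>)
  qed
  have bdw: "bdd (nsq (ds w))"
  proof (rule bdd_le)
    show "bdd (\<lambda>t. C\<^sup>2 * nsq q t)" by (intro bdd_cmult bq) simp
    show "nsq (ds w) t \<le> C\<^sup>2 * nsq q t" if "t \<in> J" for t
      unfolding nsq_def It_cmult[symmetric] dw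
    proof (intro It_mono_sm sms q)
      fix x
      have "(w t x)\<^sup>2 \<le> C\<^sup>2" using c(4)[OF that, of x] w_pos[of t x] by (intro power_mono) auto
      then have "(w t x)\<^sup>2 * (q t x)\<^sup>2 \<le> C\<^sup>2 * (q t x)\<^sup>2" by (intro mult_right_mono) auto
      then show "(w t x * q t x) \<bullet> (w t x * q t x) \<le> C\<^sup>2 * (q t x \<bullet> q t x)"
        by (simp add: power2_eq_square mult_ac)
    qed
  qed
  have Ldq: "L1 (nsq (ds q))"
  proof (rule L1_le)
    show "L1 (\<lambda>t. inverse c * It (\<lambda>t x. w t x * (ds (ds lw) t x)\<^sup>2) t)"
      using c(1) by (intro L1_cmult lw_estimate(2)) auto
    show "nsq (ds q) t \<le> inverse c * It (\<lambda>t x. w t x * (ds (ds lw) t x)\<^sup>2) t" if "t \<in> J" for t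
      unfolding nsq_def It_cmult[symmetric] power2_eq_square q_def
    proof (intro It_mono_sm sms sm_const st_imp_sm[OF lw_st])
      fix x
      have "1 \<le> inverse c * w t x" using c(1) c(3)[OF that, of x] by (simp add: field_simps)
      from mult_right_mono[OF this, of "ds (ds lw) t x * ds (ds lw) t x"]
      show "ds (ds lw) t x \<bullet> ds (ds lw) t x \<le> inverse c * (w t x * (ds (ds lw) t x * ds (ds lw) t x))"
        by (simp add: mult.assoc)
    qed
  qed
  have 1: "L1 (nsq (\<lambda>t x. q t x * ds w t x))"
    by (rule product_L1_bdd[OF bounded_bilinear_mult q(1) sm_ds[OF base_sm(1)] bdd_L1[OF bq] Ldq bdw])
  have 2: "L1 (nsq (\<lambda>t x. w t x * ds q t x))"
    by (rule product_bdd_L1[OF bounded_bilinear_mult base_sm(1) q(2) bw bdw Ldq])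
  have "S 0 1 (ds (ds w))" unfolding ddw
    by (intro S_add) (use 1 2 q in \<open>auto simp: S_0_1[unfolded One_nat_def] intro!: sms\<close>)
  then have "S (Suc 0) (Suc 1) (ds w)" by (rule S_SucI[OF sm_ds[OF base_sm(1)] bdw bdd_L1[OF bdw]])
  then have "S (Suc (Suc 0)) (Suc (Suc 1)) w" by (rule S_SucI[OF base_sm(1) bw bdd_L1[OF bw]])
  then show ?thesis by (simp add: eval_nat_numeral)
qed

end

section \<open>Bounds of all orders\<close>

context bounded_flow
begin

text \<open>Differentiating \<open>w g\<close> produces \<open>g w_s\<close>, which cancels against
  the commutator, and the derivatives of \<open>w w_ss\<close> and \<open>w_s^2\<close> leave a
  single product \<open>w_s w_ss\<close>.\<close>

lemma Dm_ds_w: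
  assumes t: "t \<in> J"
  shows "Dm (ds w) t x - (lam * w t x) *\<^sub>R ds (ds (ds w)) t x = (- lam) *\<^sub>R (ds w t x * ds (ds w) t x) - w t x * ds g t x"
proof -
  have "ds (Dm w) t x = ds (\<lambda>t x. lam * (w t x * ds (ds w) t x) - w t x * g t x - lam * (ds w t x * ds w t x)) t x"
    by (rule ds_cong) (simp add: Dm_w[OF t] power2_eq_square)
  then show ?thesis unfolding Dm_ds[OF w_st t] by (simp add: ds_rules sms) (simp add: algebra_simps)
qed

text \<open>The estimate \<open>parabolic2\<close> for \<open>u = w_s\<close>. The term
  \<open>w_s w_ss\<close> is quadratic, but \<open>nsq (ds (ds w))\<close> is the Gronwall quantity,
  and the remaining squared supremum of \<open>w_s\<close> is integrable in time by
  \<open>W_2_w\<close>.\<close>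

lemma W_3_w: "W 3 w"
proof -
  note s = base_sm(1) sm_ds[OF base_sm(1)] sm_ds[OF sm_ds[OF base_sm(1)]]
  have W2: "bdd (nsq w)" "bdd (nsq (ds w))" "L1 (nsq (ds w))" "L1 (nsq (ds (ds w)))"
    using S_bdd[OF W_2_w, of 0] S_bdd[OF W_2_w, of 1] S_L1[OF W_2_w, of 1] S_L1[OF W_2_w, of 2]
    by (simp_all add: eval_nat_numeral)
  have Lg: "L1 (nsq (ds g))" using S_L1[OF g_base, of 1] by simp
  have wg: "L1 (nsq (\<lambda>t x. w t x * ds g t x))"
    by (rule product_bdd_L1[OF bounded_bilinear_mult s(1) sm_ds[OF base_sm(6)] W2(1,2) Lg])
  obtain C where C: "C \<ge> 0" "\<forall>t\<in>J. nsq (\<lambda>t x. ds w t x * ds (ds w) t x) t \<le> C * (nsq (ds w) t + nsq (ds (ds w)) t) * nsq (ds (ds w)) t"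
    using nsq_product[OF bounded_bilinear_mult s(2,3)] by blast
  obtain c where c: "c > 0" "\<And>t x. t \<in> J \<Longrightarrow> c \<le> w t x" using w_bounds by metis
  define a where "a = (\<lambda>t. (2 * lam\<^sup>2 * C) * (nsq (ds w) t + nsq (ds (ds w)) t) + 2 * nsq (\<lambda>t x. w t x * ds g t x) t)"
  have a: "L1 a" unfolding a_def using C(1) by (intro L1_add L1_cmult W2 wg) auto
  have le: "nsq (\<lambda>t x. Dm (ds w) t x - (lam * w t x) *\<^sub>R ds (ds (ds w)) t x) t \<le> a t * (1 + nsq (ds (ds w)) t)" if t: "t \<in> J" for t
  proof -
    have "nsq (\<lambda>t x. Dm (ds w) t x - (lam * w t x) *\<^sub>R ds (ds (ds w)) t x) t
      = nsq (\<lambda>t x. (- lam) *\<^sub>R (ds w t x * ds (ds w) t x) + (-1) *\<^sub>R (w t x * ds g t x)) t"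
      by (rule nsq_cong) (use Dm_ds_w[OF t] in simp)
    also have "\<dots> \<le> 2 * nsq (\<lambda>t x. (- lam) *\<^sub>R (ds w t x * ds (ds w) t x)) t + 2 * nsq (\<lambda>t x. (-1) *\<^sub>R (w t x * ds g t x)) t"
      by (intro nsq_add_le sm_scaleR sm_const sm_mult s sm_ds base_sm)
    also have "\<dots> = 2 * lam\<^sup>2 * nsq (\<lambda>t x. ds w t x * ds (ds w) t x) t + 2 * nsq (\<lambda>t x. w t x * ds g t x) t"
      by (simp only: nsq_scaleR) simp
    also have "\<dots> \<le> 2 * lam\<^sup>2 * (C * (nsq (ds w) t + nsq (ds (ds w)) t) * nsq (ds (ds w)) t) + 2 * nsq (\<lambda>t x. w t x * ds g t x) t"
      using C(2) t by (intro add_mono mult_left_mono) auto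
    also have "\<dots> \<le> a t * (1 + nsq (ds (ds w)) t)"
    proof -
      have "0 \<le> (2 * lam\<^sup>2 * C) * (nsq (ds w) t + nsq (ds (ds w)) t)"
        "0 \<le> 2 * nsq (\<lambda>t x. w t x * ds g t x) t * nsq (ds (ds w)) t"
        using C(1) by (auto intro!: mult_nonneg_nonneg add_nonneg_nonneg nsq_nonneg)
      then show ?thesis by (simp add: a_def algebra_simps)
    qed
    finally show ?thesis .
  qed
  have "bdd (nsq (ds (ds w)))" "L1 (nsq (ds (ds (ds w))))"
    using parabolic2[OF st_ds[OF w_st] a c le] by simp_all
  then show ?thesis using W_2_w by (auto simp: S_def eval_nat_numeral less_Suc_eq)
qed

text \<open>The derivative of order \<open>j\<close> of \<open>T\<close> solves a fourth-order
  equation with inhomogeneity \<open>h j\<close>. On \<open>J\<close>,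
  \<open>h 0 = V'_s + g T\<close>, and \<open>h (Suc j)\<close> is \<open>(h j)_s\<close> plus
  \<open>g\<close> times the derivative of order \<open>Suc j\<close>. Used for order
  \<open>m - 2\<close>, \<open>parabolic4\<close> bounds order \<open>m\<close> in time and
  integrates order \<open>m + 2\<close>, precisely what the next level adds.\<close>

lemma T_step:
  assumes m: "3 \<le> m" and T: "U (Suc m) T" and w: "W m w" shows "U (Suc (Suc m)) T"
proof -
  have m2: "2 \<le> m" using m by simp
  note K = T_levels[OF T m2]
  have wK: "U (m - 1) (\<lambda>t x. w t x *\<^sub>R K t x)"
    by (rule U_scaleR[OF S_mono[OF w] S_mono[OF K(1)]]) (use m in auto)
  have V': "U (m - 1) V'" by (rule V'_level[OF m T wK])
  have g: "U (m - 2) g"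
    by (rule g_level[OF S_mono[OF K(1)] S_mono[OF V'] K(3)]) (use m in auto)
  define h where "h = (\<lambda>j t x. Dm ((ds ^^ j) T) t x + (ds ^^ (j + 4)) T t x)"
  have hs: "sm J (h j)" for j unfolding h_def by (intro sm_add Dm_sm sm_ds_pow st_ds_pow T_st base_sm)
  have gT: "S 0 (m - 2 - j) (\<lambda>t x. g t x *\<^sub>R (ds ^^ Suc j) T t x)" if "j + 3 \<le> m" for j
  proof -
    have T': "S (m - Suc j) (Suc (Suc m) - Suc j) ((ds ^^ Suc j) T)" using S_ds_pow[OF T, of "Suc j"] by simp
    have "U (m - 3 - j) (\<lambda>t x. g t x *\<^sub>R (ds ^^ Suc j) T t x)"
      by (rule U_scaleR_flip[OF S_mono[OF T'] S_mono[OF g]]) (use m that in auto)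
    then show ?thesis by (rule S_mono) (use m that in auto)
  qed
  \<comment> \<open>Each differentiation costs one order. At \<open>j = m - 2\<close> exactly one is
    left: \<open>h\<close> itself is square integrable in time.\<close>
  have h: "j + 2 \<le> m \<Longrightarrow> S 0 (m - 1 - j) (h j)" for j
  proof (induction j)
    case 0
    have "S 0 (m - 1) (ds V')" by (rule S_mono[OF S_ds[OF V']]) auto
    moreover have "S 0 (m - 1) (\<lambda>t x. g t x *\<^sub>R T t x)"
      by (rule S_mono[OF U_scaleR_flip[OF S_mono[OF T] g]]) (use m in auto)
    ultimately have "S 0 (m - 1) (\<lambda>t x. ds V' t x + g t x *\<^sub>R T t x)" by (rule S_add)
    then show ?case unfolding minus_nat.diff_0
      by (rule S_cong[OF _ _ hs]) (simp add: h_def eval_nat_numeral Dm_T_h K_def[symmetric])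
  next
    case (Suc j)
    have "S 0 (m - 2 - j) (ds (h j))" by (rule S_mono[OF S_ds[OF Suc.IH]]) (use Suc.prems in auto)
    from S_add[OF this gT] Suc.prems
    have "S 0 (m - 1 - Suc j) (\<lambda>t x. ds (h j) t x + g t x *\<^sub>R (ds ^^ Suc j) T t x)" by simp
    then show ?case
    proof (rule S_cong[OF _ _ hs])
      fix t x assume t: "t \<in> J"
      have "h (Suc j) t x = ds (Dm ((ds ^^ j) T)) t x + g t x *\<^sub>R (ds ^^ Suc j) T t x + ds ((ds ^^ (j + 4)) T) t x"
        using Dm_ds[OF st_ds_pow[OF T_st] t, of j x] by (simp only: h_def add_Suc funpow.simps comp_apply)
      moreover have "ds (h j) = (\<lambda>t x. ds (Dm ((ds ^^ j) T)) t x + ds ((ds ^^ (j + 4)) T) t x)"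
        unfolding h_def by (intro ds_add Dm_sm sm_ds_pow st_ds_pow T_st base_sm)
      ultimately show "ds (h j) t x + g t x *\<^sub>R (ds ^^ Suc j) T t x = h (Suc j) t x" by simp
    qed
  qed
  define u where "u = (ds ^^ (m - 2)) T"
  have ust: "st J u" unfolding u_def by (intro st_ds_pow T_st)
  have us: "sm J u" by (rule st_imp_sm[OF ust])
  obtain n where n: "m = Suc (Suc n)" using m2 by (metis add_2_eq_Suc le_Suc_ex)
  have d1: "ds u = (ds ^^ (m - 1)) T" and d2: "ds (ds u) = (ds ^^ m) T" by (simp_all add: u_def n)
  have d3: "ds (ds (ds u)) = (ds ^^ Suc m) T" using d2 by simp
  have d4: "ds (ds (ds (ds u))) = (ds ^^ Suc (Suc m)) T" using d2 by simp
  have "S 0 1 (h (m - 2))" using h[of "m - 2"] m by simp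
  then have Lh: "L1 (nsq (h (m - 2)))" by (simp add: S_0_1[unfolded One_nat_def])
  have h_eq: "h (m - 2) = (\<lambda>t x. Dm u t x + ds (ds (ds (ds u))) t x)"
  proof -
    have "m - 2 + 4 = Suc (Suc m)" using m by simp
    then show ?thesis unfolding h_def d4 by (simp only: u_def)
  qed
  obtain \<gamma> where \<gamma>: "L1 \<gamma>" "\<And>t. 0 \<le> \<gamma> t" "\<And>t x. t \<in> J \<Longrightarrow> (g t x)\<^sup>2 \<le> \<gamma> t" "\<And>t x. t \<in> J \<Longrightarrow> \<bar>g t x\<bar> \<le> 1 + \<gamma> t"
    using g_sup by metis
  have b1: "bdd (nsq (ds u))" unfolding d1 using S_bdd[OF T, of "m - 1"] m by simp
  have L3: "L1 (nsq (ds (ds (ds u))))" unfolding d3 by (rule S_L1[OF T]) simp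
  \<comment> \<open>The factor \<open>g\<close> is replaced by its supremum. Order
    \<open>m - 1\<close> is already bounded in time, and order \<open>m\<close> is the Gronwall
    quantity.\<close>
  define a where "a = (\<lambda>t. nsq (h (m - 2)) t + nsq (ds (ds (ds u))) t + \<gamma> t * nsq (ds u) t + (1 + \<gamma> t))"
  have a: "L1 a" unfolding a_def by (intro L1_add L1_const Lh L3 L1_mult_bdd b1 \<gamma>)
  have le: "nsq (\<lambda>t x. Dm u t x + ds (ds (ds (ds u))) t x) t + nsq (ds (ds (ds u))) t +
         It (\<lambda>t x. (g t x)\<^sup>2 * (norm (ds u t x))\<^sup>2) t + It (\<lambda>t x. \<bar>g t x\<bar> * (norm (ds (ds u) t x))\<^sup>2) t
         \<le> a t * (1 + nsq (ds (ds u)) t)" if t: "t \<in> J" for t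
  proof -
    have cg: "continuous_on {0..2 * pi} (g t)" by (rule sm_cont[OF base_sm(6)])
    have c1: "continuous_on {0..2 * pi} (ds u t)" by (rule sm_cont[OF sm_ds[OF us]])
    have c2: "continuous_on {0..2 * pi} (ds (ds u) t)" by (rule sm_cont[OF sm_ds[OF sm_ds[OF us]]])
    have 1: "It (\<lambda>t x. (g t x)\<^sup>2 * (norm (ds u t x))\<^sup>2) t \<le> \<gamma> t * nsq (ds u) t"
    proof -
      have "It (\<lambda>t x. (g t x)\<^sup>2 * (norm (ds u t x))\<^sup>2) t \<le> It (\<lambda>s x. \<gamma> t * (ds u s x \<bullet> ds u s x)) t"
      proof (rule It_mono[where u = "\<lambda>t x. (g t x)\<^sup>2 * (norm (ds u t x))\<^sup>2" and v = "\<lambda>s x. \<gamma> t * (ds u s x \<bullet> ds u s x)" and t = t])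
        show "(g t x)\<^sup>2 * (norm (ds u t x))\<^sup>2 \<le> \<gamma> t * (ds u t x \<bullet> ds u t x)" for x
          unfolding power2_norm_eq_inner using \<gamma>(3)[OF t] by (intro mult_right_mono) auto
      qed (intro continuous_intros cg c1)+
      then show ?thesis by (simp add: It_cmult nsq_def)
    qed
    have 2: "It (\<lambda>t x. \<bar>g t x\<bar> * (norm (ds (ds u) t x))\<^sup>2) t \<le> (1 + \<gamma> t) * nsq (ds (ds u)) t"
    proof -
      have "It (\<lambda>t x. \<bar>g t x\<bar> * (norm (ds (ds u) t x))\<^sup>2) t \<le> It (\<lambda>s x. (1 + \<gamma> t) * (ds (ds u) s x \<bullet> ds (ds u) s x)) t"
      proof (rule It_mono[where u = "\<lambda>t x. \<bar>g t x\<bar> * (norm (ds (ds u) t x))\<^sup>2" and v = "\<lambda>s x. (1 + \<gamma> t) * (ds (ds u) s x \<bullet> ds (ds u) s x)" and t = t])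
        show "\<bar>g t x\<bar> * (norm (ds (ds u) t x))\<^sup>2 \<le> (1 + \<gamma> t) * (ds (ds u) t x \<bullet> ds (ds u) t x)" for x
          unfolding power2_norm_eq_inner using \<gamma>(4)[OF t] by (intro mult_right_mono) auto
      qed (intro continuous_intros cg c2)+
      then show ?thesis by (simp add: It_cmult nsq_def)
    qed
    define A where "A = nsq (h (m - 2)) t + nsq (ds (ds (ds u))) t + \<gamma> t * nsq (ds u) t"
    have A0: "0 \<le> A" unfolding A_def using \<gamma>(2) by (intro add_nonneg_nonneg mult_nonneg_nonneg nsq_nonneg) auto
    have "A + (1 + \<gamma> t) * nsq (ds (ds u)) t \<le> (A + (1 + \<gamma> t)) * (1 + nsq (ds (ds u)) t)"
      using A0 \<gamma>(2)[of t] mult_nonneg_nonneg[OF A0 nsq_nonneg[of "ds (ds u)" t]] by (simp add: algebra_simps)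
    then show ?thesis
      unfolding h_eq[symmetric] using 1 2 by (simp add: A_def a_def)
  qed
  have "bdd (nsq (ds (ds u)))" "L1 (nsq (ds (ds (ds (ds u)))))"
    using parabolic4[OF ust a le] by simp_all
  then show ?thesis using T unfolding d2 d4 by (auto simp: S_def less_Suc_eq)
qed

text \<open>Differentiating the equation of order \<open>j\<close> adds \<open>lam w_s\<close> times
  order \<open>j + 2\<close>, from the variable coefficient \<open>lam w\<close>, and
  \<open>g\<close> times order \<open>j + 1\<close>, from the commutator. The recursion starts at
  index 1, the equation of \<open>w_s\<close>. Used for order \<open>m - 1\<close>,
  \<open>parabolic2\<close> bounds order \<open>m\<close> in time and integrates order
  \<open>m + 1\<close>.\<close>

lemma w_step:
  assumes m: "3 \<le> m" and T: "U (Suc (Suc m)) T" and w: "W m w" shows "W (Suc m) w"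
proof -
  have m3: "2 \<le> Suc m" using m by simp
  note K = T_levels[OF T m3]
  have m4: "3 \<le> m" using m by simp
  have T': "U (Suc m) T" by (rule S_mono[OF T]) auto
  have wK: "U (m - 1) (\<lambda>t x. w t x *\<^sub>R K t x)"
    by (rule U_scaleR[OF S_mono[OF w] S_mono[OF K(1)]]) (use m in auto)
  have V': "U (m - 1) V'" by (rule V'_level[OF m T' wK])
  have g: "U (m - 1) g"
    by (rule g_level[OF S_mono[OF K(1)] V']) (use m K(3) in auto)
  define h where "h = (\<lambda>j t x. Dm ((ds ^^ j) w) t x - (lam * w t x) *\<^sub>R (ds ^^ (j + 2)) w t x)"
  have hs: "sm J (h j)" for j unfolding h_def
    by (intro sm_diff sm_scaleR sm_mult sm_const Dm_sm sm_ds_pow st_ds_pow w_st base_sm)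
  note W_mult = W_product[OF bounded_bilinear_mult]
  have dw: "S (m - j) (Suc m - j) ((ds ^^ j) w)" for j using S_ds_pow[OF w, of j] by simp
  have dw1: "S (m - 1) m (ds w)" using dw[of 1] by simp
  have dw2: "S (m - 2) (m - 1) (ds (ds w))" using dw[of 2] by (simp add: numeral_2_eq_2)
  have h: "j + 2 \<le> m \<Longrightarrow> S 0 (m - 1 - j) (h (Suc j))" for j
  proof (induction j)
    case 0
    have "S 0 (m - 1) (\<lambda>t x. ds w t x * ds (ds w) t x)"
      by (rule S_mono[OF W_mult[of "m - 2", OF S_mono[OF dw1] S_mono[OF dw2]]]) (use m in auto)
    moreover have "S 0 (m - 1) (\<lambda>t x. w t x * ds g t x)"
      by (rule S_mono[OF U_mult[of "m - 2", OF S_mono[OF w] S_mono[OF S_ds[OF g]]]]) (use m in auto)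
    ultimately have "S 0 (m - 1) (\<lambda>t x. (- lam) *\<^sub>R (ds w t x * ds (ds w) t x) - w t x * ds g t x)"
      by (intro S_diff S_scaleR)
    then show ?case unfolding minus_nat.diff_0
      by (rule S_cong[OF _ _ hs]) (use Dm_ds_w in \<open>simp add: h_def eval_nat_numeral\<close>)
  next
    case (Suc j)
    have 1: "S 0 (m - 1 - Suc j) (ds (h (Suc j)))" by (rule S_mono[OF S_ds[OF Suc.IH]]) (use Suc.prems in auto)
    have 2: "S 0 (m - 1 - Suc j) (\<lambda>t x. ds w t x * (ds ^^ (Suc j + 2)) w t x)"
      by (rule S_mono[OF W_mult[of "m - 3 - j", OF S_mono[OF dw1] S_mono[OF dw[of "Suc j + 2"]]]])
        (use m Suc.prems in auto)
    have 3: "S 0 (m - 1 - Suc j) (\<lambda>t x. (ds ^^ (Suc (Suc j))) w t x * g t x)"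
    \<comment> \<open>At \<open>m = j + 3\<close> the first factor is only on level 1, below the
      floor of \<open>W_product\<close>.\<close>
    proof (cases "m = j + 3")
      case True
      have "W 0 (\<lambda>t x. (ds ^^ (Suc (Suc j))) w t x * g t x)"
        by (rule W_1_product[OF bounded_bilinear_mult S_mono[OF dw[of "Suc (Suc j)"]] S_mono[OF g]]) (use m True in auto)
      then show ?thesis by (rule S_mono) (use True in auto)
    next
      case False
      show ?thesis
        by (rule S_mono[OF W_mult[of "m - 3 - j", OF S_mono[OF dw[of "Suc (Suc j)"]] S_mono[OF g]]])
          (use m Suc.prems False in auto)
    qed
    from S_add[OF S_add[OF 1 S_scaleR[OF 2, of lam]] 3]
    show ?case
    proof (rule S_cong[OF _ _ hs])
      fix t x assume t: "t \<in> J"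
      let ?u = "(ds ^^ (Suc j)) w"
      have dd: "(ds ^^ (Suc j + 2)) w = ds (ds ?u)" "(ds ^^ (Suc (Suc j))) w = ds ?u" "(ds ^^ (Suc (Suc j) + 2)) w = ds (ds (ds ?u))"
        by (simp_all add: numeral_2_eq_2)
      have us: "st J ?u" by (rule st_ds_pow[OF w_st])
      have hj: "h (Suc j) = (\<lambda>t x. Dm ?u t x - (lam * w t x) * ds (ds ?u) t x)"
        unfolding h_def dd by simp
      have hj2: "h (Suc (Suc j)) t x = Dm (ds ?u) t x - (lam * w t x) * ds (ds (ds ?u)) t x"
        unfolding h_def dd by simp
      have "ds (h (Suc j)) t x = ds (Dm ?u) t x - (lam * ds w t x * ds (ds ?u) t x + lam * w t x * ds (ds (ds ?u)) t x)"
        unfolding hj using st_imp_sm[OF us] Dm_sm[OF us] by (simp add: ds_rules sms)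
      then show "ds (h (Suc j)) t x + lam *\<^sub>R (ds w t x * (ds ^^ (Suc j + 2)) w t x) + (ds ^^ Suc (Suc j)) w t x * g t x
        = h (Suc (Suc j)) t x"
        unfolding hj2 dd Dm_ds[OF us t] by (simp add: algebra_simps)
    qed
  qed
  define u where "u = (ds ^^ (m - 1)) w"
  have ust: "st J u" unfolding u_def by (intro st_ds_pow w_st)
  have d1: "ds u = (ds ^^ m) w" unfolding u_def using m by (cases m) auto
  have d2: "ds (ds u) = (ds ^^ Suc m) w" using d1 by simp
  have "S 0 1 (h (m - 1))" using h[of "m - 2"] m by (simp add: numeral_2_eq_2 Suc_diff_Suc)
  then have Lh: "L1 (nsq (h (m - 1)))" by (simp add: S_0_1[unfolded One_nat_def])
  have h_eq: "h (m - 1) = (\<lambda>t x. Dm u t x - (lam * w t x) *\<^sub>R ds (ds u) t x)"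
    unfolding h_def u_def[symmetric] d2 using m by (cases m) auto
  obtain c where c: "c > 0" "\<And>t x. t \<in> J \<Longrightarrow> c \<le> w t x" using w_bounds by metis
  have le: "nsq (\<lambda>t x. Dm u t x - (lam * w t x) *\<^sub>R ds (ds u) t x) t \<le> nsq (h (m - 1)) t * (1 + nsq (ds u) t)" for t
    unfolding h_eq[symmetric] using nsq_nonneg[of "h (m - 1)" t] nsq_nonneg[of "ds u" t] by (simp add: algebra_simps)
  have "bdd (nsq (ds u))" "L1 (nsq (ds (ds u)))" using parabolic2[OF ust Lh c le] by simp_all
  then show ?thesis using w unfolding d1 d2 by (auto simp: S_def less_Suc_eq)
qed

lemma all_levels: "U (Suc (m + 3)) T \<and> W (m + 3) w"
proof (induction m)
  case 0
  show ?case using T_base W_3_w by (simp add: eval_nat_numeral)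
next
  case (Suc m)
  have "U (Suc (Suc (m + 3))) T" using Suc.IH by (intro T_step) auto
  moreover then have "W (Suc (m + 3)) w" using Suc.IH by (intro w_step) auto
  ultimately show ?case by simp
qed

lemma nsq_bounded: "bdd (nsq ((ds ^^ j) T))" "bdd (nsq ((ds ^^ j) w))"
  using S_bdd[OF conjunct1[OF all_levels[of j]], of j] S_bdd[OF conjunct2[OF all_levels[of j]], of j] by auto

section \<open>From L^2 bounds along the curve to uniform bounds in the parameter\<close>

definition bnd :: "(real \<Rightarrow> real \<Rightarrow> 'b::euclidean_space) \<Rightarrow> bool" where
  "bnd u \<longleftrightarrow> sm J u \<and> (\<exists>C. \<forall>t\<in>J. \<forall>x. norm (u t x) \<le> C)"

primrec Bd :: "nat \<Rightarrow> (real \<Rightarrow> real \<Rightarrow> 'b::euclidean_space) \<Rightarrow> bool" where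
  "Bd 0 u \<longleftrightarrow> bnd u"
| "Bd (Suc n) u \<longleftrightarrow> bnd u \<and> Bd n (ds u)"

lemma Bd_bnd: "Bd n u \<Longrightarrow> bnd u" by (cases n) auto
lemma Bd_sm: "Bd n u \<Longrightarrow> sm J u" using Bd_bnd bnd_def by blast
lemma Bd_Suc_D: "Bd (Suc n) u \<Longrightarrow> Bd n u" by (induction n arbitrary: u) auto

lemma nsq_bounded_imp_Bd:
  assumes "sm J u" "\<And>j. bdd (nsq ((ds ^^ j) u))" shows "Bd n (u :: real \<Rightarrow> real \<Rightarrow> 'b::euclidean_space)"
  using assms
proof (induction n arbitrary: u)
  have b: "bnd u" if u: "sm J u" "\<And>j. bdd (nsq ((ds ^^ j) u))" for u :: "real \<Rightarrow> real \<Rightarrow> 'b"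
  proof -
    obtain N where N: "N \<ge> 1" "\<And>(u :: real \<Rightarrow> real \<Rightarrow> 'b) t x. sm J u \<Longrightarrow> t \<in> J \<Longrightarrow> (norm (u t x))\<^sup>2 \<le> N * (nsq u t + nsq (ds u) t)"
      using sup_bound_sq[where 'b = 'b] by metis
    have "bdd (\<lambda>t. N * (nsq u t + nsq (ds u) t))"
      using u(2)[of 0] u(2)[of 1] N(1) by (intro bdd_cmult bdd_add) auto
    then obtain C where "\<forall>t\<in>J. N * (nsq u t + nsq (ds u) t) \<le> C" unfolding bdd_def by blast
    then have "norm (u t x) \<le> sqrt C" if "t \<in> J" for t x
      using N(2)[OF u(1) that, of x] that by (intro real_le_rsqrt) (meson order_trans)
    then show ?thesis using u(1) unfolding bnd_def by blast
  qed
  case 0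
  then show ?case using b by simp
next
  case (Suc n)
  have b: "bnd u"
    using Suc.IH[of u] Suc.prems Bd_bnd by blast
  have "bdd (nsq ((ds ^^ j) (ds u)))" for j using Suc.prems(2)[of "Suc j"] unfolding ds_pow_Suc .
  then have "Bd n (ds u)" by (intro Suc.IH sm_ds Suc.prems)
  with b show ?case by simp
qed

lemma bnd_add: "bnd u \<Longrightarrow> bnd v \<Longrightarrow> bnd (\<lambda>t x. u t x + v t x)"
  unfolding bnd_def by (auto intro!: sm_add) (meson add_mono norm_triangle_le)

lemma Bd_add: "Bd n u \<Longrightarrow> Bd n v \<Longrightarrow> Bd n (\<lambda>t x. u t x + v t x)"
proof (induction n arbitrary: u v)
  case (Suc n)
  then show ?case using ds_add[OF Bd_sm[OF Suc.prems(1)] Bd_sm[OF Suc.prems(2)]] by (simp add: bnd_add)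
qed (simp add: bnd_add)

lemma bnd_bilinear:
  fixes p :: "'b::euclidean_space \<Rightarrow> 'c::euclidean_space \<Rightarrow> 'd::euclidean_space"
  assumes p: "bounded_bilinear p" and u: "bnd u" and v: "bnd v"
  shows "bnd (\<lambda>t x. p (u t x) (v t x))"
proof -
  obtain k where k: "k \<ge> 0" "\<And>a b. norm (p a b) \<le> norm a * norm b * k"
    using bounded_bilinear.nonneg_bounded[OF p] by blast
  obtain C D where C: "\<forall>t\<in>J. \<forall>x. norm (u t x) \<le> C" "\<forall>t\<in>J. \<forall>x. norm (v t x) \<le> D"
    using u v unfolding bnd_def by blast
  have "norm (p (u t x) (v t x)) \<le> C * D * k" if "t \<in> J" for t x
  proof -
    have "norm (u t x) * norm (v t x) * k \<le> C * D * k"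
      using C that k(1) by (intro mult_right_mono mult_mono) (auto intro: order_trans[OF norm_ge_zero])
    then show ?thesis using k(2) order_trans by blast
  qed
  then show ?thesis using u v unfolding bnd_def by (auto intro!: bounded_bilinear.sm[OF p])
qed

lemma Bd_bilinear:
  fixes p :: "'b::euclidean_space \<Rightarrow> 'c::euclidean_space \<Rightarrow> 'd::euclidean_space"
  assumes p: "bounded_bilinear p"
  shows "Bd n u \<Longrightarrow> Bd n v \<Longrightarrow> Bd n (\<lambda>t x. p (u t x) (v t x))"
proof (induction n arbitrary: u v)
  case (Suc n)
  have "Bd n (\<lambda>t x. p (ds u t x) (v t x) + p (u t x) (ds v t x))"
    using Suc.prems Bd_Suc_D[OF Suc.prems(1)] Bd_Suc_D[OF Suc.prems(2)]
    by (intro Bd_add Suc.IH) auto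
  then show ?case
    using ds_bilinear[OF p Bd_sm[OF Suc.prems(1)] Bd_sm[OF Suc.prems(2)]] bnd_bilinear[OF p Bd_bnd[OF Suc.prems(1)] Bd_bnd[OF Suc.prems(2)]]
    by simp
qed (simp add: bnd_bilinear[OF p])

definition bounded_derivs :: "(real \<Rightarrow> real \<Rightarrow> 'b::euclidean_space) \<Rightarrow> bool" where
  "bounded_derivs u \<longleftrightarrow> (\<forall>n. Bd n u)"

lemma bounded_derivs_add: "bounded_derivs u \<Longrightarrow> bounded_derivs v \<Longrightarrow> bounded_derivs (\<lambda>t x. u t x + v t x)"
  by (simp add: bounded_derivs_def Bd_add)

lemma bounded_derivs_bilinear:
  fixes p :: "'b::euclidean_space \<Rightarrow> 'c::euclidean_space \<Rightarrow> 'd::euclidean_space"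
  assumes "bounded_bilinear p"
  shows "bounded_derivs u \<Longrightarrow> bounded_derivs v \<Longrightarrow> bounded_derivs (\<lambda>t x. p (u t x) (v t x))"
  by (simp add: bounded_derivs_def Bd_bilinear[OF assms])

lemma bounded_derivs_ds: "bounded_derivs u \<Longrightarrow> bounded_derivs (ds u)"
  unfolding bounded_derivs_def by (metis Bd.simps(2))

lemma bounded_derivs_const: "bounded_derivs (\<lambda>t x. c)"
proof -
  have "Bd n (\<lambda>t x. c)" for n and c :: 'b by (induction n arbitrary: c) (auto simp: bnd_def)
  then show ?thesis by (simp add: bounded_derivs_def)
qed

lemmas bounded_derivs_scaleR = bounded_derivs_bilinear[OF bounded_bilinear_scaleR]
lemmas bounded_derivs_inner = bounded_derivs_bilinear[OF bounded_bilinear_inner]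

lemma bounded_derivs_T: "bounded_derivs T" and bounded_derivs_w: "bounded_derivs w"
  unfolding bounded_derivs_def using nsq_bounded_imp_Bd nsq_bounded base_sm(1,2) by blast+

lemma bounded_derivs_K: "bounded_derivs K"
  unfolding K_def by (rule bounded_derivs_ds[OF bounded_derivs_T])

text \<open>The class is closed under \<open>ds\<close> and products and contains \<open>w\<close>;
  since \<open>dx u = w u_s\<close>, arc length bounds become bounds in the parameter.\<close>

lemma bounded_derivs_dx:
  assumes "bounded_derivs u" shows "bounded_derivs (dx u)"
proof -
  have "dx u = (\<lambda>t x. w t x *\<^sub>R ds u t x)"
    by (intro ext) (simp add: ds_def less_imp_neq[OF w_pos, symmetric])
  then show ?thesis using bounded_derivs_scaleR[OF bounded_derivs_w bounded_derivs_ds[OF assms]] by simp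
qed

lemma bounded_derivs_dx_pow: "bounded_derivs u \<Longrightarrow> bounded_derivs ((dx ^^ i) u)"
  by (induction i) (auto intro: bounded_derivs_dx)

lemma bounded_derivs_dx_f: "bounded_derivs (dx f)"
proof -
  have "dx f = (\<lambda>t x. w t x *\<^sub>R T t x)" by (intro ext dx_f)
  then show ?thesis using bounded_derivs_scaleR[OF bounded_derivs_w bounded_derivs_T] by simp
qed

lemma bounded_derivs_vel: "bounded_derivs vel"
proof -
  have "vel = (\<lambda>t x. ((lam *\<^sub>R (w t x *\<^sub>R K t x) + (- 3/2) *\<^sub>R ((K t x \<bullet> K t x) *\<^sub>R K t x)) + (- 3) *\<^sub>R ((K t x \<bullet> ds K t x) *\<^sub>R T t x))
     + (- 1) *\<^sub>R ds (ds K) t x + lam *\<^sub>R (ds w t x *\<^sub>R T t x))"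
    by (intro ext) (simp add: vel_def V_def V'_def)
  moreover have "bounded_derivs \<dots>"
    by (intro bounded_derivs_add bounded_derivs_scaleR bounded_derivs_inner bounded_derivs_const bounded_derivs_ds
        bounded_derivs_w bounded_derivs_K bounded_derivs_T)
  ultimately show ?thesis by simp
qed

text \<open>Through the equation, the second bound controls the time derivatives of the space
  derivatives of the curve. Together they give Lipschitz bounds in both variables.\<close>

lemma apriori_bounds:
  "\<exists>C. \<forall>t\<in>J. \<forall>x. norm ((dx ^^ Suc i) f t x) \<le> C"
  "\<exists>C. \<forall>t\<in>J. \<forall>x. norm ((dx ^^ i) vel t x) \<le> C"
proof -
  have "bounded_derivs ((dx ^^ i) (dx f))" "bounded_derivs ((dx ^^ i) vel)"
    by (intro bounded_derivs_dx_pow bounded_derivs_dx_f bounded_derivs_vel)+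
  then have "bnd ((dx ^^ i) (dx f))" "bnd ((dx ^^ i) vel)"
    unfolding bounded_derivs_def using Bd_bnd by blast+
  then show "\<exists>C. \<forall>t\<in>J. \<forall>x. norm ((dx ^^ Suc i) f t x) \<le> C" "\<exists>C. \<forall>t\<in>J. \<forall>x. norm ((dx ^^ i) vel t x) \<le> C"
    by (auto simp: bnd_def funpow_swap1)
qed

end

section \<open>Extension and global existence\<close>

lemma vector_derivative_lipschitz:
  fixes f :: "real \<Rightarrow> 'a::real_normed_vector"
  assumes "convex S" "\<And>x. x \<in> S \<Longrightarrow> (f has_vector_derivative f' x) (at x within S)"
    "\<And>x. x \<in> S \<Longrightarrow> norm (f' x) \<le> B" "x \<in> S" "y \<in> S"
  shows "norm (f x - f y) \<le> B * \<bar>x - y\<bar>"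
proof -
  have "onorm (\<lambda>h. h *\<^sub>R f' z) \<le> B" if "z \<in> S" for z
    using assms(3)[OF that] order_trans[OF norm_ge_zero assms(3)[OF that]]
    by (intro onorm_bound) (auto simp: mult.commute[of B] intro!: mult_left_mono)
  then have "norm (f x - f y) \<le> B * norm (x - y)"
    using assms by (intro differentiable_bound[of S f "\<lambda>z h. h *\<^sub>R f' z"]) (auto simp: has_vector_derivative_def)
  then show ?thesis by simp
qed

section \<open>Gluing in time\<close>

lemma cont_per_Un:
  assumes "cont_per {0..b} u" "cont_per {b..<c} u" "0 \<le> b" "b < c"
  shows "cont_per {0..<c} u"
proof -
  have e: "{0..<c} = {0..b} \<union> {b..<c}" using assms(3,4) by auto
  have "continuous_on ({0..b} \<times> UNIV \<union> {b..<c} \<times> UNIV) (\<lambda>(t, x). u t x)"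
  proof (rule continuous_on_Un_local)
    have "closed ({..b} \<times> (UNIV :: real set))" "closed ({b..} \<times> (UNIV :: real set))" by (intro closed_Times; simp)+
    moreover have "{0..b} \<times> UNIV = ({0..b} \<times> UNIV \<union> {b..<c} \<times> UNIV) \<inter> ({..b} \<times> (UNIV :: real set))"
      "{b..<c} \<times> UNIV = ({0..b} \<times> UNIV \<union> {b..<c} \<times> UNIV) \<inter> ({b..} \<times> (UNIV :: real set))"
      using assms(3,4) by auto
    ultimately show "closedin (top_of_set ({0..b} \<times> UNIV \<union> {b..<c} \<times> (UNIV :: real set))) ({0..b} \<times> UNIV)"
      "closedin (top_of_set ({0..b} \<times> UNIV \<union> {b..<c} \<times> (UNIV :: real set))) ({b..<c} \<times> UNIV)"
      by (metis closedin_closed_Int)+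
  qed (use assms in \<open>auto simp: cont_per_def\<close>)
  then show ?thesis using assms unfolding cont_per_def e by (auto simp: Sigma_Un_distrib1)
qed

text \<open>Space derivatives are taken at fixed time. On both pieces they are the same function
  \<open>dx u\<close>, so only joint continuity has to be glued.\<close>

lemma CX_Un:
  assumes "0 \<le> b" "b < c"
  shows "CX n {0..b} u \<Longrightarrow> CX n {b..<c} u \<Longrightarrow> CX n {0..<c} u"
proof (induction n arbitrary: u)
  case 0
  then show ?case using cont_per_Un[OF _ _ assms] by simp
next
  case (Suc n)
  note d = CX_dx[OF Suc.prems(1)] CX_dx[OF Suc.prems(2)]
  show ?case
  proof (rule CX_SucI[OF _ Suc.IH[OF d(1,3)]])
    show "cont_per {0..<c} u" using cont_per_Un[OF CX_cont_per CX_cont_per assms] Suc.prems by blast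
    show "(u t has_vector_derivative dx u t x) (at x)" if "t \<in> {0..<c}" for t x
      using d(2)[of t x] d(4)[of t x] that by (cases "t \<le> b") auto
  qed
qed

lemma cont_per_shift:
  assumes "cont_per {0..<e} u" shows "cont_per {b..<b + e} (\<lambda>t. u (t - b))"
proof -
  have "continuous_on ({b..<b + e} \<times> UNIV) (\<lambda>p. (\<lambda>(t, x). u t x) (fst p - b, snd p))"
    by (rule continuous_on_compose2[of "{0..<e} \<times> UNIV"])
      (use assms in \<open>auto simp: cont_per_def intro!: continuous_intros\<close>)
  then show ?thesis using assms by (auto simp: cont_per_def case_prod_beta')
qed

lemma CX_shift:
  "CX n {0..<e} u \<Longrightarrow> CX n {b..<b + e} (\<lambda>t. u (t - b))"
proof (induction n arbitrary: u)
  case 0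
  then show ?case using cont_per_shift by simp
next
  case (Suc n)
  note d = CX_dx[OF Suc.prems]
  have dd: "dx (\<lambda>t. u (t - b)) = (\<lambda>t. dx u (t - b))" by (intro ext) (simp add: dx_def)
  have "CX n {b..<b + e} (dx (\<lambda>t. u (t - b)))" unfolding dd by (rule Suc.IH[OF d(1)])
  then show ?case
    by (rule CX_SucI[OF cont_per_shift[OF CX_cont_per[OF Suc.prems]]]) (use d(2) in \<open>auto simp: dd\<close>)
qed

context bounded_flow
begin

section \<open>The limit curve at the final time\<close>

lemma tm_pos: "0 < tm" using zero_J by (simp add: J_eq)

lemma dx_pow_st: "st J ((dx ^^ i) f)"
  by (induction i) (auto intro: f_st st_dx[OF time])

lemma dt_dx_pow: "t \<in> J \<Longrightarrow> dt J ((dx ^^ i) f) t x = (dx ^^ i) vel t x"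
proof (induction i arbitrary: x)
  case 0 then show ?case by (simp add: dt_f)
next
  case (Suc i)
  have "dt J (dx ((dx ^^ i) f)) t x = dx (dt J ((dx ^^ i) f)) t x" by (rule dt_dx[OF dx_pow_st Suc.prems])
  also have "dt J ((dx ^^ i) f) t = (dx ^^ i) vel t" by (rule ext) (rule Suc.IH[OF Suc.prems])
  then have "dx (dt J ((dx ^^ i) f)) t x = dx ((dx ^^ i) vel) t x" by (simp add: dx_def)
  finally show ?case by simp
qed

lemma dx_pow_lipschitz:
  obtains L where "L \<ge> 0" "\<And>t s x y. t \<in> J \<Longrightarrow> s \<in> J \<Longrightarrow>
    norm ((dx ^^ i) f t x - (dx ^^ i) f s y) \<le> L * \<bar>t - s\<bar> + L * \<bar>x - y\<bar>"
proof -
  obtain A where A: "\<forall>t\<in>J. \<forall>x. norm ((dx ^^ Suc i) f t x) \<le> A" using apriori_bounds(1) by blast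
  obtain B where B: "\<forall>t\<in>J. \<forall>x. norm ((dx ^^ i) vel t x) \<le> B" using apriori_bounds(2) by blast
  define L where "L = max 0 (max A B)"
  have L: "L \<ge> 0" "A \<le> L" "B \<le> L" by (auto simp: L_def)
  have "norm ((dx ^^ i) f t x - (dx ^^ i) f s y) \<le> L * \<bar>t - s\<bar> + L * \<bar>x - y\<bar>" if t: "t \<in> J" and s: "s \<in> J" for t s x y
  proof -
    have 1: "norm ((dx ^^ i) f t x - (dx ^^ i) f s x) \<le> L * \<bar>t - s\<bar>"
    proof (rule vector_derivative_lipschitz[OF _ _ _ t s])
      show "((\<lambda>t. (dx ^^ i) f t x) has_vector_derivative (dx ^^ i) vel r x) (at r within J)" if "r \<in> J" for r
        using st_dt(1)[OF time dx_pow_st that] dt_dx_pow[OF that] by simp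
      show "norm ((dx ^^ i) vel r x) \<le> L" if "r \<in> J" for r using B that L(3) order_trans by blast
    qed (simp add: J_eq)
    have 2: "norm ((dx ^^ i) f s x - (dx ^^ i) f s y) \<le> L * \<bar>x - y\<bar>"
    proof (rule vector_derivative_lipschitz[of UNIV "(dx ^^ i) f s" "(dx ^^ Suc i) f s"])
      show "((dx ^^ i) f s has_vector_derivative (dx ^^ Suc i) f s z) (at z within UNIV)" for z
        using sm_deriv[OF st_imp_sm[OF dx_pow_st], of i s z] by simp
      show "norm ((dx ^^ Suc i) f s z) \<le> L" for z using A s L(2) order_trans by blast
    qed auto
    show ?thesis using norm_triangle_mono[OF 1 2] by simp
  qed
  then show thesis using that L(1) by blast
qed

text \<open>A Lipschitz function on \<open>J \<times> UNIV\<close> extends to the closure. The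
  factor 2 in the Lipschitz constant stems from the two coordinate distances, each at most the
  distance in the product.\<close>

lemma continuous_extension:
  "\<exists>G. continuous_on ({0..tm} \<times> UNIV) (\<lambda>(t, x). G t x) \<and> (\<forall>t\<in>J. \<forall>x. G t x = (dx ^^ i) f t x)"
proof -
  obtain L where L: "L \<ge> 0" "\<And>t s x y. t \<in> J \<Longrightarrow> s \<in> J \<Longrightarrow>
    norm ((dx ^^ i) f t x - (dx ^^ i) f s y) \<le> L * \<bar>t - s\<bar> + L * \<bar>x - y\<bar>" using dx_pow_lipschitz[of i] by metis
  have "(2 * L)-lipschitz_on (J \<times> UNIV) (\<lambda>(t, x). (dx ^^ i) f t x)"
  proof (rule lipschitz_onI)
    fix p q :: "real \<times> real" assume p: "p \<in> J \<times> UNIV" and q: "q \<in> J \<times> UNIV"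
    have "L * \<bar>fst p - fst q\<bar> + L * \<bar>snd p - snd q\<bar> \<le> L * dist p q + L * dist p q"
      using dist_fst_le[of p q] dist_snd_le[of p q] L(1)
      by (intro add_mono mult_left_mono) (auto simp: dist_real_def)
    then show "dist (case p of (t, x) \<Rightarrow> (dx ^^ i) f t x) (case q of (t, x) \<Rightarrow> (dx ^^ i) f t x) \<le> 2 * L * dist p q"
      using L(2)[of "fst p" "fst q" "snd p" "snd q"] p q by (auto simp: dist_norm case_prod_beta')
  qed (use L in simp)
  from lipschitz_extend_closure[OF this] obtain G where
    G: "(2 * L)-lipschitz_on (closure (J \<times> UNIV)) G" "\<forall>p\<in>J \<times> UNIV. G p = (\<lambda>(t, x). (dx ^^ i) f t x) p" by blast
  have "closure (J \<times> (UNIV :: real set)) = {0..tm} \<times> UNIV"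
    using tm_pos by (simp add: closure_Times J_eq)
  then have "continuous_on ({0..tm} \<times> UNIV) G"
    using lipschitz_on_continuous_on[OF G(1)] by simp
  then show ?thesis using G(2) by (intro exI[of _ "\<lambda>t x. G (t, x)"]) auto
qed

text \<open>Each order is extended separately, so it has to be shown that the extensions are
  derivatives of one another also at the final time. Their linearization error is quadratic with a
  constant uniform in time, and this inequality survives the limit. So do periodicity and the lower
  bound of \<open>w\<close>, which keeps the limit curve regular.\<close>

lemma extension_at_end:
  obtains F where "CT 0 {0..tm} F" "\<And>t. t \<in> J \<Longrightarrow> F t = f t" "\<And>x. dx F tm x \<noteq> 0"
proof -
  have cl: "closure J = {0..tm}" using tm_pos by (simp add: J_eq)
  have "\<forall>i. \<exists>G. continuous_on ({0..tm} \<times> UNIV) (\<lambda>(t, x). G t x) \<and> (\<forall>t\<in>J. \<forall>x. G t x = (dx ^^ i) f t x)"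
    using continuous_extension by blast
  then obtain G where G: "\<And>i. continuous_on ({0..tm} \<times> UNIV) (\<lambda>(t, x). G i t x)"
    "\<And>i t x. t \<in> J \<Longrightarrow> G i t x = (dx ^^ i) f t x" by metis
  have ct: "continuous_on {0..tm} (\<lambda>t. G i t x)" for i x
    by (rule continuous_on_compose2[OF G(1)[of i], of _ "\<lambda>t. (t, x)", simplified]) (auto intro!: continuous_intros)
  have lim: "h t \<le> a" if "continuous_on {0..tm} h" "\<And>t. t \<in> J \<Longrightarrow> h t \<le> a" "t \<in> {0..tm}" for h :: "real \<Rightarrow> real" and a t
    using continuous_le_on_closure[of J h t a] that cl by simp
  have deriv: "(G i t has_vector_derivative G (Suc i) t x) (at x)" if t: "t \<in> {0..tm}" for i t x
  proof -
    obtain L where L: "L \<ge> 0" "\<And>t s x y. t \<in> J \<Longrightarrow> s \<in> J \<Longrightarrow>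
      norm ((dx ^^ Suc i) f t x - (dx ^^ Suc i) f s y) \<le> L * \<bar>t - s\<bar> + L * \<bar>x - y\<bar>" using dx_pow_lipschitz[of "Suc i"] by metis
    have est: "norm (G i t y - G i t x - (y - x) *\<^sub>R G (Suc i) t x) \<le> L * \<bar>y - x\<bar> * \<bar>y - x\<bar>" for y
    proof (rule lim[OF _ _ t])
      show "continuous_on {0..tm} (\<lambda>t. norm (G i t y - G i t x - (y - x) *\<^sub>R G (Suc i) t x))"
        by (intro continuous_intros ct)
      fix s assume s: "s \<in> J"
      have "norm ((dx ^^ i) f s y - (dx ^^ i) f s x - (y - x) *\<^sub>R (dx ^^ Suc i) f s x) \<le> norm (y - x) * (L * \<bar>y - x\<bar>)"
      proof (rule vector_differentiable_bound_linearization[of "closed_segment x y"])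
        show "((dx ^^ i) f s has_vector_derivative (dx ^^ Suc i) f s z) (at z within closed_segment x y)" for z
          using has_vector_derivative_at_within[OF sm_deriv[OF st_imp_sm[OF dx_pow_st], of i s z]] by simp
        fix z assume "z \<in> closed_segment x y"
        then have "\<bar>z - x\<bar> \<le> \<bar>y - x\<bar>" by (auto simp: closed_segment_eq_real_ivl split: if_splits)
        then have "L * \<bar>z - x\<bar> \<le> L * \<bar>y - x\<bar>" using L(1) by (rule mult_left_mono)
        then show "norm ((dx ^^ Suc i) f s z - (dx ^^ Suc i) f s x) \<le> L * \<bar>y - x\<bar>"
          using L(2)[OF s s, of z x] by simp
      qed auto
      then show "norm (G i s y - G i s x - (y - x) *\<^sub>R G (Suc i) s x) \<le> L * \<bar>y - x\<bar> * \<bar>y - x\<bar>"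
        using G(2)[OF s] by (simp add: mult_ac)
    qed
    have "(G i t has_derivative (\<lambda>h. h *\<^sub>R G (Suc i) t x)) (at x within UNIV)"
    proof (rule has_derivativeI_sandwich[of 1])
      show "norm (G i t y - G i t x - (y - x) *\<^sub>R G (Suc i) t x) / norm (y - x) \<le> L * \<bar>y - x\<bar>" if "y \<noteq> x" for y
        using est[of y] that by (simp add: divide_le_eq)
      have "((\<lambda>y. L * \<bar>y - x\<bar>) \<longlongrightarrow> L * \<bar>x - x\<bar>) (at x)" by (intro tendsto_intros)
      then show "((\<lambda>y. L * \<bar>y - x\<bar>) \<longlongrightarrow> 0) (at x within UNIV)" by simp
    qed (auto intro: bounded_linear_scaleR_left)
    then show ?thesis by (simp add: has_vector_derivative_def)
  qed
  have per: "G i t (x + 2 * pi) = G i t x" if t: "t \<in> {0..tm}" for i t x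
  proof -
    have "norm (G i t (x + 2 * pi) - G i t x) \<le> 0"
    proof (rule lim[OF _ _ t])
      show "continuous_on {0..tm} (\<lambda>t. norm (G i t (x + 2 * pi) - G i t x))" by (intro continuous_intros ct)
      show "norm (G i s (x + 2 * pi) - G i s x) \<le> 0" if "s \<in> J" for s
        using G(2)[OF that] sm_per[OF st_imp_sm[OF dx_pow_st], of i s x] by simp
    qed
    then show ?thesis by simp
  qed
  have cp: "cont_per {0..tm} (G i)" for i unfolding cont_per_def using G(1) per by auto
  have X: "CX n {0..tm} (G i)" for n i
  proof (induction n arbitrary: i)
    case (Suc n)
    show ?case by (rule CX_SucI[OF cp Suc.IH deriv])
  qed (simp add: cp)
  obtain c where c: "c > 0" "\<And>t x. t \<in> J \<Longrightarrow> c \<le> w t x" using w_bounds by metis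
  have "dx (G 0) tm x \<noteq> 0" for x
  proof -
    \<comment> \<open>Negated because \<open>lim\<close> transports upper bounds.\<close>
    have "- norm (G 1 tm x) \<le> - c"
    proof (rule lim[of "\<lambda>t. - norm (G 1 t x)"])
      show "continuous_on {0..tm} (\<lambda>t. - norm (G 1 t x))" by (intro continuous_intros ct)
      show "- norm (G 1 t x) \<le> - c" if "t \<in> J" for t using c(2)[OF that, of x] G(2)[OF that, of 1 x] by (simp add: w_def)
    qed (use tm_pos in simp)
    moreover have "dx (G 0) tm x = G 1 tm x"
      using vector_derivative_at[OF deriv[of tm 0 x]] tm_pos by (simp add: dx_def)
    ultimately show ?thesis using c(1) by auto
  qed
  moreover have "CT 0 {0..tm} (G 0)" using X by simp
  moreover have "\<And>t. t \<in> J \<Longrightarrow> G 0 t = f t" using G(2)[of _ 0] by auto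
  ultimately show thesis using that by blast
qed

end

lemma solves_cong:
  assumes "solves lam J u" "\<And>t. t \<in> J \<Longrightarrow> u t = v t" shows "solves lam J v"
proof -
  have "CT 0 J v" using assms by (intro CT_cong[of 0 J u v]) (auto simp: solves_def)
  moreover have "((\<lambda>s. v s x) has_vector_derivative flow_velocity lam (v t) x) (at t within J)" if t: "t \<in> J" for t x
  proof -
    have "((\<lambda>s. u s x) has_vector_derivative flow_velocity lam (u t) x) (at t within J)"
      using assms(1) t by (simp add: solves_def)
    then show ?thesis
      using has_vector_derivative_transform[OF t, of "\<lambda>s. v s x" "\<lambda>s. u s x"] assms(2) t by simp
  qed
  ultimately show ?thesis using assms by (simp add: solves_def dx_def)
qed

lemma time_interval_Ico: "0 < b \<Longrightarrow> time_interval {0..<b}"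
  unfolding time_interval_def
proof (intro conjI ballI)
  fix t assume "t \<in> {0..<b}"
  then show "0 \<le> t" "\<exists>b'>t. {0..b'} \<subseteq> {0..<b}" by (auto intro!: exI[of _ "(t + b) / 2"])
qed auto

lemma time_interval_atLeast: "time_interval {0..}"
  unfolding time_interval_def by (auto intro: gt_ex)

lemma flow_solution_restrict:
  assumes "flow_solution lam f0 {0..b} f" "0 < b" shows "flow_solution lam f0 {0..<b} f"
proof -
  have s: "{0..<b} \<subseteq> {0..b}" by auto
  have "smooth_on ({0..<b} \<times> UNIV) (\<lambda>(t, x). f t x)"
    by (rule smooth_on_subset) (use assms s in \<open>auto simp: flow_solution_def\<close>)
  moreover have "((\<lambda>s. f s x) has_vector_derivative flow_velocity lam (f t) x) (at t within {0..<b})"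
    if "t \<in> {0..<b}" for t x
    by (rule has_vector_derivative_within_subset[OF _ s]) (use assms that in \<open>auto simp: flow_solution_def\<close>)
  ultimately show ?thesis using assms by (auto simp: flow_solution_def)
qed

text \<open>At the junction time the equation holds because both sides are continuous in time.\<close>

lemma glue_solutions:
  fixes f h :: "real \<Rightarrow> real \<Rightarrow> 'a::euclidean_space"
  assumes b: "0 < b" and e: "0 < e" and f: "solves lam {0..<b} f" and h: "solves lam {0..<e} h"
    and F: "CT 0 {0..b} F" "\<And>t. t \<in> {0..<b} \<Longrightarrow> F t = f t" "F b = h 0"
  shows "solves lam {0..<b + e} (\<lambda>t. if t < b then f t else h (t - b))"
proof -
  define u where "u = (\<lambda>t. if t < b then f t else h (t - b))"
  let ?J = "{0..<b + e}"
  have J: "time_interval ?J" using b e by (intro time_interval_Ico) auto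
  have "CX n ?J u" for n
  proof (rule CX_Un)
    \<comment> \<open>The piece includes the time \<open>b\<close>, where \<open>u\<close> already
      takes the value \<open>h 0\<close>; \<open>F\<close> provides smoothness up to there.\<close>
    show "CX n {0..b} u" by (rule CX_cong[of n _ F]) (use F CT_CX[OF F(1)] in \<open>auto simp: u_def\<close>)
    show "CX n {b..<b + e} u"
      by (rule CX_cong[OF CX_shift[of n e h b]]) (use h CT_CX in \<open>auto simp: u_def solves_def simp del: CX.simps CT.simps\<close>)
  qed (use b e in auto)
  then have C: "CT 0 ?J u" by simp
  have nz: "dx u t x \<noteq> 0" if "t \<in> ?J" for t x
    using f h that by (auto simp: u_def solves_def dx_def)
  have cv: "cont_per ?J (\<lambda>t. flow_velocity lam (u t))"
    by (rule CX_cont_per[OF CT_CX[OF CT_flow_velocity[OF J C nz], of 0]])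
  have cu: "cont_per ?J u" by (rule CX_cont_per[OF CT_CX[OF C, of 0]])
  have der: "((\<lambda>s. u s x) has_vector_derivative flow_velocity lam (u t) x) (at t)"
    if t: "0 < t" "t < b + e" "t \<noteq> b" for t x
  proof (cases "t < b")
    case True
    have "((\<lambda>s. f s x) has_vector_derivative flow_velocity lam (f t) x) (at t within {0..<b})"
      using f True t by (simp add: solves_def)
    moreover have "at t within {0..<b} = at t" using True t by (intro at_within_interior) simp
    ultimately have "((\<lambda>s. f s x) has_vector_derivative flow_velocity lam (f t) x) (at t)" by simp
    then have "((\<lambda>s. u s x) has_vector_derivative flow_velocity lam (f t) x) (at t)"
      by (rule has_vector_derivative_transform_within_open[of _ _ _ "{..<b}"]) (use True in \<open>auto simp: u_def\<close>)
    then show ?thesis using True by (simp add: u_def)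
  next
    case False
    have "((\<lambda>s. h s x) has_vector_derivative flow_velocity lam (h (t - b)) x) (at (t - b) within {0..<e})"
      using h False t by (simp add: solves_def)
    moreover have "at (t - b) within {0..<e} = at (t - b)" using False t by (intro at_within_interior) simp
    ultimately have "((\<lambda>s. h s x) has_vector_derivative flow_velocity lam (h (t - b)) x) (at (t - b))" by simp
    then have "((\<lambda>s. h s x) \<circ> (\<lambda>s. s - b) has_vector_derivative 1 *\<^sub>R flow_velocity lam (h (t - b)) x) (at t)"
      by (intro vector_diff_chain_at) (auto intro!: derivative_eq_intros)
    then have "((\<lambda>s. h (s - b) x) has_vector_derivative flow_velocity lam (h (t - b)) x) (at t)" by (simp add: o_def)
    then have "((\<lambda>s. u s x) has_vector_derivative flow_velocity lam (h (t - b)) x) (at t)"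
      by (rule has_vector_derivative_transform_within_open[of _ _ _ "{b<..}"]) (use False t in \<open>auto simp: u_def\<close>)
    then show ?thesis using False by (simp add: u_def)
  qed
  have "((\<lambda>s. u s x) has_vector_derivative flow_velocity lam (u t) x) (at t within ?J)" if t: "t \<in> ?J" for t x
  proof -
    obtain c where c: "c > t" "{0..c} \<subseteq> ?J" "t \<in> {0..c}" "at t within ?J = at t within {0..c}"
      using time_interval_within[OF J t] by blast
    \<comment> \<open>The fundamental theorem of calculus for a continuous function tolerates the
      single exceptional time \<open>b\<close>, and differentiating the integral recovers the
      equation there as well.\<close>
    have eq: "u s x = u 0 x + integral {0..s} (\<lambda>r. flow_velocity lam (u r) x)" if s: "s \<in> {0..c}" for s
    proof -
      have sJ: "{0..s} \<subseteq> ?J" using s c(2) by auto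
      have "((\<lambda>r. flow_velocity lam (u r) x) has_integral (u s x - u 0 x)) {0..s}"
      proof (rule fundamental_theorem_of_calculus_interior_strong[of "{b}"])
        show "continuous_on {0..s} (\<lambda>r. u r x)" by (rule cont_per_slices(1)[OF cu sJ])
        fix r assume r: "r \<in> {0<..<s} - {b}"
        then have "r \<in> {0..s}" by auto
        then have "r \<in> ?J" using sJ by blast
        then show "((\<lambda>r. u r x) has_vector_derivative flow_velocity lam (u r) x) (at r)"
          using r by (intro der) auto
      qed (use s in auto)
      then show ?thesis by (simp add: integral_unique)
    qed
    have "((\<lambda>s. u 0 x + integral {0..s} (\<lambda>r. flow_velocity lam (u r) x)) has_vector_derivative 0 + flow_velocity lam (u t) x) (at t within {0..c})"
      by (rule has_vector_derivative_add[OF has_vector_derivative_const integral_has_vector_derivative])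
        (rule cont_per_slices(1)[OF cv c(2)], rule c(3))
    then have "((\<lambda>s. u s x) has_vector_derivative 0 + flow_velocity lam (u t) x) (at t within {0..c})"
      by (rule has_vector_derivative_transform[OF c(3), rotated]) (rule eq)
    then show ?thesis unfolding c(4) by simp
  qed
  then show ?thesis using C nz unfolding solves_def u_def by blast
qed

lemma extend_solution:
  fixes f :: "real \<Rightarrow> real \<Rightarrow> 'a::euclidean_space"
  assumes lam: "lam > 0" and b: "0 < b" and f: "solves lam {0..<b} f"
    and ste: "\<And>g :: real \<Rightarrow> 'a. smooth_regular_closed_curve g \<Longrightarrow> \<exists>T>0. \<exists>f. flow_solution lam g {0..T} f"
  shows "\<exists>e>0. \<exists>F. solves lam {0..<b + e} F \<and> (\<forall>t\<in>{0..<b}. F t = f t)"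
proof -
  \<comment> \<open>The values of \<open>f\<close> beyond its interval are arbitrary; freezing them
    meets the convention of the locale.\<close>
  define f' where "f' = (\<lambda>t. if t \<in> {0..<b} then f t else f 0)"
  interpret bounded_flow "{0..<b}" lam f' b
  proof
    show "time_interval {0..<b}" by (rule time_interval_Ico[OF b])
    show "solves lam {0..<b} f'" by (rule solves_cong[OF f]) (simp add: f'_def)
    show "f' t = f' 0" if "t \<notin> {0..<b}" for t using that b by (auto simp: f'_def)
  qed (rule lam refl)+
  obtain F where F: "CT 0 {0..b} F" "\<And>t. t \<in> {0..<b} \<Longrightarrow> F t = f' t" "\<And>x. dx F b x \<noteq> 0"
    using extension_at_end by metis
  have "smooth_regular_closed_curve (F b)"
  proof -
    have X: "CX n {0..b} F" for n by (rule CT_CX[OF F(1)])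
    have "smooth_on UNIV (F b)" unfolding smooth_on_def using CX_imp_Ck_on[OF X, of b] b by simp
    moreover have "F b (x + 2 * pi) = F b x" for x
      using CX_cont_per[OF X[of 0]] b by (simp add: cont_per_def)
    ultimately show ?thesis using F(3) by (simp add: smooth_regular_closed_curve_def dx_def)
  qed
  then obtain e h where e: "0 < e" and h: "flow_solution lam (F b) {0..e} h" using ste by blast
  have h': "solves lam {0..<e} h" "h 0 = F b"
    using flow_solution_restrict[OF h e] unfolding solves_iff_flow_solution[OF time_interval_Ico[OF e]] by auto
  have "solves lam {0..<b + e} (\<lambda>t. if t < b then f t else h (t - b))"
    by (rule glue_solutions[OF b e f h'(1) F(1)]) (use F(2) h'(2) in \<open>auto simp: f'_def\<close>)
  then show ?thesis using e by (intro exI[of _ e] conjI exI[of _ "\<lambda>t. if t < b then f t else h (t - b)"]) auto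
qed

section \<open>Unions of solutions and the maximal solution\<close>

lemma at_within_prefix:
  assumes "t < (b::real)" "{0..<b} \<subseteq> D" "\<And>s. s \<in> D \<Longrightarrow> 0 \<le> s"
  shows "at (t, x) within D \<times> (UNIV :: real set) = at (t, x) within {0..<b} \<times> UNIV" "at t within D = at t within {0..<b}"
proof -
  show "at (t, x) within D \<times> (UNIV :: real set) = at (t, x) within {0..<b} \<times> UNIV"
  proof (rule at_within_nhd[of _ "{..<b} \<times> UNIV"])
    show "open ({..<b} \<times> (UNIV :: real set))" by (intro open_Times) auto
    show "D \<times> UNIV \<inter> {..<b} \<times> UNIV - {(t, x)} = {0..<b} \<times> UNIV \<inter> {..<b} \<times> UNIV - {(t, x)}"
      using assms by auto
  qed (use assms in auto)
  show "at t within D = at t within {0..<b}"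
    by (rule at_within_nhd[of _ "{..<b}"]) (use assms in auto)
qed

lemma cont_per_union:
  assumes D: "\<And>s. s \<in> D \<Longrightarrow> 0 \<le> s"
    and P: "\<And>t. t \<in> D \<Longrightarrow> \<exists>b>t. {0..<b} \<subseteq> D \<and> cont_per {0..<b} u"
  shows "cont_per D u"
  unfolding cont_per_def
proof (intro conjI ballI allI)
  show "continuous_on (D \<times> UNIV) (\<lambda>(t, x). u t x)"
    unfolding continuous_on_eq_continuous_within
  proof safe
    fix t x assume t: "t \<in> D"
    from P[OF t] obtain b where b: "b > t" "{0..<b} \<subseteq> D" "cont_per {0..<b} u" by blast
    have "continuous (at (t, x) within {0..<b} \<times> UNIV) (\<lambda>(t, x). u t x)"
      using b(1,3) D[OF t] by (auto simp: cont_per_def continuous_on_eq_continuous_within)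
    moreover have "at (t, x) within D \<times> UNIV = at (t, x) within {0..<b} \<times> UNIV"
      by (rule at_within_prefix(1)[OF b(1,2) D])
    ultimately show "continuous (at (t, x) within D \<times> UNIV) (\<lambda>(t, x). u t x)" by simp
  qed
  fix t x assume t: "t \<in> D"
  from P[OF t] obtain b where b: "b > t" "cont_per {0..<b} u" by blast
  then show "u t (x + 2 * pi) = u t x" using D[OF t] by (auto simp: cont_per_def)
qed

lemma CX_union:
  assumes D: "\<And>s. s \<in> D \<Longrightarrow> 0 \<le> s"
  shows "(\<And>t. t \<in> D \<Longrightarrow> \<exists>b>t. {0..<b} \<subseteq> D \<and> CX n {0..<b} u) \<Longrightarrow> CX n D u"
proof (induction n arbitrary: u)
  case 0
  have "cont_per D u" by (rule cont_per_union[OF D]) (use 0 in auto)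
  then show ?case by simp
next
  case (Suc n)
  have "cont_per D u"
  proof (rule cont_per_union[OF D])
    fix t assume "t \<in> D"
    from Suc.prems[OF this] show "\<exists>b>t. {0..<b} \<subseteq> D \<and> cont_per {0..<b} u" using CX_cont_per by blast
  qed
  moreover have "CX n D (dx u)"
  proof (rule Suc.IH)
    fix t assume "t \<in> D"
    from Suc.prems[OF this] show "\<exists>b>t. {0..<b} \<subseteq> D \<and> CX n {0..<b} (dx u)" using CX_dx(1) by blast
  qed
  moreover have "(u t has_vector_derivative dx u t x) (at x)" if t: "t \<in> D" for t x
  proof -
    from Suc.prems[OF t] obtain b where "b > t" "CX (Suc n) {0..<b} u" by blast
    then show ?thesis using CX_dx(2)[of n "{0..<b}" u t x] D[OF t] by simp
  qed
  ultimately show ?case by (rule CX_SucI)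
qed

text \<open>All requirements are local in time: at each \<open>t\<close> the filters within
  \<open>D\<close> and within a suitable \<open>{0..<b}\<close> agree.\<close>

lemma solves_union:
  fixes F :: "real \<Rightarrow> real \<Rightarrow> 'a::euclidean_space"
  assumes D: "\<And>s. s \<in> D \<Longrightarrow> 0 \<le> s"
    and P: "\<And>t. t \<in> D \<Longrightarrow> \<exists>b>t. {0..<b} \<subseteq> D \<and> solves lam {0..<b} F"
  shows "solves lam D F"
  unfolding solves_def
proof (intro conjI ballI allI)
  have "CX n D F" for n
  proof (rule CX_union[OF D])
    fix t assume "t \<in> D"
    from P[OF this] show "\<exists>b>t. {0..<b} \<subseteq> D \<and> CX n {0..<b} F" unfolding solves_def using CT_CX by blast
  qed
  then show "CT 0 D F" by simp
  fix t x assume t: "t \<in> D"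
  from P[OF t] obtain b where b: "b > t" "{0..<b} \<subseteq> D" "solves lam {0..<b} F" by blast
  then show "dx F t x \<noteq> 0" using D[OF t] by (simp add: solves_def)
  have "at t within D = at t within {0..<b}" by (rule at_within_prefix(2)[OF b(1,2) D])
  then show "((\<lambda>s. F s x) has_vector_derivative flow_velocity lam (F t) x) (at t within D)"
    using b(3,1) D[OF t] by (simp add: solves_def)
qed

text \<open>Solutions from the same curve are not known to agree, so they cannot simply be united.
  If none of them is global, each chain under extension has an upper bound with finite existence
  time, and a maximal solution contradicts \<open>extend_solution\<close>.\<close>

lemma global_solution:
  fixes f0 :: "real \<Rightarrow> 'a::euclidean_space"
  assumes lam: "lam > 0" and f0: "smooth_regular_closed_curve f0"
    and ste: "\<And>g :: real \<Rightarrow> 'a. smooth_regular_closed_curve g \<Longrightarrow> \<exists>T>0. \<exists>f. flow_solution lam g {0..T} f"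
  shows "\<exists>f. solves lam {0..} f \<and> f 0 = f0"
proof (rule ccontr)
  assume none: "\<nexists>f. solves lam {0..} f \<and> f 0 = f0"
  \<comment> \<open>Graphs over \<open>{0..<b}\<close> discard the arbitrary values beyond
    \<open>b\<close> and turn extension of solutions into inclusion of sets.\<close>
  define graph where "graph = (\<lambda>b (f :: real \<Rightarrow> real \<Rightarrow> 'a). (\<lambda>t. (t, f t)) ` {0..<b})"
  define A where "A = {graph b f |b f. 0 < b \<and> solves lam {0..<b} f \<and> f 0 = f0}"
  have "A \<noteq> {}"
  proof -
    obtain T h where T: "0 < T" "flow_solution lam f0 {0..T} h" using ste[OF f0] by blast
    then have "solves lam {0..<T} h \<and> h 0 = f0"
      using flow_solution_restrict[OF T(2,1)] unfolding solves_iff_flow_solution[OF time_interval_Ico[OF T(1)]] by simp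
    then show ?thesis using T(1) unfolding A_def by blast
  qed
  moreover have "\<Union>\<C> \<in> A" if ne: "\<C> \<noteq> {}" and ch: "subset.chain A \<C>" for \<C>
  proof -
    have "\<forall>X\<in>\<C>. \<exists>p. X = graph (fst p) (snd p) \<and> 0 < fst p \<and> solves lam {0..<fst p} (snd p) \<and> snd p 0 = f0"
      using ch unfolding subset.chain_def A_def by fastforce
    from bchoice[OF this] obtain p where p: "\<forall>X\<in>\<C>. X = graph (fst (p X)) (snd (p X)) \<and> 0 < fst (p X) \<and>
      solves lam {0..<fst (p X)} (snd (p X)) \<and> snd (p X) 0 = f0" by blast
    define B where "B = (\<lambda>X. fst (p X))"
    define f where "f = (\<lambda>X. snd (p X))"
    have Bf: "X = graph (B X) (f X)" "0 < B X" "solves lam {0..<B X} (f X)" "f X 0 = f0" if "X \<in> \<C>" for X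
      using p that unfolding B_def f_def by blast+
    have mem: "(t, y) \<in> X \<longleftrightarrow> 0 \<le> t \<and> t < B X \<and> y = f X t" if "X \<in> \<C>" for X t y
      by (subst Bf(1)[OF that]) (auto simp: graph_def)
    have agree: "f X t = f Y t" if "X \<in> \<C>" "Y \<in> \<C>" "0 \<le> t" "t < B X" "t < B Y" for X Y t
    proof -
      have "X \<subseteq> Y \<or> Y \<subseteq> X" using ch that(1,2) unfolding subset.chain_def by auto
      moreover have "(t, f X t) \<in> X" "(t, f Y t) \<in> Y" using mem that by auto
      ultimately have "(t, f X t) \<in> Y \<or> (t, f Y t) \<in> X" by auto
      then show ?thesis using mem[OF that(2), of t "f X t"] mem[OF that(1), of t "f Y t"] by auto
    qed
    \<comment> \<open>Any member of the chain that lives beyond \<open>t\<close> may be chosen,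
      since members agree where both are defined.\<close>
    define F where "F = (\<lambda>t. f (SOME X. X \<in> \<C> \<and> t < B X) t)"
    have F: "F t = f X t" if "X \<in> \<C>" "0 \<le> t" "t < B X" for X t
    proof -
      have "(SOME X. X \<in> \<C> \<and> t < B X) \<in> \<C> \<and> t < B (SOME X. X \<in> \<C> \<and> t < B X)"
        by (rule someI[of "\<lambda>X. X \<in> \<C> \<and> t < B X" X]) (use that in simp)
      then show ?thesis unfolding F_def using agree that by blast
    qed
    define D where "D = (\<Union>X\<in>\<C>. {0..<B X})"
    have "solves lam D F"
    proof (rule solves_union)
      show "0 \<le> s" if "s \<in> D" for s using that by (auto simp: D_def)
      fix t assume "t \<in> D"
      then obtain X where X: "X \<in> \<C>" "0 \<le> t" "t < B X" by (auto simp: D_def)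
      have "solves lam {0..<B X} F" by (rule solves_cong[OF Bf(3)[OF X(1)]]) (use F[OF X(1)] in auto)
      then show "\<exists>b>t. {0..<b} \<subseteq> D \<and> solves lam {0..<b} F" using X by (intro exI[of _ "B X"]) (auto simp: D_def)
    qed
    obtain X0 where X0: "X0 \<in> \<C>" using ne by blast
    have F0: "F 0 = f0" using F[OF X0, of 0] Bf(2,4)[OF X0] by simp
    \<comment> \<open>A chain with unbounded existence times would unite to a solution on
      \<open>{0..}\<close>, against the assumption \<open>none\<close>.\<close>
    have bd: "bdd_above (B ` \<C>)"
    proof (rule ccontr)
      assume "\<not> bdd_above (B ` \<C>)"
      have "\<exists>X\<in>\<C>. t < B X" for t
      proof (rule ccontr)
        assume "\<not> (\<exists>X\<in>\<C>. t < B X)"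
        then have "bdd_above (B ` \<C>)" by (intro bdd_aboveI2[of _ _ t]) (auto simp: not_less)
        with \<open>\<not> bdd_above (B ` \<C>)\<close> show False ..
      qed
      then have "D = {0..}" unfolding D_def by fastforce
      with \<open>solves lam D F\<close> F0 none show False by blast
    qed
    define b where "b = Sup (B ` \<C>)"
    have up: "B X \<le> b" if "X \<in> \<C>" for X unfolding b_def by (rule cSUP_upper[OF that bd])
    have D: "D = {0..<b}"
    proof
      show "D \<subseteq> {0..<b}" using up unfolding D_def by fastforce
      show "{0..<b} \<subseteq> D"
      proof
        fix t assume t: "t \<in> {0..<b}"
        then have "\<exists>X\<in>\<C>. t < B X" using less_cSUP_iff[OF ne bd, of t] unfolding b_def by auto
        then show "t \<in> D" using t unfolding D_def by auto
      qed
    qed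
    have "\<Union>\<C> = graph b F"
    proof (rule set_eqI)
      fix p :: "real \<times> (real \<Rightarrow> 'a)"
      obtain t y where p: "p = (t, y)" by (cases p)
      have "p \<in> \<Union>\<C> \<longleftrightarrow> (\<exists>X\<in>\<C>. 0 \<le> t \<and> t < B X \<and> y = f X t)"
        unfolding p Union_iff by (intro bex_cong refl mem)
      also have "\<dots> \<longleftrightarrow> (\<exists>X\<in>\<C>. 0 \<le> t \<and> t < B X \<and> y = F t)"
        by (intro bex_cong refl) (use F in auto)
      also have "\<dots> \<longleftrightarrow> t \<in> D \<and> y = F t" unfolding D_def by auto
      also have "\<dots> \<longleftrightarrow> p \<in> graph b F" unfolding D p graph_def by auto
      finally show "p \<in> \<Union>\<C> \<longleftrightarrow> p \<in> graph b F" .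
    qed
    moreover have "0 < b" using up[OF X0] Bf(2)[OF X0] by linarith
    ultimately show "\<Union>\<C> \<in> A" using \<open>solves lam D F\<close> F0 unfolding A_def D by blast
  qed
  ultimately have "\<exists>M\<in>A. \<forall>X\<in>A. M \<subseteq> X \<longrightarrow> X = M" by (rule subset_Zorn_nonempty)
  then obtain M where M: "M \<in> A" "\<And>X. X \<in> A \<Longrightarrow> M \<subseteq> X \<Longrightarrow> X = M" by blast
  from M(1) obtain b f where bf: "M = graph b f" "0 < b" "solves lam {0..<b} f" "f 0 = f0" unfolding A_def by blast
  obtain e F where e: "0 < e" "solves lam {0..<b + e} F" "\<forall>t\<in>{0..<b}. F t = f t"
    using extend_solution[OF lam bf(2,3) ste] by blast
  have "F 0 = f0" using e(3) bf(2,4) by simp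
  then have "graph (b + e) F \<in> A" using e(1,2) bf(2) unfolding A_def by fastforce
  moreover have "M \<subseteq> graph (b + e) F" using e(1,3) unfolding bf(1) graph_def by fastforce
  ultimately have "graph (b + e) F = M" by (rule M(2))
  \<comment> \<open>The time \<open>b\<close> lies in the extended interval but not in the half-open
    original one.\<close>
  moreover have "(b, F b) \<in> graph (b + e) F" using e(1) bf(2) unfolding graph_def by auto
  moreover have "(b, F b) \<notin> M" unfolding bf(1) graph_def by auto
  ultimately show False by simp
qed

theorem theorem1p1:
  fixes lam :: real and f0 :: "real \<Rightarrow> real ^ 'n"
  assumes lambda_pos: "lam > 0"
    and initial_curve: "smooth_regular_closed_curve f0"
    and short_time_existence:
      "\<And>g :: real \<Rightarrow> real ^ 'n. smooth_regular_closed_curve g \<Longrightarrow>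
         \<exists>T>0. \<exists>f. flow_solution lam g {0..T} f"
  shows "\<exists>f. flow_solution lam f0 {0..} f"
  using global_solution[OF lambda_pos initial_curve short_time_existence]
  unfolding solves_iff_flow_solution[OF time_interval_atLeast] .

end
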